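(* $\mathsf{TT}^1_2$ admits $\Pi^0_1$-class avoidance of bounded enumeration: for every $D\subseteq\omega$, every $S\subseteq 2^{<\omega}$ with no $D$-computable bounded enumeration, and every nonempty $\Pi^{0,D}_1$-class $Q$ of colorings $2^{<\omega}\to 2$, there exist $C\in Q$ and an infinite perfect tree $T\subseteq 2^{<\omega}$ on which $C$ is constant such that $D\oplus T$ computes no bounded enumeration of $S$.
   Context: An infinite perfect tree is a subset of $2^{<\omega}$ which, ordered by the initial-segment relation, is isomorphic to $2^{<\omega}$. For $S\subseteq 2^{<\omega}$ and $l\in\omega$, an $l$-enumeration of $S$ is a function $g:\omega\to$ (finite subsets of $2^{<\omega}$) with $|g(n)|\le l$ and $g(n)\cap S\cap 2^n\ne\emptyset$ for all $n$; a bounded enumeration is an $l$-enumeration for some $l$. Colorings $2^{<\omega}\to 2$ are regarded as elements of $2^{2^{<\omega}}$, so $\Pi^{0,D}_1$-classes of them make sense. *)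

theory Defs
  imports Main "HOL-Library.Sublist" "HOL-Library.Nat_Bijection"
begin

subsection \<open>Computability relative to an oracle\<close>

text \<open>
  Partial recursive functions relative to an oracle. In \<open>Prec f g\<close> the recursion variable comes
  first, followed by the parameters; \<open>g\<close> receives the predecessor, the previous value and the
  parameters. \<open>Mu f\<close> is unbounded minimization in the first argument of \<open>f\<close>.
\<close>

datatype orec =
    Zero
  | Succ
  | Proj nat
  | Oracle
  | Comp orec "orec list"
  | Prec orec orec
  | Mu orec

text \<open>\<open>orec_eval A p xs y\<close>: the program \<open>p\<close> with oracle \<open>A\<close> halts on input \<open>xs\<close> with output \<open>y\<close>.\<close>

inductive orec_eval :: "nat set \<Rightarrow> orec \<Rightarrow> nat list \<Rightarrow> nat \<Rightarrow> bool" for A :: "nat set" where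
  eval_Zero: "orec_eval A Zero xs 0"
| eval_Succ: "orec_eval A Succ [x] (Suc x)"
| eval_Proj: "i < length xs \<Longrightarrow> orec_eval A (Proj i) xs (xs ! i)"
| eval_Oracle: "orec_eval A Oracle [x] (of_bool (x \<in> A))"
| eval_Comp:
    "\<lbrakk>list_all2 (\<lambda>g y. orec_eval A g xs y) gs ys; orec_eval A f ys z\<rbrakk>
      \<Longrightarrow> orec_eval A (Comp f gs) xs z"
| eval_Prec_0: "orec_eval A f xs y \<Longrightarrow> orec_eval A (Prec f g) (0 # xs) y"
| eval_Prec_Suc:
    "\<lbrakk>orec_eval A (Prec f g) (n # xs) r; orec_eval A g (n # r # xs) y\<rbrakk>
      \<Longrightarrow> orec_eval A (Prec f g) (Suc n # xs) y"
| eval_Mu: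
    "\<lbrakk>orec_eval A f (n # xs) 0; \<forall>m<n. \<exists>y. orec_eval A f (m # xs) (Suc y)\<rbrakk>
      \<Longrightarrow> orec_eval A (Mu f) xs n"

inductive_cases orec_eval_ZeroE: "orec_eval A Zero xs y"
inductive_cases orec_eval_SuccE: "orec_eval A Succ xs y"
inductive_cases orec_eval_ProjE: "orec_eval A (Proj i) xs y"
inductive_cases orec_eval_OracleE: "orec_eval A Oracle xs y"
inductive_cases orec_eval_CompE: "orec_eval A (Comp f gs) xs y"
inductive_cases orec_eval_Prec_0E: "orec_eval A (Prec f g) (0 # xs) y"
inductive_cases orec_eval_Prec_SucE: "orec_eval A (Prec f g) (Suc n # xs) y"
inductive_cases orec_eval_MuE: "orec_eval A (Mu f) xs y"

lemma orec_eval_functional: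
  assumes "orec_eval A p xs y" "orec_eval A p xs z"
  shows "y = z"
  using assms
proof (induction arbitrary: z rule: orec_eval.induct)
  case (eval_Zero xs)
  then show ?case by (rule orec_eval_ZeroE) simp
next
  case (eval_Succ x)
  then show ?case by (rule orec_eval_SuccE) simp
next
  case (eval_Proj i xs)
  from eval_Proj.prems show ?case by (rule orec_eval_ProjE) simp
next
  case (eval_Oracle x)
  then show ?case by (rule orec_eval_OracleE) simp
next
  case (eval_Comp xs gs ys f w)
  from eval_Comp.prems obtain ys' where ys':
    "list_all2 (\<lambda>g y. orec_eval A g xs y) gs ys'" "orec_eval A f ys' z"
    by (rule orec_eval_CompE)
  have "ys' = ys"
  proof (rule nth_equalityI)
    show "length ys' = length ys"
      using eval_Comp.IH(1) ys'(1) by (simp add: list_all2_conv_all_nth)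
    fix i assume "i < length ys'"
    with ys'(1) have i: "i < length gs" "orec_eval A (gs ! i) xs (ys' ! i)"
      by (simp_all add: list_all2_conv_all_nth)
    have "\<forall>w. orec_eval A (gs ! i) xs w \<longrightarrow> ys ! i = w"
      using list_all2_nthD[OF eval_Comp.IH(1) i(1)] by blast
    with i(2) show "ys' ! i = ys ! i" by simp
  qed
  then show ?case using ys'(2) eval_Comp.IH(2) by simp
next
  case (eval_Prec_0 f xs y g)
  from eval_Prec_0.prems show ?case
    by (rule orec_eval_Prec_0E) (rule eval_Prec_0.IH)
next
  case (eval_Prec_Suc f g n xs r y)
  from eval_Prec_Suc.prems obtain r' where
    r': "orec_eval A (Prec f g) (n # xs) r'" "orec_eval A g (n # r' # xs) z"
    by (rule orec_eval_Prec_SucE)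
  have "r = r'" using eval_Prec_Suc.IH(1) r'(1) .
  with r'(2) show ?case using eval_Prec_Suc.IH(2) by simp
next
  case (eval_Mu f n xs)
  from eval_Mu.prems have z: "orec_eval A f (z # xs) 0"
    "\<forall>m<z. \<exists>y. orec_eval A f (m # xs) (Suc y)"
    by (auto elim: orec_eval_MuE)
  show ?case
  proof (rule linorder_cases[of n z])
    assume "n < z"
    with z(2) obtain y where "orec_eval A f (n # xs) (Suc y)" by blast
    with eval_Mu.IH(1) have "0 = Suc y" by blast
    then show ?thesis by simp
  next
    assume "z < n"
    with eval_Mu.IH(2) obtain y where "\<forall>w. orec_eval A f (z # xs) w \<longrightarrow> Suc y = w" by blast
    with z(1) have "Suc y = 0" by blast
    then show ?thesis by simp
  qed
qed

definition computable_in :: "nat set \<Rightarrow> (nat \<Rightarrow> nat) \<Rightarrow> bool" where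
  "computable_in A f \<longleftrightarrow> (\<exists>p. \<forall>n. orec_eval A p [n] (f n))"

text \<open>The Turing join \<open>A \<oplus> B\<close>.\<close>

definition turing_join :: "nat set \<Rightarrow> nat set \<Rightarrow> nat set" where
  "turing_join A B = {2 * n | n. n \<in> A} \<union> {2 * n + 1 | n. n \<in> B}"


subsection \<open>Coding of binary strings\<close>

text \<open>
  Elements of \<open>2\<^sup><\<^sup>\<omega>\<close> are boolean lists, identified with the natural numbers through bijective
  base-2 notation (the head of the list being the least significant digit). Finite sets of strings
  are coded by canonical indices, and sets of strings by their images under the coding.
\<close>

fun str_code :: "bool list \<Rightarrow> nat" where
  "str_code [] = 0"
| "str_code (b # s) = 2 * str_code s + (if b then 2 else 1)"

lemma bij_str_code: "bij str_code"
proof (rule bijI)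
  have "str_code s = str_code t \<Longrightarrow> s = t" for s t
  proof (induction s arbitrary: t)
    case Nil
    then show ?case by (cases t) (auto split: if_splits)
  next
    case (Cons b s)
    then obtain c t' where t: "t = c # t'" by (cases t) (auto split: if_splits)
    have eq: "2 * str_code s + (if b then 2 else 1) = 2 * str_code t' + (if c then 2 else 1)"
      using Cons.prems t by simp
    then have "b = c \<and> str_code s = str_code t'"
      by (cases b; cases c) (simp_all, presburger+)
    with Cons.IH t show ?case by simp
  qed
  then show "inj str_code" by (rule injI)
  have "\<exists>s. n = str_code s" for n
  proof (induction n rule: less_induct)
    case (less n)
    show ?case
    proof (cases "n = 0")
      case True
      then show ?thesis by (intro exI[of _ "[]"]) simp
    next
      case False
      then have "(n - 1) div 2 < n" by auto
      then obtain s where s: "(n - 1) div 2 = str_code s" using less by blast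
      have "n = str_code (even n # s)" using False s by (cases "even n") (simp_all, presburger+)
      then show ?thesis by blast
    qed
  qed
  then show "surj str_code" unfolding surj_def by blast
qed

definition finset_code :: "bool list set \<Rightarrow> nat" where
  "finset_code F = set_encode (str_code ` F)"

definition computable_strings :: "nat set \<Rightarrow> bool list set \<Rightarrow> bool" where
  "computable_strings A R \<longleftrightarrow> computable_in A (\<lambda>n. of_bool (n \<in> str_code ` R))"


subsection \<open>Bounded enumerations\<close>

definition l_enumeration :: "nat \<Rightarrow> bool list set \<Rightarrow> (nat \<Rightarrow> bool list set) \<Rightarrow> bool" where
  "l_enumeration l S g \<longleftrightarrow>
     (\<forall>n. finite (g n) \<and> card (g n) \<le> l \<and> g n \<inter> S \<inter> {s. length s = n} \<noteq> {})"

definition bounded_enumeration :: "bool list set \<Rightarrow> (nat \<Rightarrow> bool list set) \<Rightarrow> bool" where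
  "bounded_enumeration S g \<longleftrightarrow> (\<exists>l. l_enumeration l S g)"

definition computes_bounded_enumeration :: "nat set \<Rightarrow> bool list set \<Rightarrow> bool" where
  "computes_bounded_enumeration A S \<longleftrightarrow>
     (\<exists>g. bounded_enumeration S g \<and> computable_in A (\<lambda>n. finset_code (g n)))"


subsection \<open>Classes of colorings and perfect trees\<close>

text \<open>
  A coloring \<open>C\<close> of the binary strings is regarded as the infinite binary sequence
  \<open>C \<sigma>\<^sub>0, C \<sigma>\<^sub>1, \<dots>\<close>, where \<open>\<sigma>\<^sub>i\<close> is the string with code \<open>i\<close>. A \<open>\<Pi>\<^sup>0\<^sub>1\<close>-class relative to \<open>A\<close>
  is the set of infinite paths through an \<open>A\<close>-computable binary tree.
\<close>

definition coloring_initial :: "(bool list \<Rightarrow> bool) \<Rightarrow> nat \<Rightarrow> bool list" where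
  "coloring_initial C n = map (\<lambda>i. C (inv str_code i)) [0..<n]"

definition binary_tree :: "bool list set \<Rightarrow> bool" where
  "binary_tree R \<longleftrightarrow> (\<forall>s t. prefix s t \<longrightarrow> t \<in> R \<longrightarrow> s \<in> R)"

definition Pi01_class :: "nat set \<Rightarrow> (bool list \<Rightarrow> bool) set \<Rightarrow> bool" where
  "Pi01_class A Q \<longleftrightarrow>
     (\<exists>R. binary_tree R \<and> computable_strings A R \<and> Q = {C. \<forall>n. coloring_initial C n \<in> R})"

definition infinite_perfect_tree :: "bool list set \<Rightarrow> bool" where
  "infinite_perfect_tree T \<longleftrightarrow>
     (\<exists>f. bij_betw f UNIV T \<and> (\<forall>s t :: bool list. prefix (f s) (f t) \<longleftrightarrow> prefix s t))"

end

theory Submission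
  imports Defs "HOL-Library.FuncSet" "HOL-Library.Countable"
begin

text \<open>
  States \<open>c\<close> code finite tuples of colorings in \<open>Q\<close>. A candidate is a finite tree \<open>G\<close> together
  with tips above which it may grow, a color, and a finite set of coordinates of the tuple for which
  the tree has to be homogeneous. A condition is a nonempty \<open>\<Pi>\<^sup>0\<^sub>1\<close>-class of states with finitely many
  candidates such that every coloring of the tips is matched by some candidate. To handle a program
  \<open>p\<close> and a bound \<open>k\<close>, fix a state; one candidate after the other is either extended to force an
  output of \<open>p\<close> missing \<open>S\<close> at some level or admits no such extension above its tips. Refining the
  tips preserves the matching property: where the color above a tip is not forced, it can be chosen
  to disagree with the candidate under consideration. For the remaining candidates, consider for a
  level \<open>n\<close> and a set \<open>E\<close> of at most \<open>d\<close> strings the class of states in which all possible outputs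
  at \<open>n\<close> are not contained in \<open>E\<close>. If for every \<open>n\<close> some \<open>E\<close> made this class empty, then
  searching for such \<open>E\<close> would be a computable \<open>d\<close>-enumeration of \<open>S\<close>. Hence for some \<open>n\<close> all these classes
  are nonempty, and the product over all \<open>E\<close> is the new class of states: by the pigeonhole principle,
  some candidate is matched in so many rows that an output of size at most \<open>k\<close> would be contained in
  one of the corresponding \<open>E\<close>. A limit along a branch given by Koenig's lemma is the tree.
\<close>


text \<open>One coloring cannot deal with divergence. For a suitable level, every \<open>E\<close>
  is avoided by some member of the class, but the member varies with \<open>E\<close>, and no single
  one need avoid all \<open>E\<close>. This is why a state acquires one row per \<open>E\<close>,
  and why a tree must be homogeneous in several coordinates at once. The bound on \<open>E\<close>
  is \<open>k\<close> times the number of candidates, so that the union of one uncovered output per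
  candidate is itself an admissible \<open>E\<close>. Addresses get longer with each such step, so a
  later candidate is not literally an extension of an earlier one. The two are compared only through
  \<open>pot\<close>, the set of finite trees still allowed, which shrinks. No particular candidate
  is guaranteed to grow. For each state some candidate can, since a color pattern dense above every
  tip is a guess that must be matched. A growth step therefore makes either all or none of the trees
  in \<open>pot\<close> grow, and the branch is chosen among candidates of the first kind. The
  coloring is not built along the branch; compactness of \<open>Q\<close> supplies it at the
  end.\<close>

subsection \<open>Functions computable relative to an oracle\<close>

text \<open>Total lookup, so that \<open>arg k (tl e) = arg (Suc k) e\<close> holds for all \<open>e\<close> and quantifiers can be
  introduced by shifting indices; out of range the value is \<open>0\<close>.\<close>

definition arg :: "nat \<Rightarrow> nat list \<Rightarrow> nat" where
  "arg k e = (if k < length e then e ! k else 0)"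

lemma vr_tl [simp]: "arg k (tl e) = arg (Suc k) e"
  by (cases e) (auto simp: arg_def)

lemma vr_Cons_0 [simp]: "arg 0 (x # e) = x"
  and vr_Cons_Suc [simp]: "arg (Suc k) (x # e) = arg k e"
  by (auto simp: arg_def)

definition computable_fun :: "nat set \<Rightarrow> nat \<Rightarrow> (nat list \<Rightarrow> nat) \<Rightarrow> bool" where
  "computable_fun D m f \<longleftrightarrow> (\<exists>p. \<forall>xs. length xs = m \<longrightarrow> orec_eval D p xs (f xs))"

lemma cfI: "(\<And>xs. length xs = m \<Longrightarrow> orec_eval D p xs (f xs)) \<Longrightarrow> computable_fun D m f"
  unfolding computable_fun_def by blast

lemma cf_cong:
  assumes "computable_fun D m f" "\<And>xs. length xs = m \<Longrightarrow> f xs = g xs"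
  shows "computable_fun D m g"
  using assms unfolding computable_fun_def by auto

lemma cf_vr: "k < m \<Longrightarrow> computable_fun D m (\<lambda>e. arg k e)"
  by (rule cfI[where p = "Proj k"]) (auto simp: arg_def intro: eval_Proj)

lemma cf_subst:
  assumes f: "computable_fun D n f" and "length gs = n" and gs: "\<forall>g\<in>set gs. computable_fun D m g"
  shows "computable_fun D m (\<lambda>e. f (map (\<lambda>g. g e) gs))"
proof -
  from f obtain p where p: "\<And>xs. length xs = n \<Longrightarrow> orec_eval D p xs (f xs)"
    unfolding computable_fun_def by blast
  from gs have "\<forall>g\<in>set gs. \<exists>q. \<forall>xs. length xs = m \<longrightarrow> orec_eval D q xs (g xs)"
    unfolding computable_fun_def .
  then obtain q where q: "\<And>g xs. g \<in> set gs \<Longrightarrow> length xs = m \<Longrightarrow> orec_eval D (q g) xs (g xs)"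
    by metis
  show ?thesis
  proof (rule cfI[where p = "Comp p (map q gs)"])
    fix xs :: "nat list" assume "length xs = m"
    then show "orec_eval D (Comp p (map q gs)) xs (f (map (\<lambda>g. g xs) gs))"
      using q assms(2)
      by (intro eval_Comp[where ys = "map (\<lambda>g. g xs) gs"] p)
        (auto simp: list_all2_conv_all_nth)
  qed
qed

lemma cf_subst1:
  assumes "computable_fun D 1 (\<lambda>e. f (arg 0 e))" "computable_fun D m g"
  shows "computable_fun D m (\<lambda>e. f (g e))"
  using cf_subst[OF assms(1), of "[g]" m] assms(2) by simp

lemma cf_subst2:
  assumes "computable_fun D 2 (\<lambda>e. f (arg 0 e) (arg (Suc 0) e))" "computable_fun D m g" "computable_fun D m h"
  shows "computable_fun D m (\<lambda>e. f (g e) (h e))"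
  using cf_subst[OF assms(1), of "[g, h]" m] assms(2,3) by simp

lemma map_vr_upt: "length e = m \<Longrightarrow> map (\<lambda>k. arg k e) [0..<m] = e"
  by (auto simp: arg_def intro: nth_equalityI)

lemma cf_Suc: "computable_fun D m g \<Longrightarrow> computable_fun D m (\<lambda>e. Suc (g e))"
proof (rule cf_subst1[where f = Suc])
  show "computable_fun D 1 (\<lambda>e. Suc (arg 0 e))"
    by (rule cfI[where p = Succ]) (auto simp: length_Suc_conv arg_def intro: eval_Succ)
qed

lemma cf_const: "computable_fun D m (\<lambda>e. c)"
proof (induction c)
  case 0
  show ?case by (rule cfI[where p = Zero]) (rule eval_Zero)
qed (rule cf_Suc)

lemma cf_rec:
  assumes h: "computable_fun D m h" and b: "computable_fun D m b" and s: "computable_fun D (Suc (Suc m)) (\<lambda>e. s (arg 0 e) (arg (Suc 0) e) (tl (tl e)))"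
  shows "computable_fun D m (\<lambda>e. rec_nat (b e) (\<lambda>i r. s i r e) (h e))"
proof -
  from b obtain p where p: "\<And>xs. length xs = m \<Longrightarrow> orec_eval D p xs (b xs)"
    unfolding computable_fun_def by blast
  from s obtain q where q: "\<And>xs. length xs = Suc (Suc m) \<Longrightarrow>
      orec_eval D q xs (s (arg 0 xs) (arg (Suc 0) xs) (tl (tl xs)))"
    unfolding computable_fun_def by blast
  have 1: "orec_eval D (Prec p q) (n # xs) (rec_nat (b xs) (\<lambda>i r. s i r xs) n)"
    if "length xs = m" for n xs
  proof (induction n)
    case 0
    show ?case using p[OF that] by (auto intro: eval_Prec_0)
  next
    case (Suc n)
    show ?case
      using q[of "n # rec_nat (b xs) (\<lambda>i r. s i r xs) n # xs"] that
      by (auto intro!: eval_Prec_Suc[OF Suc.IH])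
  qed
  have "computable_fun D (Suc m) (\<lambda>e. rec_nat (b (tl e)) (\<lambda>i r. s i r (tl e)) (arg 0 e))"
    by (rule cfI[where p = "Prec p q"]) (auto simp: length_Suc_conv intro!: 1)
  \<comment> \<open>Composition with all projections hands the original list on as parameters, so a
    recursion on the head of a longer list becomes a recursion on \<open>h e\<close>.\<close>
  from cf_subst[OF this, of "h # map (\<lambda>k e. arg k e) [0..<m]" m] h
  have "computable_fun D m (\<lambda>e. rec_nat (b (map (\<lambda>k. arg k e) [0..<m]))
      (\<lambda>i r. s i r (map (\<lambda>k. arg k e) [0..<m])) (h e))"
    by (auto simp: cf_vr comp_def)
  then show ?thesis by (rule cf_cong) (simp only: map_vr_upt)
qed

lemma cf_tl:
  assumes "computable_fun D m f"
  shows "computable_fun D (Suc m) (\<lambda>e. f (tl e))"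
proof -
  have "computable_fun D (Suc m) (\<lambda>e. f (map (\<lambda>g. g e) (map (\<lambda>k e. arg (Suc k) e) [0..<m])))"
    by (rule cf_subst[OF assms]) (auto intro: cf_vr)
  then show ?thesis
  proof (rule cf_cong)
    fix xs :: "nat list" assume "length xs = Suc m"
    then show "f (map (\<lambda>g. g xs) (map (\<lambda>k e. arg (Suc k) e) [0..<m])) = f (tl xs)"
      using map_vr_upt[of "tl xs" m] by (simp add: comp_def)
  qed
qed

lemma cf_case:
  assumes "computable_fun D m h" "computable_fun D m b" "computable_fun D (Suc m) (\<lambda>e. s (arg 0 e) (tl e))"
  shows "computable_fun D m (\<lambda>e. case h e of 0 \<Rightarrow> b e | Suc i \<Rightarrow> s i e)"
proof -
  have "computable_fun D (Suc (Suc m)) (\<lambda>e. s (arg 0 e) (tl (tl e)))"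
  proof -
    have "computable_fun D (Suc (Suc m)) (\<lambda>e. (\<lambda>d. s (arg 0 d) (tl d))
       (map (\<lambda>g. g e) ((\<lambda>e. arg 0 e) # map (\<lambda>k e. arg (Suc (Suc k)) e) [0..<m])))"
      by (rule cf_subst[OF assms(3)]) (auto intro: cf_vr)
    then show ?thesis
    proof (rule cf_cong)
      fix xs :: "nat list" assume "length xs = Suc (Suc m)"
      then show "(\<lambda>d. s (arg 0 d) (tl d)) (map (\<lambda>g. g xs) ((\<lambda>e. arg 0 e) #
          map (\<lambda>k e. arg (Suc (Suc k)) e) [0..<m])) = s (arg 0 xs) (tl (tl xs))"
        using map_vr_upt[of "tl (tl xs)" m] by (simp add: comp_def)
    qed
  qed
  from cf_rec[OF assms(1,2) this] show ?thesis
    by (rule cf_cong) (auto split: nat.split)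
qed

lemma cf_pred: "computable_fun D m g \<Longrightarrow> computable_fun D m (\<lambda>e. g e - Suc 0)"
  by (rule cf_cong[OF cf_case[of D m g "\<lambda>e. 0" "\<lambda>i e. i"]]) (auto intro: cf_const cf_vr split: nat.split)


lemma cf_add:
  assumes "computable_fun D m f" "computable_fun D m g"
  shows "computable_fun D m (\<lambda>e. f e + g e)"
proof -
  have *: "rec_nat a (\<lambda>i. Suc) n = a + n" for a n :: nat
    by (induction n) auto
  have "computable_fun D m (\<lambda>e. rec_nat (f e) (\<lambda>i r. Suc r) (g e))"
    by (rule cf_rec) (use assms in \<open>auto intro: cf_Suc cf_vr\<close>)
  then show ?thesis by (simp only: *)
qed

lemma cf_diff:
  assumes "computable_fun D m f" "computable_fun D m g"
  shows "computable_fun D m (\<lambda>e. f e - g e)"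
proof -
  have *: "rec_nat a (\<lambda>i r. r - Suc 0) n = a - n" for a n :: nat
    by (induction n) auto
  have "computable_fun D m (\<lambda>e. rec_nat (f e) (\<lambda>i r. r - Suc 0) (g e))"
    by (rule cf_rec) (use assms in \<open>auto intro: cf_pred cf_vr\<close>)
  then show ?thesis by (simp only: *)
qed

text \<open>Bounded sums drive the closure properties below: a product is a constant sum, a bounded
  existential quantifier is positivity of a sum of indicators, and a cardinality is such a sum
  itself.\<close>

lemma cf_sum:
  assumes f: "computable_fun D m f" and g: "computable_fun D (Suc m) (\<lambda>e. g (arg 0 e) (tl e))"
  shows "computable_fun D m (\<lambda>e. \<Sum>i<f e. g i e)"
proof -
  have *: "rec_nat 0 (\<lambda>i r. r + h i) n = (\<Sum>i<n. h i)" for h :: "nat \<Rightarrow> nat" and n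
    by (induction n) auto
  have "computable_fun D (Suc (Suc m)) (\<lambda>e. (\<lambda>d. g (arg 0 d) (tl d))
     (map (\<lambda>g. g e) ((\<lambda>e. arg 0 e) # map (\<lambda>k e. arg (Suc (Suc k)) e) [0..<m])))"
    by (rule cf_subst[OF g]) (auto intro: cf_vr)
  then have "computable_fun D (Suc (Suc m)) (\<lambda>e. g (arg 0 e) (tl (tl e)))"
  proof (rule cf_cong)
    fix xs :: "nat list" assume "length xs = Suc (Suc m)"
    then show "(\<lambda>d. g (arg 0 d) (tl d)) (map (\<lambda>g. g xs) ((\<lambda>e. arg 0 e) #
        map (\<lambda>k e. arg (Suc (Suc k)) e) [0..<m])) = g (arg 0 xs) (tl (tl xs))"
      using map_vr_upt[of "tl (tl xs)" m] by (simp add: comp_def)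
  qed
  then have "computable_fun D m (\<lambda>e. rec_nat 0 (\<lambda>i r. r + g i e) (f e))"
    by (intro cf_rec f cf_const cf_add cf_vr) auto
  then show ?thesis by (simp only: *)
qed

lemma cf_mult:
  assumes "computable_fun D m f" "computable_fun D m g"
  shows "computable_fun D m (\<lambda>e. f e * g e)"
proof -
  have "computable_fun D m (\<lambda>e. \<Sum>i<f e. g e)"
    by (intro cf_sum assms cf_tl)
  then show ?thesis by simp
qed

lemma cf_pow2:
  assumes "computable_fun D m f"
  shows "computable_fun D m (\<lambda>e. 2 ^ f e)"
proof -
  have *: "rec_nat 1 (\<lambda>i r. r + r) n = (2 ^ n :: nat)" for n
    by (induction n) auto
  have "computable_fun D m (\<lambda>e. rec_nat 1 (\<lambda>i r. r + r) (f e))"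
    by (rule cf_rec) (use assms in \<open>auto intro: cf_add cf_vr cf_const\<close>)
  then show ?thesis by (simp only: *)
qed

lemma cf_prod_encode:
  assumes "computable_fun D m f" "computable_fun D m g"
  shows "computable_fun D m (\<lambda>e. prod_encode (f e, g e))"
proof -
  have tri: "(\<Sum>i<Suc n. i) = triangle n" for n
    by (induction n) auto
  have "computable_fun D m (\<lambda>e. (\<Sum>i<Suc (f e + g e). i) + f e)"
    by (intro cf_add cf_sum assms cf_Suc cf_vr zero_less_Suc)
  then show ?thesis by (simp only: tri prod_encode_def split)
qed

section \<open>Decidable relations and finite sets coded by numbers\<close>

definition decidable :: "nat set \<Rightarrow> nat \<Rightarrow> (nat list \<Rightarrow> bool) \<Rightarrow> bool" where
  "decidable D m P \<longleftrightarrow> computable_fun D m (\<lambda>e. of_bool (P e))"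

lemma dec_cong: "decidable D m P \<Longrightarrow> (\<And>e. length e = m \<Longrightarrow> P e = Q e) \<Longrightarrow> decidable D m Q"
  unfolding decidable_def by (erule cf_cong) simp

lemma dec_const: "decidable D m (\<lambda>e. b)"
  unfolding decidable_def by (rule cf_const)

lemma dec_not: "decidable D m P \<Longrightarrow> decidable D m (\<lambda>e. \<not> P e)"
proof -
  assume "decidable D m P"
  then have "computable_fun D m (\<lambda>e. 1 - of_bool (P e))" unfolding decidable_def by (intro cf_diff cf_const)
  then show "decidable D m (\<lambda>e. \<not> P e)" unfolding decidable_def by (rule cf_cong) auto
qed

lemma dec_conj: "decidable D m P \<Longrightarrow> decidable D m Q \<Longrightarrow> decidable D m (\<lambda>e. P e \<and> Q e)"
  unfolding decidable_def of_bool_conj by (rule cf_mult)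

lemma dec_disj: "decidable D m P \<Longrightarrow> decidable D m Q \<Longrightarrow> decidable D m (\<lambda>e. P e \<or> Q e)"
proof -
  assume "decidable D m P" "decidable D m Q"
  from dec_not[OF dec_conj[OF this[THEN dec_not]]] show "decidable D m (\<lambda>e. P e \<or> Q e)" by simp
qed

lemma dec_imp: "decidable D m P \<Longrightarrow> decidable D m Q \<Longrightarrow> decidable D m (\<lambda>e. P e \<longrightarrow> Q e)"
  unfolding imp_conv_disj by (intro dec_disj dec_not)

lemma dec_pos: "computable_fun D m f \<Longrightarrow> decidable D m (\<lambda>e. 0 < f e)"
proof -
  assume "computable_fun D m f"
  then have "computable_fun D m (\<lambda>e. 1 - (1 - f e))" by (intro cf_diff cf_const)
  then show ?thesis unfolding decidable_def by (rule cf_cong) auto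
qed

lemma dec_less: "computable_fun D m f \<Longrightarrow> computable_fun D m g \<Longrightarrow> decidable D m (\<lambda>e. f e < g e)"
proof -
  assume "computable_fun D m f" "computable_fun D m g"
  from dec_pos[OF cf_diff[OF this(2,1)]] show "decidable D m (\<lambda>e. f e < g e)" by simp
qed

lemma dec_le: "computable_fun D m f \<Longrightarrow> computable_fun D m g \<Longrightarrow> decidable D m (\<lambda>e. f e \<le> g e)"
  unfolding not_less[symmetric] by (intro dec_not dec_less)

lemma dec_eq: "computable_fun D m f \<Longrightarrow> computable_fun D m g \<Longrightarrow> decidable D m (\<lambda>e. f e = g e)"
  unfolding eq_iff by (intro dec_conj dec_le)

lemma dec_ex:
  assumes f: "computable_fun D m f" and P: "decidable D (Suc m) (\<lambda>e. P (arg 0 e) (tl e))"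
  shows "decidable D m (\<lambda>e. \<exists>i<f e. P i e)"
proof -
  have "decidable D m (\<lambda>e. 0 < (\<Sum>i<f e. of_bool (P i e) :: nat))"
    using P unfolding decidable_def[of D "Suc m"] by (intro dec_pos cf_sum f)
  then show ?thesis
    by (rule dec_cong) (auto simp: sum_nonneg_eq_0_iff simp flip: neq0_conv)
qed

lemma dec_all:
  assumes f: "computable_fun D m f" and P: "decidable D (Suc m) (\<lambda>e. P (arg 0 e) (tl e))"
  shows "decidable D m (\<lambda>e. \<forall>i<f e. P i e)"
  using dec_not[OF dec_ex[OF f dec_not[OF P]]] by simp

lemma cf_if:
  assumes "decidable D m P" "computable_fun D m f" "computable_fun D m g"
  shows "computable_fun D m (\<lambda>e. if P e then f e else g e)"
proof -
  have "computable_fun D m (\<lambda>e. of_bool (P e) * f e + (1 - of_bool (P e)) * g e)"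
    using assms unfolding decidable_def by (intro cf_add cf_mult cf_diff cf_const)
  then show ?thesis by (rule cf_cong) auto
qed

lemma dec_oracle: "computable_fun D m f \<Longrightarrow> decidable D m (\<lambda>e. f e \<in> D)"
proof -
  assume f: "computable_fun D m f"
  have "computable_fun D 1 (\<lambda>e. of_bool (arg 0 e \<in> D))"
    by (rule cfI[where p = Oracle]) (auto simp only: length_Suc_conv vr_Cons_0 One_nat_def list.size intro!: eval_Oracle)
  from cf_subst1[OF this f] show ?thesis unfolding decidable_def .
qed

text \<open>Division is traded for a bounded search: in the binary expansion of \<open>y\<close>,
  \<open>r\<close> is the part below bit \<open>x\<close>, \<open>q\<close> the part above it, and
  the \<open>1\<close> between them is the bit itself. What remains is built from sums, products,
  powers and bounded quantifiers.\<close>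

lemma set_decode_iff: "x \<in> set_decode y \<longleftrightarrow> (\<exists>q<Suc y. \<exists>r<2 ^ x. y = (2 * q + 1) * 2 ^ x + r)"
proof
  assume "x \<in> set_decode y"
  then have o: "odd (y div 2 ^ x)" by (simp add: set_decode_def)
  define q where "q = (y div 2 ^ x) div 2"
  have "y div 2 ^ x = 2 * q + 1" using o unfolding q_def by (metis odd_two_times_div_two_succ)
  then have "y = (2 * q + 1) * 2 ^ x + y mod 2 ^ x"
    by (metis div_mult_mod_eq)
  moreover have "q \<le> y" unfolding q_def by (meson div_le_dividend order_trans)
  ultimately show "\<exists>q<Suc y. \<exists>r<2 ^ x. y = (2 * q + 1) * 2 ^ x + r"
    by (intro exI[of _ q] conjI exI[of _ "y mod 2 ^ x"]) auto
next
  assume "\<exists>q<Suc y. \<exists>r<2 ^ x. y = (2 * q + 1) * 2 ^ x + r"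
  then obtain q r where "r < 2 ^ x" "y = (2 * q + 1) * 2 ^ x + r" by blast
  then have "y div 2 ^ x = 2 * q + 1" by (simp only: div_mult_self3[OF power_not_zero[OF zero_neq_numeral[symmetric]]] div_less)
  then show "x \<in> set_decode y" by (simp add: set_decode_def)
qed

lemma dec_mem:
  assumes "computable_fun D m f" "computable_fun D m g"
  shows "decidable D m (\<lambda>e. f e \<in> set_decode (g e))"
proof -
  have "decidable D 2 (\<lambda>e. arg 0 e \<in> set_decode (arg (Suc 0) e))"
    unfolding set_decode_iff
    by (intro dec_ex dec_eq cf_add cf_mult cf_pow2 cf_vr cf_const cf_Suc) (auto intro!: cf_Suc cf_vr cf_pow2 cf_add cf_mult cf_const dec_ex dec_eq)
  from cf_subst2[OF this[unfolded decidable_def] assms] show ?thesis unfolding decidable_def .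
qed

lemma dec_ball:
  assumes "finite A" "\<And>a. a \<in> A \<Longrightarrow> decidable D m (P a)"
  shows "decidable D m (\<lambda>e. \<forall>a\<in>A. P a e)"
  using assms by (induction A) (auto intro: dec_const dec_conj)

lemma dec_bex:
  assumes "finite A" "\<And>a. a \<in> A \<Longrightarrow> decidable D m (P a)"
  shows "decidable D m (\<lambda>e. \<exists>a\<in>A. P a e)"
  using assms by (induction A) (auto intro: dec_const dec_disj)

text \<open>A member \<open>x\<close> contributes \<open>2 ^ x\<close> to the code. Hence
  quantifiers over a coded set become quantifiers bounded by its code.\<close>

lemma mem_set_decode_less: "x \<in> set_decode y \<Longrightarrow> x < y"
proof -
  assume "x \<in> set_decode y"
  then have "2 ^ x \<le> y" 
    using set_decode_iff[of x y] by (auto simp: algebra_simps trans_le_add1)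
  then show "x < y" using less_exp[of x] by linarith
qed

lemma cf_card_decode:
  assumes "computable_fun D m f"
  shows "computable_fun D m (\<lambda>e. card (set_decode (f e)))"
proof -
  have "computable_fun D m (\<lambda>e. \<Sum>i<f e. of_bool (i \<in> set_decode (f e)))"
    by (intro cf_sum assms dec_mem[unfolded decidable_def] cf_tl cf_vr) simp
  moreover have "(\<Sum>i<y. of_bool (i \<in> set_decode y)) = card (set_decode y)" for y
  proof -
    have "{..<y} \<inter> {i. i \<in> set_decode y} = set_decode y" using mem_set_decode_less by auto
    then show ?thesis by (simp add: sum.If_cases of_bool_def)
  qed
  ultimately show ?thesis by simp
qed

subsection \<open>Semidecidable relations\<close>

text \<open>Replaces the whole argument list at once. This is the means of permuting, dropping and
  duplicating arguments when a relation is used below further quantifiers.\<close>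

lemma cf_env:
  assumes "computable_fun D n f" "\<And>k. k < n \<Longrightarrow> computable_fun D m (\<lambda>e. arg k (h e))" "\<And>e. length e = m \<Longrightarrow> length (h e) = n"
  shows "computable_fun D m (\<lambda>e. f (h e))"
proof -
  have "computable_fun D m (\<lambda>e. f (map (\<lambda>g. g e) (map (\<lambda>k e. arg k (h e)) [0..<n])))"
    by (rule cf_subst[OF assms(1)]) (auto intro: assms(2))
  then show ?thesis
  proof (rule cf_cong)
    fix xs :: "nat list" assume "length xs = m"
    then show "f (map (\<lambda>g. g xs) (map (\<lambda>k e. arg k (h e)) [0..<n])) = f (h xs)"
      using map_vr_upt[of "h xs" n] assms(3) by (simp add: comp_def)
  qed
qed

lemma dec_env:
  assumes "decidable D n P" "\<And>k. k < n \<Longrightarrow> computable_fun D m (\<lambda>e. arg k (h e))" "\<And>e. length e = m \<Longrightarrow> length (h e) = n"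
  shows "decidable D m (\<lambda>e. P (h e))"
  using assms unfolding decidable_def by (rule cf_env)

lemma cf_least:
  assumes R: "decidable D (Suc m) (\<lambda>e. R (arg 0 e) (tl e))" and ex: "\<And>e. length e = m \<Longrightarrow> \<exists>w. R w e"
  shows "computable_fun D m (\<lambda>e. LEAST w. R w e)"
proof -
  \<comment> \<open>\<open>Mu\<close> searches for a zero, hence the complemented indicator;
    \<open>ex\<close> makes the search total.\<close>
  have "computable_fun D (Suc m) (\<lambda>e. 1 - of_bool (R (arg 0 e) (tl e)))"
    using R unfolding decidable_def by (intro cf_diff cf_const)
  then obtain p where p: "\<And>xs. length xs = Suc m \<Longrightarrow> orec_eval D p xs (1 - of_bool (R (arg 0 xs) (tl xs)))"
    unfolding computable_fun_def by blast
  show ?thesis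
  proof (rule cfI[where p = "Mu p"])
    fix xs :: "nat list" assume xs: "length xs = m"
    have p': "orec_eval D p (w # xs) (1 - of_bool (R w xs))" for w
      using p[of "w # xs"] xs by simp
    show "orec_eval D (Mu p) xs (LEAST w. R w xs)"
    proof (rule eval_Mu)
      show "orec_eval D p ((LEAST w. R w xs) # xs) 0"
        using p'[of "LEAST w. R w xs"] LeastI_ex[OF ex[OF xs]] by simp
      show "\<forall>m<LEAST w. R w xs. \<exists>y. orec_eval D p (m # xs) (Suc y)"
      proof (intro allI impI)
        fix w assume "w < (LEAST w. R w xs)"
        then have "\<not> R w xs" by (rule not_less_Least)
        then show "\<exists>y. orec_eval D p (w # xs) (Suc y)" using p'[of w] by auto
      qed
    qed
  qed
qed

text \<open>Monotone stages make closure under conjunction and bounded quantification immediate, without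
  any coding of witness tuples.\<close>

definition semidecidable :: "nat set \<Rightarrow> nat \<Rightarrow> (nat list \<Rightarrow> bool) \<Rightarrow> bool" where
  "semidecidable D m P \<longleftrightarrow> (\<exists>R. decidable D (Suc m) (\<lambda>e. R (arg 0 e) (tl e)) \<and>
     (\<forall>w w' e. w \<le> w' \<longrightarrow> R w e \<longrightarrow> R w' e) \<and>
     (\<forall>e. length e = m \<longrightarrow> (P e \<longleftrightarrow> (\<exists>w. R w e))))"

lemma ceE:
  assumes "semidecidable D m P"
  obtains R where "decidable D (Suc m) (\<lambda>e. R (arg 0 e) (tl e))"
    "\<And>w w' e. w \<le> w' \<Longrightarrow> R w e \<Longrightarrow> R w' e"
    "\<And>e. length e = m \<Longrightarrow> P e \<longleftrightarrow> (\<exists>w. R w e)"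
  using assms unfolding semidecidable_def by metis

lemma ceI:
  assumes "decidable D (Suc m) (\<lambda>e. R (arg 0 e) (tl e))"
    "\<And>w w' e. w \<le> w' \<Longrightarrow> R w e \<Longrightarrow> R w' e"
    "\<And>e. length e = m \<Longrightarrow> P e \<longleftrightarrow> (\<exists>w. R w e)"
  shows "semidecidable D m P"
  using assms unfolding semidecidable_def by blast

lemma dec_tl: "decidable D m P \<Longrightarrow> decidable D (Suc m) (\<lambda>e. P (tl e))"
  unfolding decidable_def by (rule cf_tl)

lemma ce_cong: "semidecidable D m P \<Longrightarrow> (\<And>e. length e = m \<Longrightarrow> P e = Q e) \<Longrightarrow> semidecidable D m Q"
  unfolding semidecidable_def by simp

lemma ce_dec: "decidable D m P \<Longrightarrow> semidecidable D m P"
  by (rule ceI[where R = "\<lambda>_. P"]) (auto intro: dec_tl)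

lemma ce_conj:
  assumes "semidecidable D m P" "semidecidable D m Q"
  shows "semidecidable D m (\<lambda>e. P e \<and> Q e)"
proof -
  from assms(1) obtain R where R: "decidable D (Suc m) (\<lambda>e. R (arg 0 e) (tl e))"
    "\<And>w w' e. w \<le> w' \<Longrightarrow> R w e \<Longrightarrow> R w' e" "\<And>e. length e = m \<Longrightarrow> P e \<longleftrightarrow> (\<exists>w. R w e)"
    by (rule ceE) blast
  from assms(2) obtain S where S: "decidable D (Suc m) (\<lambda>e. S (arg 0 e) (tl e))"
    "\<And>w w' e. w \<le> w' \<Longrightarrow> S w e \<Longrightarrow> S w' e" "\<And>e. length e = m \<Longrightarrow> Q e \<longleftrightarrow> (\<exists>w. S w e)"
    by (rule ceE) blast
  show ?thesis
  proof (rule ceI[where R = "\<lambda>w e. R w e \<and> S w e"])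
    show "P e \<and> Q e \<longleftrightarrow> (\<exists>w. R w e \<and> S w e)" if "length e = m" for e
      using R(2)[of _ "max _ _"] S(2)[of _ "max _ _"] R(3)[OF that] S(3)[OF that]
      by (meson max.cobounded1 max.cobounded2)
  qed (use R S in \<open>auto intro: dec_conj\<close>)
qed

lemma ce_disj:
  assumes "semidecidable D m P" "semidecidable D m Q"
  shows "semidecidable D m (\<lambda>e. P e \<or> Q e)"
proof -
  from assms(1) obtain R where R: "decidable D (Suc m) (\<lambda>e. R (arg 0 e) (tl e))"
    "\<And>w w' e. w \<le> w' \<Longrightarrow> R w e \<Longrightarrow> R w' e" "\<And>e. length e = m \<Longrightarrow> P e \<longleftrightarrow> (\<exists>w. R w e)"
    by (rule ceE) blast
  from assms(2) obtain S where S: "decidable D (Suc m) (\<lambda>e. S (arg 0 e) (tl e))"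
    "\<And>w w' e. w \<le> w' \<Longrightarrow> S w e \<Longrightarrow> S w' e" "\<And>e. length e = m \<Longrightarrow> Q e \<longleftrightarrow> (\<exists>w. S w e)"
    by (rule ceE) blast
  show ?thesis
    by (rule ceI[where R = "\<lambda>w e. R w e \<or> S w e"]) (use R S in \<open>auto intro: dec_disj\<close>)
qed

lemma ce_env:
  assumes "semidecidable D n P" "\<And>k. k < n \<Longrightarrow> computable_fun D m (\<lambda>e. arg k (h e))" "\<And>e. length e = m \<Longrightarrow> length (h e) = n"
  shows "semidecidable D m (\<lambda>e. P (h e))"
proof -
  from assms(1) obtain R where R: "decidable D (Suc n) (\<lambda>e. R (arg 0 e) (tl e))"
    "\<And>w w' e. w \<le> w' \<Longrightarrow> R w e \<Longrightarrow> R w' e" "\<And>e. length e = n \<Longrightarrow> P e \<longleftrightarrow> (\<exists>w. R w e)"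
    by (rule ceE) blast
  show ?thesis
  proof (rule ceI[where R = "\<lambda>w e. R w (h e)"])
    have "decidable D (Suc m) (\<lambda>e. (\<lambda>e. R (arg 0 e) (tl e)) (arg 0 e # h (tl e)))"
    proof (rule dec_env[OF R(1)])
      show "computable_fun D (Suc m) (\<lambda>e. arg k (arg 0 e # h (tl e)))" if "k < Suc n" for k
        using that cf_tl[OF assms(2)] by (cases k) (auto intro: cf_vr)
    qed (auto simp: assms(3))
    then show "decidable D (Suc m) (\<lambda>e. R (arg 0 e) (h (tl e)))" by simp
  qed (use R assms(3) in auto)
qed

lemma ce_ex:
  assumes "semidecidable D (Suc m) (\<lambda>e. P (arg 0 e) (tl e))"
  shows "semidecidable D m (\<lambda>e. \<exists>i. P i e)"
proof -
  from assms obtain R where R: "decidable D (Suc (Suc m)) (\<lambda>e. R (arg 0 e) (tl e))"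
    "\<And>w w' e. w \<le> w' \<Longrightarrow> R w e \<Longrightarrow> R w' e"
    "\<And>e. length e = Suc m \<Longrightarrow> P (arg 0 e) (tl e) \<longleftrightarrow> (\<exists>w. R w e)"
    by (rule ceE) blast
  \<comment> \<open>The stage \<open>w\<close> both bounds the witness \<open>i\<close> and serves
    as its stage, which keeps the relation monotone.\<close>
  show ?thesis
  proof (rule ceI[where R = "\<lambda>w e. \<exists>i<w. R w (i # e)"])
    have "decidable D (Suc (Suc m)) (\<lambda>e. (\<lambda>e. R (arg 0 e) (tl e)) (arg (Suc 0) e # arg 0 e # tl (tl e)))"
      by (rule dec_env[OF R(1)]) (auto simp: less_Suc_eq_0_disj intro: cf_vr)
    then show "decidable D (Suc m) (\<lambda>e. \<exists>i<arg 0 e. R (arg 0 e) (i # tl e))"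
      by (intro dec_ex cf_vr) auto
    show "\<exists>i<w'. R w' (i # e)" if "w \<le> w'" "\<exists>i<w. R w (i # e)" for w w' e
      using that R(2) by (meson order_less_le_trans)
    show "(\<exists>i. P i e) \<longleftrightarrow> (\<exists>w. \<exists>i<w. R w (i # e))" if "length e = m" for e
    proof -
      have *: "P i e \<longleftrightarrow> (\<exists>w. R w (i # e))" for i
        using R(3)[of "i # e"] that by simp
      show ?thesis
      proof
        assume "\<exists>i. P i e"
        then obtain i w where "R w (i # e)" using * by blast
        then have "R (max w (Suc i)) (i # e)" by (rule R(2)[rotated]) simp
        then show "\<exists>w. \<exists>i<w. R w (i # e)" by (intro exI[of _ "max w (Suc i)"] exI[of _ i]) simp
      qed (use * in blast)
    qed
  qed
qed

text \<open>Each of the finitely many \<open>i < f e\<close> is confirmed at some stage; by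
  monotonicity the largest of these stages confirms all of them.\<close>

lemma ce_all:
  assumes f: "computable_fun D m f" and "semidecidable D (Suc m) (\<lambda>e. P (arg 0 e) (tl e))"
  shows "semidecidable D m (\<lambda>e. \<forall>i<f e. P i e)"
proof -
  from assms(2) obtain R where R: "decidable D (Suc (Suc m)) (\<lambda>e. R (arg 0 e) (tl e))"
    "\<And>w w' e. w \<le> w' \<Longrightarrow> R w e \<Longrightarrow> R w' e"
    "\<And>e. length e = Suc m \<Longrightarrow> P (arg 0 e) (tl e) \<longleftrightarrow> (\<exists>w. R w e)"
    by (rule ceE) blast
  show ?thesis
  proof (rule ceI[where R = "\<lambda>w e. \<forall>i<f e. R w (i # e)"])
    have "decidable D (Suc (Suc m)) (\<lambda>e. (\<lambda>e. R (arg 0 e) (tl e)) (arg (Suc 0) e # arg 0 e # tl (tl e)))"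
      by (rule dec_env[OF R(1)]) (auto simp: less_Suc_eq_0_disj intro: cf_vr)
    then show "decidable D (Suc m) (\<lambda>e. \<forall>i<f (tl e). R (arg 0 e) (i # tl e))"
      by (intro dec_all cf_tl f) auto
    show "\<forall>i<f e. R w' (i # e)" if "w \<le> w'" "\<forall>i<f e. R w (i # e)" for w w' e
      using that R(2) by blast
    show "(\<forall>i<f e. P i e) \<longleftrightarrow> (\<exists>w. \<forall>i<f e. R w (i # e))" if "length e = m" for e
    proof -
      have *: "P i e \<longleftrightarrow> (\<exists>w. R w (i # e))" for i
        using R(3)[of "i # e"] that by simp
      have "\<exists>w. \<forall>i<n. R w (i # e)" if "\<forall>i<n. P i e" for n
        using that
      proof (induction n)
        case (Suc n)
        then obtain w where w: "\<forall>i<n. R w (i # e)" by auto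
        from Suc.prems * obtain w' where "R w' (n # e)" by blast
        then show ?case using w R(2)
          by (intro exI[of _ "max w w'"]) (metis less_Suc_eq max.cobounded1 max.cobounded2)
      qed auto
      then show ?thesis using * by blast
    qed
  qed
qed

lemma ce_bex:
  assumes "finite A" "\<And>a. a \<in> A \<Longrightarrow> semidecidable D m (P a)"
  shows "semidecidable D m (\<lambda>e. \<exists>a\<in>A. P a e)"
  using assms by (induction A) (auto intro: ce_dec dec_const ce_disj)

text \<open>Two successive minimizations: the first finds a stage at which some value below the
  stage is confirmed, the second takes the least value confirmed at that stage. Both search through
  decidable relations and always succeed.\<close>

lemma ce_uniformize:
  assumes "semidecidable D 2 (\<lambda>e. P (arg 0 e) (arg (Suc 0) e))" and "\<And>n. \<exists>y. P n y"
  shows "\<exists>g. computable_in D g \<and> (\<forall>n. P n (g n))"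
proof -
  from assms(1) obtain R where R: "decidable D (Suc 2) (\<lambda>e. R (arg 0 e) (tl e))"
    "\<And>w w' e. w \<le> w' \<Longrightarrow> R w e \<Longrightarrow> R w' e"
    "\<And>e. length e = 2 \<Longrightarrow> P (arg 0 e) (arg (Suc 0) e) \<longleftrightarrow> (\<exists>w. R w e)"
    by (rule ceE) blast
  have R3: "P n y \<longleftrightarrow> (\<exists>w. R w [n, y])" for n y using R(3)[of "[n, y]"] by simp
  have R1: "decidable D m (\<lambda>e. R (f e) [g e, h e])" if "computable_fun D m f" "computable_fun D m g" "computable_fun D m h" for m f g h
  proof -
    have "decidable D m (\<lambda>e. (\<lambda>e. R (arg 0 e) (tl e)) [f e, g e, h e])"
      by (rule dec_env[OF R(1)]) (use that in \<open>auto simp: less_Suc_eq_0_disj numeral_2_eq_2\<close>)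
    then show ?thesis by simp
  qed
  define w where "w e = (LEAST w. \<exists>y<w. R w [arg 0 e, y])" for e
  have ex: "\<exists>w. \<exists>y<w. R w [n, y]" for n
  proof -
    from assms(2) R3 obtain y w where "R w [n, y]" by blast
    then have "R (max w (Suc y)) [n, y]" by (rule R(2)[rotated]) simp
    then show ?thesis by (intro exI[of _ "max w (Suc y)"] exI[of _ y]) simp
  qed
  have w: "computable_fun D 1 w"
    unfolding w_def using ex by (intro cf_least dec_ex R1 cf_vr) (auto intro: cf_vr)
  have wy: "\<exists>y. R (w e) [arg 0 e, y]" for e
    unfolding w_def using LeastI_ex[OF ex] by blast
  define g where "g e = (LEAST y. R (w e) [arg 0 e, y])" for e
  have g: "computable_fun D 1 g"
    unfolding g_def using wy by (intro cf_least R1 cf_vr cf_tl w) (auto intro: cf_vr)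
  have "P n (g [n])" for n
    using LeastI_ex[OF wy[of "[n]"]] R3[of n "g [n]"] unfolding g_def by auto
  moreover have "computable_in D (\<lambda>n. g [n])"
  proof -
    from g obtain p where "\<And>xs. length xs = 1 \<Longrightarrow> orec_eval D p xs (g xs)" unfolding computable_fun_def by blast
    then show ?thesis unfolding computable_in_def by (intro exI[of _ p]) simp
  qed
  ultimately show ?thesis by blast
qed

section \<open>Evaluation of programs with bounded search\<close>

text \<open>The fuel only bounds the search in minimization. The value is \<open>0\<close> if there is no result, and
  the successor of the result otherwise.\<close>

fun fuel_eval :: "nat \<Rightarrow> nat set \<Rightarrow> orec \<Rightarrow> nat list \<Rightarrow> nat" where
  "fuel_eval w A Zero xs = Suc 0"
| "fuel_eval w A Succ xs = (if length xs = 1 then Suc (Suc (arg 0 xs)) else 0)"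
| "fuel_eval w A (Proj i) xs = (if i < length xs then Suc (arg i xs) else 0)"
| "fuel_eval w A Oracle xs = (if length xs = 1 then Suc (of_bool (arg 0 xs \<in> A)) else 0)"
| "fuel_eval w A (Comp f gs) xs =
     (if \<exists>g\<in>set gs. fuel_eval w A g xs = 0 then 0 else fuel_eval w A f (map (\<lambda>g. fuel_eval w A g xs - 1) gs))"
| "fuel_eval w A (Prec f g) xs = (if xs = [] then 0 else
     rec_nat (fuel_eval w A f (tl xs))
       (\<lambda>i r. if r = 0 then 0 else fuel_eval w A g (i # (r - 1) # tl xs)) (arg 0 xs))"
| "fuel_eval w A (Mu f) xs =
     (\<Sum>n<w. if fuel_eval w A f (n # xs) = 1 \<and> (\<forall>m<n. fuel_eval w A f (m # xs) > 1) then Suc n else 0)"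

lemma fuel_eval_Prec_Cons: "fuel_eval w A (Prec f g) (n # zs) =
    rec_nat (fuel_eval w A f zs) (\<lambda>i r. if r = 0 then 0 else fuel_eval w A g (i # (r - 1) # zs)) n"
  by (simp only: fuel_eval.simps vr_Cons_0 list.sel list.distinct if_False)

lemma fuel_eval_sound: "fuel_eval w A p xs = Suc y \<Longrightarrow> orec_eval A p xs y"
proof (induction p arbitrary: xs y)
  case Zero
  then show ?case by (auto intro: eval_Zero)
next
  case Succ
  then show ?case by (auto simp: length_Suc_conv intro: eval_Succ split: if_splits)
next
  case (Proj i)
  then show ?case using eval_Proj[of i xs] by (auto simp: arg_def split: if_splits)
next
  case Oracle
  then show ?case by (auto simp: length_Suc_conv simp del: of_bool_eq intro!: eval_Oracle split: if_splits)
next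
  case (Comp f gs)
  from Comp.prems have gs: "\<forall>g\<in>set gs. fuel_eval w A g xs \<noteq> 0"
    and f: "fuel_eval w A f (map (\<lambda>g. fuel_eval w A g xs - 1) gs) = Suc y"
    by (auto split: if_splits)
  show ?case
  proof (rule eval_Comp)
    show "list_all2 (\<lambda>g. orec_eval A g xs) gs (map (\<lambda>g. fuel_eval w A g xs - 1) gs)"
      using gs by (auto simp: list_all2_conv_all_nth intro!: Comp.IH(2))
  qed (rule Comp.IH(1)[OF f])
next
  case (Prec f g)
  then obtain n zs where xs: "xs = n # zs" by (cases xs) auto
  have "rec_nat (fuel_eval w A f zs) (\<lambda>i r. if r = 0 then 0 else fuel_eval w A g (i # (r - 1) # zs)) n = Suc y \<Longrightarrow>
    orec_eval A (Prec f g) (n # zs) y" for n y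
  proof (induction n arbitrary: y)
    case 0
    then show ?case by (auto intro!: eval_Prec_0 Prec.IH(1))
  next
    case (Suc n)
    define r where "r = rec_nat (fuel_eval w A f zs) (\<lambda>i r. if r = 0 then 0 else fuel_eval w A g (i # (r - 1) # zs)) n"
    from Suc.prems have r: "r \<noteq> 0" "fuel_eval w A g (n # (r - 1) # zs) = Suc y"
      by (auto simp: r_def[symmetric] split: if_splits)
    from r(1) have "r = Suc (r - 1)" by simp
    then have "orec_eval A (Prec f g) (n # zs) (r - 1)" using Suc.IH r_def by simp
    then show ?case using Prec.IH(2)[OF r(2)] by (rule eval_Prec_Suc)
  qed
  then show ?case using Prec.prems unfolding xs by (simp only: fuel_eval_Prec_Cons)
next
  case (Mu f)
  from Mu.prems have "\<exists>n<w. (if fuel_eval w A f (n # xs) = 1 \<and> (\<forall>m<n. fuel_eval w A f (m # xs) > 1) then Suc n else 0) \<noteq> 0"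
  proof (rule contrapos_pp)
    assume "\<not> (\<exists>n<w. (if fuel_eval w A f (n # xs) = 1 \<and> (\<forall>m<n. fuel_eval w A f (m # xs) > 1) then Suc n else 0) \<noteq> 0)"
    then have "fuel_eval w A (Mu f) xs = 0" unfolding fuel_eval.simps by (intro sum.neutral) blast
    then show "fuel_eval w A (Mu f) xs \<noteq> Suc y" by simp
  qed
  then obtain n where n: "n < w" "fuel_eval w A f (n # xs) = 1" "\<forall>m<n. fuel_eval w A f (m # xs) > 1"
    by (auto split: if_splits)
  \<comment> \<open>Two indices cannot both qualify: the smaller would have the value
    \<open>1\<close> and, lying below the larger, a value above \<open>1\<close>. The sum therefore
    has a single nonzero term.\<close>
  have "(\<Sum>k<w. if fuel_eval w A f (k # xs) = 1 \<and> (\<forall>m<k. fuel_eval w A f (m # xs) > 1) then Suc k else 0) =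
    (\<Sum>k<w. if k = n then Suc n else 0)"
  proof (rule sum.cong[OF refl])
    fix k assume "k \<in> {..<w}"
    show "(if fuel_eval w A f (k # xs) = 1 \<and> (\<forall>m<k. fuel_eval w A f (m # xs) > 1) then Suc k else 0) =
      (if k = n then Suc n else 0)"
      using n by (cases k n rule: linorder_cases) auto
  qed
  also have "\<dots> = Suc n" using n(1) by simp
  finally have y: "y = n" using Mu.prems by simp
  show ?case unfolding y
  proof (rule eval_Mu)
    show "orec_eval A f (n # xs) 0" using n(2) by (intro Mu.IH) simp
    show "\<forall>m<n. \<exists>y. orec_eval A f (m # xs) (Suc y)"
    proof (intro allI impI)
      fix m assume "m < n"
      then have "fuel_eval w A f (m # xs) = Suc (Suc (fuel_eval w A f (m # xs) - 2))" using n(3) by fastforce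
      then show "\<exists>y. orec_eval A f (m # xs) (Suc y)" using Mu.IH by blast
    qed
  qed
qed

text \<open>Claiming success for all large fuels, instead of for one, is what makes the induction go
  through: the subcomputations of a composition, a recursion or a minimization have to succeed with
  a common fuel.\<close>

lemma fuel_eval_complete: "orec_eval A p xs y \<Longrightarrow> \<exists>v. \<forall>w\<ge>v. fuel_eval w A p xs = Suc y"
proof (induction rule: orec_eval.induct)
  case (eval_Comp xs gs ys f z)
  then have len: "length gs = length ys"
    and "\<forall>i<length gs. \<exists>v. \<forall>w\<ge>v. fuel_eval w A (gs ! i) xs = Suc (ys ! i)"
    by (auto simp: list_all2_conv_all_nth)
  then obtain v where v: "\<And>i w. i < length gs \<Longrightarrow> v i \<le> w \<Longrightarrow> fuel_eval w A (gs ! i) xs = Suc (ys ! i)"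
    by metis
  from eval_Comp.IH(2) obtain u where u: "\<And>w. w \<ge> u \<Longrightarrow> fuel_eval w A f ys = Suc z" by blast
  have "fuel_eval w A (Comp f gs) xs = Suc z" if "w \<ge> max u (\<Sum>i<length gs. v i)" for w
  proof -
    have g: "fuel_eval w A (gs ! i) xs = Suc (ys ! i)" if i: "i < length gs" for i
    proof (rule v[OF i])
      have "v i \<le> (\<Sum>i<length gs. v i)" using i by (intro member_le_sum) auto
      then show "v i \<le> w" using \<open>w \<ge> max u (\<Sum>i<length gs. v i)\<close> by linarith
    qed
    then have "map (\<lambda>g. fuel_eval w A g xs - 1) gs = ys"
      using len by (intro nth_equalityI) auto
    moreover have "\<not> (\<exists>g\<in>set gs. fuel_eval w A g xs = 0)"
      using g by (auto simp: in_set_conv_nth)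
    ultimately show ?thesis using u that by simp
  qed
  then show ?case by blast
next
  case (eval_Prec_Suc f g n xs r y)
  from eval_Prec_Suc.IH obtain v v' where
    "\<And>w. w \<ge> v \<Longrightarrow> fuel_eval w A (Prec f g) (n # xs) = Suc r"
    "\<And>w. w \<ge> v' \<Longrightarrow> fuel_eval w A g (n # r # xs) = Suc y" by blast
  then show ?case by (intro exI[of _ "max v v'"]) (auto simp: fuel_eval_Prec_Cons simp del: fuel_eval.simps)
next
  case (eval_Mu f n xs)
  from eval_Mu.IH obtain v where v: "\<And>w. w \<ge> v \<Longrightarrow> fuel_eval w A f (n # xs) = Suc 0" by blast
  from eval_Mu.IH have "\<forall>m<n. \<exists>y v. \<forall>w\<ge>v. fuel_eval w A f (m # xs) = Suc (Suc y)" by blast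
  then obtain z u where u: "\<And>m w. m < n \<Longrightarrow> u m \<le> w \<Longrightarrow> fuel_eval w A f (m # xs) = Suc (Suc (z m))"
    by metis
  have "fuel_eval w A (Mu f) xs = Suc n" if w: "w \<ge> max (Suc n) (max v (\<Sum>i<n. u i))" for w
  proof -
    have g: "fuel_eval w A f (m # xs) > 1" if m: "m < n" for m
    proof -
      have "u m \<le> (\<Sum>i<n. u i)" using m by (intro member_le_sum) auto
      then show ?thesis using u[OF m, of w] w by simp
    qed
    have n: "fuel_eval w A f (n # xs) = 1" using v[of w] w by simp
    have "fuel_eval w A (Mu f) xs = (\<Sum>k<w. if k = n then Suc n else 0)"
      unfolding fuel_eval.simps
    proof (rule sum.cong[OF refl])
      fix k assume "k \<in> {..<w}"
      show "(if fuel_eval w A f (k # xs) = 1 \<and> (\<forall>m<k. fuel_eval w A f (m # xs) > 1) then Suc k else 0) =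
        (if k = n then Suc n else 0)"
        using n g by (cases k n rule: linorder_cases) (auto dest: g)
    qed
    then show ?thesis using w by simp
  qed
  then show ?case by blast
qed (auto simp: arg_def)

lemma orec_eval_iff_fuel_eval: "orec_eval A p xs y \<longleftrightarrow> (\<exists>w. fuel_eval w A p xs = Suc y)"
  using fuel_eval_sound fuel_eval_complete by (metis order_refl)

lemma dec_turing_join:
  assumes "computable_fun D m f" "computable_fun D m g"
  shows "decidable D m (\<lambda>e. f e \<in> turing_join D (set_decode (g e)))"
proof -
  have *: "x \<in> turing_join D A \<longleftrightarrow> (\<exists>n<Suc x. x = n + n \<and> n \<in> D) \<or> (\<exists>n<Suc x. x = Suc (n + n) \<and> n \<in> A)" for x A
    unfolding turing_join_def by (auto simp: mult_2)
  show ?thesis unfolding *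
    by (intro dec_disj dec_ex dec_conj dec_eq dec_oracle dec_mem cf_Suc cf_add cf_vr cf_tl assms) simp_all
qed

text \<open>The program is fixed and the induction runs over it, whereas the fuel and the code of
  the finite second half of the oracle are arguments, because they are searched over later. The
  arity \<open>m\<close> is arbitrary since composition, recursion and minimization change
  it.\<close>

lemma cf_fuel_eval: "computable_fun D (Suc (Suc m)) (\<lambda>e. fuel_eval (arg 0 e) (turing_join D (set_decode (arg (Suc 0) e))) p (tl (tl e)))"
proof (induction p arbitrary: m)
  case Zero
  show ?case by (simp add: cf_const)
next
  case Succ
  show ?case
  proof (cases "m = 1")
    case True
    have "computable_fun D (Suc (Suc m)) (\<lambda>e. Suc (Suc (arg (Suc (Suc 0)) e)))" using True by (intro cf_Suc cf_vr) simp
    then show ?thesis by (rule cf_cong) (simp add: True)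
  next
    case False
    show ?thesis by (rule cf_cong[OF cf_const[where c = 0]]) (use False in simp)
  qed
next
  case (Proj i)
  show ?case
  proof (cases "i < m")
    case True
    have "computable_fun D (Suc (Suc m)) (\<lambda>e. Suc (arg (Suc (Suc i)) e))" using True by (intro cf_Suc cf_vr) simp
    then show ?thesis by (rule cf_cong) (simp add: True)
  next
    case False
    show ?thesis by (rule cf_cong[OF cf_const[where c = 0]]) (simp add: False)
  qed
next
  case Oracle
  show ?case
  proof (cases "m = 1")
    case True
    have "computable_fun D (Suc (Suc m)) (\<lambda>e. Suc (of_bool (arg (Suc (Suc 0)) e \<in> turing_join D (set_decode (arg (Suc 0) e)))))"
      using True by (intro cf_Suc dec_turing_join[unfolded decidable_def] cf_vr) simp_all
    then show ?thesis by (rule cf_cong) (simp add: True)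
  next
    case False
    show ?thesis by (rule cf_cong[OF cf_const[where c = 0]]) (use False in simp)
  qed
next
  case (Comp f gs)
  have "computable_fun D (Suc (Suc m)) (\<lambda>e. (\<lambda>e. fuel_eval (arg 0 e) (turing_join D (set_decode (arg (Suc 0) e))) f (tl (tl e)))
     (arg 0 e # arg (Suc 0) e #
       map (\<lambda>g. fuel_eval (arg 0 e) (turing_join D (set_decode (arg (Suc 0) e))) g (tl (tl e)) - 1) gs))"
  proof (rule cf_env[OF Comp.IH(1)[of "length gs"]], goal_cases)
    case (1 k)
    show ?case
    proof (cases k)
      case (Suc k')
      then show ?thesis
      proof (cases k')
        case (Suc j)
        have j: "j < length gs" using 1 \<open>k = Suc k'\<close> Suc by simp
        then have "computable_fun D (Suc (Suc m)) (\<lambda>e. fuel_eval (arg 0 e) (turing_join D (set_decode (arg (Suc 0) e))) (gs ! j) (tl (tl e)) - Suc 0)"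
          by (intro cf_pred Comp.IH(2)) simp
        then show ?thesis using \<open>k = Suc k'\<close> Suc j by (simp add: arg_def[of j])
      qed (auto intro: cf_vr)
    qed (auto intro: cf_vr)
  qed simp
  moreover have "decidable D (Suc (Suc m)) (\<lambda>e. \<exists>g\<in>set gs. fuel_eval (arg 0 e) (turing_join D (set_decode (arg (Suc 0) e))) g (tl (tl e)) = 0)"
    by (intro dec_bex dec_eq Comp.IH(2) cf_const) auto
  ultimately show ?case by (simp add: cf_if cf_const)
next
  case (Prec f g)
  show ?case
  proof (cases m)
    case 0
    show ?thesis by (rule cf_cong[OF cf_const[where c = 0]]) (auto simp: 0 length_Suc_conv)
  next
    case (Suc k)
    have f: "computable_fun D (Suc (Suc m)) (\<lambda>e. (\<lambda>e. fuel_eval (arg 0 e) (turing_join D (set_decode (arg (Suc 0) e))) f (tl (tl e)))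
        (arg 0 e # arg (Suc 0) e # tl (tl (tl e))))"
      by (rule cf_env[OF Prec.IH(1)[of k]]) (auto simp: Suc less_Suc_eq_0_disj intro: cf_vr)
    have g: "computable_fun D (Suc (Suc (Suc (Suc m)))) (\<lambda>e. (\<lambda>e. fuel_eval (arg 0 e) (turing_join D (set_decode (arg (Suc 0) e))) g (tl (tl e)))
        (arg (Suc (Suc 0)) e # arg (Suc (Suc (Suc 0))) e # arg 0 e # (arg (Suc 0) e - 1) # tl (tl (tl (tl (tl e))))))"
      by (rule cf_env[OF Prec.IH(2)[of "Suc m"]]) (auto simp: Suc less_Suc_eq_0_disj intro!: cf_vr cf_pred[OF cf_vr])
    have "computable_fun D (Suc (Suc m)) (\<lambda>e. rec_nat (fuel_eval (arg 0 e) (turing_join D (set_decode (arg (Suc 0) e))) f (tl (tl (tl e))))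
       (\<lambda>i r. if r = 0 then 0 else fuel_eval (arg 0 e) (turing_join D (set_decode (arg (Suc 0) e))) g (i # (r - 1) # tl (tl (tl e)))) (arg (Suc (Suc 0)) e))"
    proof (rule cf_rec)
      show "computable_fun D (Suc (Suc m)) (\<lambda>e. fuel_eval (arg 0 e) (turing_join D (set_decode (arg (Suc 0) e))) f (tl (tl (tl e))))"
        using f by simp
      show "computable_fun D (Suc (Suc m)) (\<lambda>e. arg (Suc (Suc 0)) e)" by (rule cf_vr) (simp add: Suc)
      show "computable_fun D (Suc (Suc (Suc (Suc m))))
        (\<lambda>e. if arg (Suc 0) e = 0 then 0
              else fuel_eval (arg 0 (tl (tl e))) (turing_join D (set_decode (arg (Suc 0) (tl (tl e))))) g
                    (arg 0 e # (arg (Suc 0) e - 1) # tl (tl (tl (tl (tl e))))))"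
        using g by (intro cf_if dec_eq cf_const cf_vr) (auto simp: Suc)
    qed
    then show ?thesis by (rule cf_cong) (auto simp: Suc length_Suc_conv)
  qed
next
  case (Mu f)
  have 1: "computable_fun D k (\<lambda>e. fuel_eval (h e) (turing_join D (set_decode (h' e))) f (h2 e # t e))"
    if "computable_fun D k h" "computable_fun D k h'" "computable_fun D k h2" "\<And>i. i < m \<Longrightarrow> computable_fun D k (\<lambda>e. arg i (t e))"
      "\<And>e. length e = k \<Longrightarrow> length (t e) = m" for k h h' h2 t
  proof -
    have "computable_fun D k (\<lambda>e. (\<lambda>e. fuel_eval (arg 0 e) (turing_join D (set_decode (arg (Suc 0) e))) f (tl (tl e)))
        (h e # h' e # h2 e # t e))"
      by (rule cf_env[OF Mu.IH[of "Suc m"]]) (use that in \<open>auto simp: less_Suc_eq_0_disj\<close>)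
    then show ?thesis by simp
  qed
  show ?case
    unfolding fuel_eval.simps
    by (intro cf_sum cf_if dec_conj dec_eq dec_all dec_less 1 cf_const cf_Suc cf_vr) (auto intro: cf_vr)
qed

lemma ce_orec_eval:
  assumes "computable_fun D m f" "computable_fun D m x" "computable_fun D m y"
  shows "semidecidable D m (\<lambda>e. orec_eval (turing_join D (set_decode (f e))) p [x e] (y e))"
  unfolding orec_eval_iff_fuel_eval
proof (rule ce_ex, rule ce_dec, rule dec_eq)
  have "computable_fun D (Suc m) (\<lambda>e. (\<lambda>e. fuel_eval (arg 0 e) (turing_join D (set_decode (arg (Suc 0) e))) p (tl (tl e)))
     [arg 0 e, f (tl e), x (tl e)])"
    by (rule cf_env[OF cf_fuel_eval[of D 1]]) (use assms[THEN cf_tl] in \<open>auto simp: less_Suc_eq_0_disj intro: cf_vr\<close>)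
  then show "computable_fun D (Suc m) (\<lambda>e. fuel_eval (arg 0 e) (turing_join D (set_decode (f (tl e)))) p [x (tl e)])"
    by simp
  show "computable_fun D (Suc m) (\<lambda>e. Suc (y (tl e)))" by (intro cf_Suc cf_tl assms)
qed

subsection \<open>Compactness and effectively closed classes\<close>

text \<open>If each \<open>b\<close> failed at some \<open>T b\<close>, all of them would fail at
  the sum of these numbers.\<close>

lemma finite_antitone_choice:
  assumes "finite B" "\<And>T. \<exists>b\<in>B. P b T" "\<And>b T T'. T \<le> T' \<Longrightarrow> P b T' \<Longrightarrow> P b (T :: nat)"
  shows "\<exists>b\<in>B. \<forall>T. P b T"
proof (rule ccontr)
  assume "\<not> ?thesis"
  then have "\<forall>b\<in>B. \<exists>T. \<not> P b T" by blast
  then obtain T where T: "\<And>b. b \<in> B \<Longrightarrow> \<not> P b (T b)" by metis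
  from assms(2) obtain b where b: "b \<in> B" "P b (\<Sum>b\<in>B. T b)" by blast
  then have "P b (T b)" using assms(1) by (intro assms(3)[OF _ b(2)] member_le_sum) auto
  with T b show False by blast
qed

text \<open>\<open>P t a T\<close> says that \<open>a\<close> in layer \<open>t\<close> starts a
  path up to layer \<open>T\<close>. It is antitone in \<open>T\<close>, so among the finitely many
  successors of an element with arbitrarily long continuations, one has arbitrarily long
  continuations again.\<close>

lemma koenig:
  fixes A :: "nat \<Rightarrow> 'a set"
  assumes fin: "\<And>t. finite (A t)"
    and path: "\<And>T. \<exists>\<pi>. (\<forall>t\<le>T. \<pi> t \<in> A t) \<and> (\<forall>t<T. R t (\<pi> t) (\<pi> (Suc t)))"
  shows "\<exists>\<pi>. \<forall>t. \<pi> t \<in> A t \<and> R t (\<pi> t) (\<pi> (Suc t))"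
proof -
  define P where "P t a T \<longleftrightarrow> (\<exists>\<pi>. \<pi> t = a \<and> (\<forall>i. t \<le> i \<and> i \<le> T \<longrightarrow> \<pi> i \<in> A i) \<and>
      (\<forall>i. t \<le> i \<and> i < T \<longrightarrow> R i (\<pi> i) (\<pi> (Suc i))))" for t a T
  have anti: "P t a T" if "T \<le> T'" "P t a T'" for t a T T'
  proof -
    from that(2) obtain \<pi> where "\<pi> t = a" "\<forall>i. t \<le> i \<and> i \<le> T' \<longrightarrow> \<pi> i \<in> A i"
      "\<forall>i. t \<le> i \<and> i < T' \<longrightarrow> R i (\<pi> i) (\<pi> (Suc i))" unfolding P_def by blast
    with that(1) show ?thesis unfolding P_def by (intro exI[of _ \<pi>]) auto
  qed
  have "\<exists>a\<in>A 0. \<forall>T. P 0 a T"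
  proof (rule finite_antitone_choice[OF fin _ anti])
    fix T
    from path[of T] obtain \<pi> where "\<forall>t\<le>T. \<pi> t \<in> A t" "\<forall>t<T. R t (\<pi> t) (\<pi> (Suc t))" by blast
    then show "\<exists>a\<in>A 0. P 0 a T" unfolding P_def by (intro bexI[of _ "\<pi> 0"] exI[of _ \<pi>]) auto
  qed
  moreover have "\<exists>b. (b \<in> A (Suc t) \<and> (\<forall>T. P (Suc t) b T)) \<and> R t a b"
    if a: "a \<in> A t \<and> (\<forall>T. P t a T)" for a t
  proof -
    have "\<exists>b\<in>{b \<in> A (Suc t). R t a b}. \<forall>T. P (Suc t) b T"
    proof (rule finite_antitone_choice)
      show "finite {b \<in> A (Suc t). R t a b}" using fin by simp
      fix T
      from a have "P t a (max (Suc t) T)" by blast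
      then obtain \<pi> where \<pi>: "\<pi> t = a" "\<forall>i. t \<le> i \<and> i \<le> max (Suc t) T \<longrightarrow> \<pi> i \<in> A i"
        "\<forall>i. t \<le> i \<and> i < max (Suc t) T \<longrightarrow> R i (\<pi> i) (\<pi> (Suc i))"
        unfolding P_def by blast
      then have "\<pi> (Suc t) \<in> A (Suc t)" "R t a (\<pi> (Suc t))" by auto
      moreover have "P (Suc t) (\<pi> (Suc t)) T"
        unfolding P_def using \<pi> by (intro exI[of _ \<pi>]) auto
      ultimately show "\<exists>b\<in>{b \<in> A (Suc t). R t a b}. P (Suc t) b T" by blast
    qed (rule anti)
    then show ?thesis by blast
  qed
  ultimately obtain \<pi> where "\<forall>t. (\<pi> t \<in> A t \<and> (\<forall>T. P t (\<pi> t) T)) \<and> R t (\<pi> t) (\<pi> (Suc t))"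
    using dependent_nat_choice[of "\<lambda>t a. a \<in> A t \<and> (\<forall>T. P t a T)" R] by blast
  then show ?thesis by blast
qed

text \<open>Turns quantification over the subsets of \<open>{..<m}\<close> into quantification over
  the numbers below \<open>2 ^ m\<close>.\<close>

lemma set_decode_subset_lessThan: "set_decode a \<subseteq> {..<m} \<longleftrightarrow> a < 2 ^ m"
proof
  assume "a < 2 ^ m"
  show "set_decode a \<subseteq> {..<m}"
  proof
    fix x assume "x \<in> set_decode a"
    then have "2 ^ x \<le> a" using set_decode_iff[of x a] by (auto simp: algebra_simps trans_le_add1)
    then have "(2::nat) ^ x < 2 ^ m" using \<open>a < 2 ^ m\<close> by linarith
    then show "x \<in> {..<m}" by simp
  qed
next
  assume *: "set_decode a \<subseteq> {..<m}"
  have "set_encode {..<m} < 2 ^ m"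
    unfolding set_encode_def by (induction m) (auto simp: lessThan_Suc)
  moreover have "set_decode a \<subseteq> set_decode (set_encode {..<m})" using * by simp
  ultimately show "a < 2 ^ m" using subset_decode_imp_le by (meson order_le_less_trans)
qed

text \<open>A pair \<open>(a, b)\<close> stands for the basic open set of all \<open>c\<close> including the finite set coded by \<open>a\<close>
  and disjoint from the one coded by \<open>b\<close>.\<close>

definition obstructed :: "(nat \<Rightarrow> nat \<Rightarrow> bool) \<Rightarrow> nat set \<Rightarrow> bool" where
  "obstructed W c \<longleftrightarrow> (\<exists>a b. W a b \<and> set_decode a \<subseteq> c \<and> set_decode b \<inter> c = {})"

lemma obstI: "W a b \<Longrightarrow> set_decode a \<subseteq> c \<Longrightarrow> set_decode b \<inter> c = {} \<Longrightarrow> obstructed W c"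
  unfolding obstructed_def by blast

text \<open>Compactness of Cantor space, in a form that can be searched: the single number
  \<open>m\<close> bounds both the length of the bit patterns \<open>u\<close> and the codes of the
  open sets that cover them.\<close>

lemma obst_compact:
  "(\<forall>c. obstructed W c) \<longleftrightarrow> (\<exists>m. \<forall>u<2 ^ m. \<exists>a b. W a b \<and> a < 2 ^ m \<and> b < 2 ^ m \<and>
     set_decode a \<subseteq> set_decode u \<and> set_decode b \<inter> set_decode u = {})" (is "?L \<longleftrightarrow> ?R")
proof
  assume ?R
  then obtain m where m: "\<And>u. u < 2 ^ m \<Longrightarrow> \<exists>a b. W a b \<and> a < 2 ^ m \<and> b < 2 ^ m \<and>
     set_decode a \<subseteq> set_decode u \<and> set_decode b \<inter> set_decode u = {}" by blast
  show ?L
  proof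
    fix c
    define u where "u = set_encode (c \<inter> {..<m})"
    have u: "set_decode u = c \<inter> {..<m}" unfolding u_def by simp
    then have "u < 2 ^ m" by (metis set_decode_subset_lessThan Int_lower2)
    from m[OF this] obtain a b where "W a b" "b < 2 ^ m"
      "set_decode a \<subseteq> c \<inter> {..<m}" "set_decode b \<inter> (c \<inter> {..<m}) = {}" unfolding u by blast
    moreover from this have "set_decode b \<subseteq> {..<m}" by (simp add: set_decode_subset_lessThan)
    ultimately show "obstructed W c" unfolding obstructed_def by blast
  qed
next
  show ?R if ?L
  proof (rule ccontr)
    assume nR: "\<not> ?R"
    \<comment> \<open>A pattern \<open>u\<close> on \<open>{..<t}\<close> is free if no open set
      supported below \<open>t\<close> contains it. Restrictions of free patterns are free, so
      Koenig's lemma yields an infinite sequence all of whose restrictions are free.\<close>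
    define free where "free t u \<longleftrightarrow> \<not> (\<exists>a b. W a b \<and> set_decode a \<subseteq> {..<t} \<and> set_decode b \<subseteq> {..<t} \<and>
      set_decode a \<subseteq> u \<and> set_decode b \<inter> u = {})" for t u
    have "\<exists>\<pi>. \<forall>t. \<pi> t \<in> {u. u \<subseteq> {..<t} \<and> free t u} \<and> \<pi> (Suc t) \<inter> {..<t} = \<pi> t"
    proof (rule koenig)
      show "finite {u. u \<subseteq> {..<t} \<and> free t u}" for t :: nat by simp
      fix T
      from nR obtain u where u: "u < 2 ^ T" "free T (set_decode u)"
        unfolding free_def set_decode_subset_lessThan by blast
      have "free t (set_decode u \<inter> {..<t})" if "t \<le> T" for t
        unfolding free_def
      proof (rule notI, elim exE conjE)
        fix a b assume "W a b" and ab: "set_decode a \<subseteq> {..<t}" "set_decode b \<subseteq> {..<t}"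
          "set_decode a \<subseteq> set_decode u \<inter> {..<t}" "set_decode b \<inter> (set_decode u \<inter> {..<t}) = {}"
        have "{..<t} \<subseteq> {..<T}" using that by auto
        then have "set_decode a \<subseteq> {..<T}" "set_decode b \<subseteq> {..<T}" using ab(1,2) by auto
        moreover have "set_decode a \<subseteq> set_decode u" using ab(3) by simp
        moreover have "set_decode b \<inter> set_decode u = {}" using ab(2,4) by (simp add: disjoint_iff subset_iff)
        ultimately have "\<not> free T (set_decode u)"
          unfolding free_def not_not using \<open>W a b\<close> by (intro exI[of _ a] exI[of _ b] conjI)
        then show False using u(2) by contradiction
      qed
      then show "\<exists>\<pi>. (\<forall>t\<le>T. \<pi> t \<in> {u. u \<subseteq> {..<t} \<and> free t u}) \<and> (\<forall>t<T. \<pi> (Suc t) \<inter> {..<t} = \<pi> t)"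
        by (intro exI[of _ "\<lambda>t. set_decode u \<inter> {..<t}"]) auto
    qed
    then obtain \<pi> where \<pi>: "\<And>t. \<pi> t \<subseteq> {..<t}" "\<And>t. free t (\<pi> t)" "\<And>t. \<pi> (Suc t) \<inter> {..<t} = \<pi> t"
      by blast
    define c where "c = (\<Union>t. \<pi> t)"
    have grow_miss_step: "\<pi> (t + k) \<inter> {..<t} = \<pi> t" for t k
    proof (induction k)
      case 0
      show ?case using \<pi>(1)[of t] by auto
    next
      case (Suc k)
      have "\<pi> (t + Suc k) \<inter> {..<t} = (\<pi> (Suc (t + k)) \<inter> {..<t + k}) \<inter> {..<t}" by auto
      then show ?case using \<pi>(3)[of "t + k"] Suc by simp
    qed
    have c: "c \<inter> {..<t} = \<pi> t" for t
    proof
      show "\<pi> t \<subseteq> c \<inter> {..<t}" unfolding c_def using \<pi>(1) by blast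
      show "c \<inter> {..<t} \<subseteq> \<pi> t"
      proof
        fix x assume "x \<in> c \<inter> {..<t}"
        then obtain t' where "x \<in> \<pi> t'" "x < t" unfolding c_def by blast
        moreover have "\<pi> t' \<subseteq> \<pi> (t + t')" using grow_miss_step[of t' t] by (auto simp: add.commute)
        ultimately show "x \<in> \<pi> t" using grow_miss_step[of t t'] by auto
      qed
    qed
    from that have "obstructed W c" by blast
    then obtain a b where ab: "W a b" "set_decode a \<subseteq> c" "set_decode b \<inter> c = {}"
      unfolding obstructed_def by blast
    \<comment> \<open>Elements of a coded set are smaller than its code, so both sets are supported
      below the sum of the codes.\<close>
    define t where "t = a + b"
    have "set_decode a \<subseteq> {..<t}" "set_decode b \<subseteq> {..<t}"
      unfolding t_def using mem_set_decode_less by fastforce+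
    moreover from this have "set_decode a \<subseteq> \<pi> t" "set_decode b \<inter> \<pi> t = {}" using ab c[of t] by auto
    ultimately have "\<not> free t (\<pi> t)"
      unfolding free_def not_not using ab(1) by (intro exI[of _ a] exI[of _ b] conjI)
    then show False using \<pi>(2) by contradiction
  qed
qed

lemma ce_subst2:
  assumes "semidecidable D 2 (\<lambda>e. W (arg 0 e) (arg (Suc 0) e))" "computable_fun D m f" "computable_fun D m g"
  shows "semidecidable D m (\<lambda>e. W (f e) (g e))"
proof -
  have "semidecidable D m (\<lambda>e. (\<lambda>e. W (arg 0 e) (arg (Suc 0) e)) [f e, g e])"
    by (rule ce_env[OF assms(1)]) (use assms in \<open>auto simp: less_Suc_eq_0_disj numeral_2_eq_2\<close>)
  then show ?thesis by simp
qed

lemma dec_subset: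
  assumes "computable_fun D m f" "computable_fun D m g"
  shows "decidable D m (\<lambda>e. set_decode (f e) \<subseteq> set_decode (g e))"
proof -
  have *: "set_decode a \<subseteq> set_decode b \<longleftrightarrow> (\<forall>x<a. x \<in> set_decode a \<longrightarrow> x \<in> set_decode b)" for a b
    using mem_set_decode_less by blast
  show ?thesis unfolding * by (intro dec_all dec_imp dec_mem cf_vr cf_tl assms) simp_all
qed

lemma dec_disjoint:
  assumes "computable_fun D m f" "computable_fun D m g"
  shows "decidable D m (\<lambda>e. set_decode (f e) \<inter> set_decode (g e) = {})"
proof -
  have *: "set_decode a \<inter> set_decode b = {} \<longleftrightarrow> (\<forall>x<a. x \<in> set_decode a \<longrightarrow> x \<notin> set_decode b)" for a b
    using mem_set_decode_less by blast
  show ?thesis unfolding * by (intro dec_all dec_imp dec_not dec_mem cf_vr cf_tl assms) simp_all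
qed

text \<open>Emptiness of an effectively closed class is semidecidable, uniformly in parameters:
  compactness replaces the quantifier over all \<open>c\<close> by a search for one number.\<close>

lemma ce_obst_all:
  assumes "semidecidable D (Suc (Suc m)) (\<lambda>e. W (arg 0 e) (arg (Suc 0) e) (tl (tl e)))"
  shows "semidecidable D m (\<lambda>e. \<forall>c. obstructed (\<lambda>a b. W a b e) c)"
  unfolding obst_compact
proof (intro ce_ex ce_all ce_conj)
  have "semidecidable D (Suc (Suc (Suc (Suc m)))) (\<lambda>e. (\<lambda>e. W (arg 0 e) (arg (Suc 0) e) (tl (tl e)))
      (arg (Suc 0) e # arg 0 e # tl (tl (tl (tl e)))))"
    by (rule ce_env[OF assms]) (auto simp: less_Suc_eq_0_disj intro: cf_vr)
  then show "semidecidable D (Suc (Suc (Suc (Suc m)))) (\<lambda>e. W (arg 0 (tl e)) (arg 0 e) (tl (tl (tl (tl e)))))"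
    by simp
qed (simp_all add: ce_dec dec_less dec_subset dec_disjoint cf_vr cf_pow2)

text \<open>A class is presented by an enumeration of basic open sets that exhaust its complement,
  rather than by a tree, so that an intersection is just a disjunction of enumerations.\<close>

definition eff_closed :: "nat set \<Rightarrow> nat set set \<Rightarrow> bool" where
  "eff_closed D Q \<longleftrightarrow> (\<exists>W. semidecidable D 2 (\<lambda>e. W (arg 0 e) (arg (Suc 0) e)) \<and> Q = {c. \<not> obstructed W c})"

lemma effI: "semidecidable D 2 (\<lambda>e. W (arg 0 e) (arg (Suc 0) e)) \<Longrightarrow> Q = {c. \<not> obstructed W c} \<Longrightarrow> eff_closed D Q"
  unfolding eff_closed_def by blast

lemma eff_UNIV: "eff_closed D UNIV"
  by (rule effI[where W = "\<lambda>_ _. False"]) (auto simp: obstructed_def intro: ce_dec dec_const)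

lemma eff_Int:
  assumes "eff_closed D Q" "eff_closed D Q'"
  shows "eff_closed D (Q \<inter> Q')"
proof -
  from assms obtain W W' where "semidecidable D 2 (\<lambda>e. W (arg 0 e) (arg (Suc 0) e))" "Q = {c. \<not> obstructed W c}"
    "semidecidable D 2 (\<lambda>e. W' (arg 0 e) (arg (Suc 0) e))" "Q' = {c. \<not> obstructed W' c}"
    unfolding eff_closed_def by blast
  then show ?thesis
    by (intro effI[where W = "\<lambda>a b. W a b \<or> W' a b"] ce_disj) (auto simp: obstructed_def)
qed

lemma eff_INT: "finite I \<Longrightarrow> (\<And>i. i \<in> I \<Longrightarrow> eff_closed D (Q i)) \<Longrightarrow> eff_closed D (\<Inter>i\<in>I. Q i)"
  by (induction I rule: finite_induct) (auto intro: eff_UNIV eff_Int)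

lemma eff_mem_eq: "eff_closed D {c. (z \<in> c) = s}"
proof (rule effI[where W = "\<lambda>a b. z \<in> set_decode (if s then b else a)"])
  show "semidecidable D 2 (\<lambda>e. z \<in> set_decode (if s then arg (Suc 0) e else arg 0 e))"
    by (cases s) (auto intro!: ce_dec dec_mem cf_const cf_vr)
  have z: "set_decode (2 ^ z) = {z}"
    using set_encode_inverse[of "{z}"] by (simp add: set_encode_def)
  have "(z \<in> c) = s" if n: "\<not> obstructed (\<lambda>a b. z \<in> set_decode (if s then b else a)) c" for c
  proof (rule ccontr)
    assume *: "(z \<in> c) \<noteq> s"
    have "obstructed (\<lambda>a b. z \<in> set_decode (if s then b else a)) c"
      by (rule obstI[where a = "if s then 0 else 2 ^ z" and b = "if s then 2 ^ z else 0"])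
        (use * z in \<open>auto split: if_splits\<close>)
    with n show False by contradiction
  qed
  moreover have "\<not> obstructed (\<lambda>a b. z \<in> set_decode (if s then b else a)) c" if z: "(z \<in> c) = s" for c
  proof
    assume "obstructed (\<lambda>a b. z \<in> set_decode (if s then b else a)) c"
    then obtain a b where "z \<in> set_decode (if s then b else a)" "set_decode a \<subseteq> c" "set_decode b \<inter> c = {}"
      unfolding obstructed_def by blast
    then show False using z by (cases s) auto
  qed
  ultimately show "{c. (z \<in> c) = s} = {c. \<not> obstructed (\<lambda>a b. z \<in> set_decode (if s then b else a)) c}"
    by (intro Collect_cong) blast
qed

definition row :: "nat \<Rightarrow> nat set \<Rightarrow> nat set" where
  "row i c = {x. prod_encode (i, x) \<in> c}"

lemma eff_row:
  assumes "eff_closed D Q"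
  shows "eff_closed D {c. row i c \<in> Q}"
proof -
  from assms obtain W where W: "semidecidable D 2 (\<lambda>e. W (arg 0 e) (arg (Suc 0) e))" "Q = {c. \<not> obstructed W c}"
    unfolding eff_closed_def by blast
  \<comment> \<open>The preimage of a basic open set under \<open>row i\<close> is basic open.
    Demanding only that \<open>a\<close> and \<open>b\<close> contain the translated sets, not that
    they equal them, leaves bounded quantifiers and the same union of open sets.\<close>
  define W' where "W' a b \<longleftrightarrow> (\<exists>a' b'. W a' b' \<and>
     (\<forall>x<a'. x \<in> set_decode a' \<longrightarrow> prod_encode (i, x) \<in> set_decode a) \<and>
     (\<forall>x<b'. x \<in> set_decode b' \<longrightarrow> prod_encode (i, x) \<in> set_decode b))" for a b
  have "semidecidable D 2 (\<lambda>e. W' (arg 0 e) (arg (Suc 0) e))"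
    unfolding W'_def
    by (intro ce_ex ce_conj ce_subst2[OF W(1)] ce_dec dec_all dec_imp dec_mem cf_vr cf_prod_encode cf_const)
      (auto intro: cf_vr)
  moreover have "obstructed W (row i c) \<longleftrightarrow> obstructed W' c" for c
  proof
    assume "obstructed W (row i c)"
    then obtain a b where ab: "W a b" "set_decode a \<subseteq> row i c" "set_decode b \<inter> row i c = {}"
      unfolding obstructed_def by blast
    define a' where "a' = set_encode ((\<lambda>x. prod_encode (i, x)) ` set_decode a)"
    define b' where "b' = set_encode ((\<lambda>x. prod_encode (i, x)) ` set_decode b)"
    have "W' a' b'" unfolding W'_def a'_def b'_def using ab(1)
      by (intro exI[of _ a] exI[of _ b]) simp
    moreover have "set_decode a' \<subseteq> c" "set_decode b' \<inter> c = {}"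
      using ab(2,3) unfolding a'_def b'_def row_def by auto
    ultimately show "obstructed W' c" unfolding obstructed_def by blast
  next
    assume "obstructed W' c"
    then obtain a b where ab: "W' a b" "set_decode a \<subseteq> c" "set_decode b \<inter> c = {}"
      unfolding obstructed_def by blast
    then obtain a' b' where "W a' b'" "\<forall>x<a'. x \<in> set_decode a' \<longrightarrow> prod_encode (i, x) \<in> set_decode a"
     "\<forall>x<b'. x \<in> set_decode b' \<longrightarrow> prod_encode (i, x) \<in> set_decode b" unfolding W'_def by blast
    with ab mem_set_decode_less show "obstructed W (row i c)" unfolding obstructed_def row_def by blast
  qed
  ultimately show ?thesis using W(2) by (intro effI[where W = W']) auto
qed

subsection \<open>Strings, trees and candidates\<close>

definition dstr :: "nat \<Rightarrow> bool list" where "dstr = inv str_code"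

lemma dstr_str_code [simp]: "dstr (str_code s) = s"
  and str_code_dstr [simp]: "str_code (dstr x) = x"
  unfolding dstr_def using bij_str_code
  by (auto simp: bij_is_inj bij_is_surj surj_f_inv_f)

lemma str_code_eq_iff [simp]: "str_code s = str_code t \<longleftrightarrow> s = t"
  by (metis dstr_str_code)

lemma str_code_append: "str_code (s @ t) = str_code s + 2 ^ length s * str_code t"
  by (induction s) (auto simp: algebra_simps)

text \<open>The strings of length \<open>n\<close> occupy the block of codes from
  \<open>2 ^ n - 1\<close> to \<open>2 ^ Suc n - 2\<close>; after a shift by one its ends are powers
  of two, which makes lengths decidable.\<close>

lemma str_code_bounds: "2 ^ length s \<le> Suc (str_code s)" "Suc (str_code s) < 2 ^ Suc (length s)"
  by (induction s) auto

lemma length_le_str_code: "length s \<le> str_code s"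
  by (induction s) auto

lemma length_dstr_iff: "length (dstr x) = n \<longleftrightarrow> 2 ^ n \<le> Suc x \<and> Suc x < 2 ^ Suc n"
proof
  show "length (dstr x) = n \<Longrightarrow> 2 ^ n \<le> Suc x \<and> Suc x < 2 ^ Suc n"
    using str_code_bounds[of "dstr x"] by auto
  assume *: "2 ^ n \<le> Suc x \<and> Suc x < 2 ^ Suc n"
  have b: "2 ^ length (dstr x) \<le> Suc x" "Suc x < 2 ^ Suc (length (dstr x))"
    using str_code_bounds[of "dstr x"] by auto
  have "(2::nat) ^ length (dstr x) < 2 ^ Suc n" "(2::nat) ^ n < 2 ^ Suc (length (dstr x))"
    using * b by linarith+
  then have "length (dstr x) < Suc n" "n < Suc (length (dstr x))"
    by (meson power_strict_increasing_iff one_less_numeral_iff semiring_norm(76))+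
  then show "length (dstr x) = n" by simp
qed

definition strs :: "nat \<Rightarrow> bool list set" where
  "strs f = {s. str_code s \<in> set_decode f}"

lemma set_decode_finset_code: "finite F \<Longrightarrow> set_decode (finset_code F) = str_code ` F"
  unfolding finset_code_def by simp

lemma strs_finset_code [simp]: "finite F \<Longrightarrow> strs (finset_code F) = F"
  unfolding strs_def by (auto simp: set_decode_finset_code)

lemma str_code_strs: "str_code ` strs f = set_decode f"
  unfolding strs_def by (auto intro!: image_eqI[of _ _ "dstr _"])

lemma finite_strs [simp]: "finite (strs f)"
  by (rule finite_imageD[of str_code]) (auto simp: str_code_strs inj_on_def)

lemma finset_code_strs [simp]: "finset_code (strs f) = f"
  unfolding finset_code_def str_code_strs by simp

lemma dec_strs_ball:
  assumes "computable_fun D m g" "decidable D (Suc m) (\<lambda>e. P (dstr (arg 0 e)) (tl e))"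
  shows "decidable D m (\<lambda>e. \<forall>s\<in>strs (g e). P s e)"
proof -
  have *: "(\<forall>s\<in>strs f. Q s) \<longleftrightarrow> (\<forall>x<f. x \<in> set_decode f \<longrightarrow> Q (dstr x))" for f Q
    unfolding strs_def using mem_set_decode_less by (metis dstr_str_code mem_Collect_eq str_code_dstr)
  show ?thesis unfolding * by (intro dec_all dec_imp dec_mem cf_vr cf_tl assms) simp_all
qed

lemma dec_strs_bex:
  assumes "computable_fun D m g" "decidable D (Suc m) (\<lambda>e. P (dstr (arg 0 e)) (tl e))"
  shows "decidable D m (\<lambda>e. \<exists>s\<in>strs (g e). P s e)"
  using dec_not[OF dec_strs_ball[OF assms(1) dec_not[OF assms(2)]]] by simp

lemma dec_prefix:
  assumes "computable_fun D m f" "computable_fun D m g"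
  shows "decidable D m (\<lambda>e. prefix (dstr (f e)) (dstr (g e)))"
proof -
  \<comment> \<open>Here \<open>l\<close> is the length of \<open>dstr x\<close> and
    \<open>u\<close> the code of the remaining string, which is shifted by \<open>l\<close> digits
    when appended.\<close>
  have *: "prefix (dstr x) (dstr y) \<longleftrightarrow>
    (\<exists>l<Suc x. \<exists>u<Suc y. 2 ^ l \<le> Suc x \<and> Suc x < 2 ^ l + 2 ^ l \<and> y = x + 2 ^ l * u)" (is "_ \<longleftrightarrow> ?R") for x y
  proof
    assume "prefix (dstr x) (dstr y)"
    then obtain v where v: "dstr y = dstr x @ v" by (auto simp: prefix_def)
    have y: "y = x + 2 ^ length (dstr x) * str_code v"
      using arg_cong[OF v, of str_code] by (simp add: str_code_append)
    moreover have "str_code v \<le> y" unfolding y by (simp add: trans_le_add2)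
    moreover have "length (dstr x) \<le> x" using length_le_str_code[of "dstr x"] by simp
    moreover have "2 ^ length (dstr x) \<le> Suc x" "Suc x < 2 ^ length (dstr x) + 2 ^ length (dstr x)"
      using str_code_bounds[of "dstr x"] by auto
    ultimately show ?R by (metis less_Suc_eq_le)
  next
    assume ?R
    then obtain l u where "2 ^ l \<le> Suc x" "Suc x < 2 ^ l + 2 ^ l" "y = x + 2 ^ l * u" by blast
    moreover from this have "l = length (dstr x)" using length_dstr_iff[of x l] by simp
    ultimately have "y = str_code (dstr x @ dstr u)" by (simp add: str_code_append)
    then show "prefix (dstr x) (dstr y)" by simp
  qed
  show ?thesis unfolding *
    by (intro dec_ex dec_conj dec_le dec_less dec_eq cf_Suc cf_add cf_mult cf_pow2 cf_vr cf_tl assms) simp_all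
qed

lemma dec_length:
  assumes "computable_fun D m f" "computable_fun D m g"
  shows "decidable D m (\<lambda>e. length (dstr (f e)) = g e)"
  unfolding length_dstr_iff
  by (intro dec_conj dec_le dec_less cf_Suc cf_pow2 assms)

definition bit_at :: "bool list \<Rightarrow> nat \<Rightarrow> bool \<Rightarrow> bool" where
  "bit_at s i b \<longleftrightarrow> i < length s \<and> s ! i = b"

lemma dec_bit_at:
  assumes "computable_fun D m f" "computable_fun D m g"
  shows "decidable D m (\<lambda>e. bit_at (dstr (f e)) (g e) b)"
proof -
  \<comment> \<open>The string is cut at position \<open>i\<close>: \<open>u\<close> codes the part
    before it, \<open>q\<close> the part after it, and the digit between them is \<open>2\<close> or
    \<open>1\<close>.\<close>
  have *: "bit_at (dstr x) i b \<longleftrightarrow>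
    (\<exists>u<Suc x. \<exists>q<Suc x. length (dstr u) = i \<and> x = u + 2 ^ i * ((if b then 2 else 1) + (q + q)))"
    (is "?L \<longleftrightarrow> ?R") for x i
  proof
    assume ?L
    then have L: "i < length (dstr x)" "dstr x ! i = b" by (auto simp: bit_at_def)
    with id_take_nth_drop[of i "dstr x"] have s: "dstr x = take i (dstr x) @ b # drop (Suc i) (dstr x)"
      by simp
    define u q where "u = str_code (take i (dstr x))" and "q = str_code (drop (Suc i) (dstr x))"
    have l: "length (dstr u) = i" unfolding u_def using L by simp
    have x: "x = u + 2 ^ i * ((if b then 2 else 1) + (q + q))"
      using arg_cong[OF s, of str_code] L unfolding u_def q_def
      by (simp add: str_code_append min_def algebra_simps split: if_splits)
    define X where "X = (if b then 2 else 1) + (q + q)"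
    have "1 * X \<le> 2 ^ i * X" by (rule mult_right_mono) simp_all
    moreover have "q \<le> X" unfolding X_def by simp
    ultimately have "u < Suc x" "q < Suc x" using x unfolding X_def[symmetric] by linarith+
    with l x show ?R by blast
  next
    assume ?R
    then obtain u q where uq: "length (dstr u) = i" "x = u + 2 ^ i * ((if b then 2 else 1) + (q + q))" by blast
    then have "x = str_code (dstr u @ b # dstr q)" by (simp add: str_code_append)
    then have "dstr x = dstr u @ b # dstr q" by simp
    then show ?L using uq(1) by (simp add: nth_append bit_at_def)
  qed
  show ?thesis unfolding *
    by (intro dec_ex dec_conj dec_length dec_eq cf_Suc cf_add cf_mult cf_pow2 cf_const cf_vr cf_tl assms) simp_all
qed

lemma eff_Pi01:
  assumes "Pi01_class D Q"
  shows "eff_closed D {c. (\<lambda>s. str_code s \<in> c) \<in> Q}"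
proof -
  from assms obtain R where R: "computable_strings D R" "Q = {C. \<forall>n. coloring_initial C n \<in> R}"
    unfolding Pi01_class_def by blast
  from R(1) obtain p where p: "\<And>n. orec_eval D p [n] (of_bool (n \<in> str_code ` R))"
    unfolding computable_strings_def computable_in_def by blast
  have "computable_fun D 1 (\<lambda>e. of_bool (arg 0 e \<in> str_code ` R))"
  proof (rule cfI)
    fix xs :: "nat list" assume "length xs = 1"
    then obtain x where "xs = [x]" by (cases xs) auto
    then show "orec_eval D p xs (of_bool (arg 0 xs \<in> str_code ` R))" using p[of x] by simp
  qed
  then have decR: "decidable D m (\<lambda>e. f e \<in> str_code ` R)" if "computable_fun D m f" for m f
    unfolding decidable_def by (rule cf_subst1[OF _ that])
  \<comment> \<open>\<open>W a b\<close> holds if the pair fixes every bit of some string outside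
    the tree \<open>R\<close>. Bounding \<open>i\<close> by the code \<open>t\<close> loses nothing,
    as a string is at most as long as its code.\<close>
  define W where "W a b \<longleftrightarrow> (\<exists>t. t \<notin> str_code ` R \<and> (\<forall>i<t.
      (bit_at (dstr t) i True \<longrightarrow> i \<in> set_decode a) \<and>
      (bit_at (dstr t) i False \<longrightarrow> i \<in> set_decode b)))" for a b
  have init: "coloring_initial (\<lambda>s. str_code s \<in> c) n = map (\<lambda>i. i \<in> c) [0..<n]" for c n
    unfolding coloring_initial_def dstr_def[symmetric] by simp
  show ?thesis
  proof (rule effI[where W = W])
    show "semidecidable D 2 (\<lambda>e. W (arg 0 e) (arg (Suc 0) e))"
      unfolding W_def
      by (intro ce_ex ce_dec dec_conj dec_not decR dec_all dec_imp dec_mem dec_bit_at cf_vr) (simp_all add: cf_vr)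
    have "(\<forall>n. map (\<lambda>i. i \<in> c) [0..<n] \<in> R) \<longleftrightarrow> \<not> obstructed W c" for c
    proof
      assume l: "\<forall>n. map (\<lambda>i. i \<in> c) [0..<n] \<in> R"
      show "\<not> obstructed W c"
      proof
        assume "obstructed W c"
        then obtain a b t where t: "t \<notin> str_code ` R" and
          ab: "\<forall>i<t. (bit_at (dstr t) i True \<longrightarrow> i \<in> set_decode a) \<and>
            (bit_at (dstr t) i False \<longrightarrow> i \<in> set_decode b)" and
          c: "set_decode a \<subseteq> c" "set_decode b \<inter> c = {}"
          unfolding obstructed_def W_def by blast
        have len: "length (dstr t) \<le> t" using length_le_str_code[of "dstr t"] by simp
        have "dstr t = map (\<lambda>i. i \<in> c) [0..<length (dstr t)]"
        proof (rule nth_equalityI)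
          fix i assume i: "i < length (dstr t)"
          with ab len have "dstr t ! i \<Longrightarrow> i \<in> set_decode a" "\<not> dstr t ! i \<Longrightarrow> i \<in> set_decode b"
            by (auto simp: bit_at_def)
          with c have "i \<in> c \<longleftrightarrow> dstr t ! i" by blast
          then show "dstr t ! i = map (\<lambda>i. i \<in> c) [0..<length (dstr t)] ! i" using i by simp
        qed simp
        with l have "dstr t \<in> R" by metis
        with t show False by (metis image_eqI str_code_dstr)
      qed
    next
      assume n: "\<not> obstructed W c"
      show "\<forall>n. map (\<lambda>i. i \<in> c) [0..<n] \<in> R"
      proof (rule allI, rule ccontr)
        fix n assume nR: "map (\<lambda>i. i \<in> c) [0..<n] \<notin> R"
        define a b where "a = set_encode (c \<inter> {..<n})" and "b = set_encode ({..<n} - c)"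
        have ab: "set_decode a = c \<inter> {..<n}" "set_decode b = {..<n} - c" unfolding a_def b_def by auto
        have "W a b" unfolding W_def ab
          by (rule exI[of _ "str_code (map (\<lambda>i. i \<in> c) [0..<n])"]) (use nR in \<open>auto simp: bit_at_def\<close>)
        then have "obstructed W c" by (rule obstI) (auto simp: ab)
        with n show False by contradiction
      qed
    qed
    then show "{c. (\<lambda>s. str_code s \<in> c) \<in> Q} = {c. \<not> obstructed W c}"
      unfolding R(2) by (simp add: init)
  qed
qed

section \<open>Addresses, finite trees and candidates\<close>

text \<open>States are nested tuples of colorings; the address of a coloring in a state is the list of the
  indices leading to it.\<close>

fun pos :: "nat list \<Rightarrow> nat \<Rightarrow> nat" where
  "pos [] x = x"
| "pos (i # j) x = prod_encode (i, pos j x)"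

lemma cf_pos: "computable_fun D m f \<Longrightarrow> computable_fun D m (\<lambda>e. pos j (f e))"
  by (induction j) (auto intro: cf_prod_encode cf_const)

lemma pos_Cons_mem: "pos (i # j) x \<in> c \<longleftrightarrow> pos j x \<in> row i c"
  unfolding row_def by simp

definition shaded :: "nat set \<Rightarrow> nat list set \<Rightarrow> bool \<Rightarrow> bool list \<Rightarrow> bool" where
  "shaded c B k x \<longleftrightarrow> (\<forall>j\<in>B. (pos j (str_code x) \<in> c) = k)"

text \<open>The finite approximations to perfect trees as suborders of the strings, not closed under
  initial segments: every element is a leaf or has exactly two immediate successors, and common
  lower bounds provide a root. The empty set is included as a starting point.\<close>

definition tree :: "bool list set \<Rightarrow> bool" where
  "tree F \<longleftrightarrow> (\<forall>x\<in>F. \<forall>y\<in>F. \<exists>r\<in>F. prefix r x \<and> prefix r y) \<and>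
     (\<forall>x\<in>F. (\<forall>y\<in>F. prefix x y \<longrightarrow> x = y) \<or>
       (\<exists>u\<in>F. \<exists>v\<in>F. \<not> prefix u v \<and> \<not> prefix v u \<and> prefix x u \<and> prefix x v \<and>
          (\<forall>y\<in>F. prefix x y \<longrightarrow> x = y \<or> prefix u y \<or> prefix v y)))"

definition above :: "bool list set \<Rightarrow> bool list \<Rightarrow> bool" where
  "above P x \<longleftrightarrow> (\<exists>p\<in>P. prefix p x)"

datatype cand = Cand (nodes: "bool list set") (tips: "bool list set") (shade: bool) (addrs: "nat list set")

definition valid :: "cand \<Rightarrow> nat set \<Rightarrow> bool list set \<Rightarrow> bool" where
  "valid \<alpha> c F \<longleftrightarrow> finite F \<and> tree F \<and> nodes \<alpha> \<subseteq> F \<and>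
     (\<forall>x\<in>F. x \<in> nodes \<alpha> \<or> above (tips \<alpha>) x) \<and> (\<forall>x\<in>F. shaded c (addrs \<alpha>) (shade \<alpha>) x)"

lemma dec_strs_eq: "computable_fun D m f \<Longrightarrow> computable_fun D m g \<Longrightarrow> decidable D m (\<lambda>e. dstr (f e) = dstr (g e))"
proof -
  assume *: "computable_fun D m f" "computable_fun D m g"
  have "dstr x = dstr y \<longleftrightarrow> x = y" for x y by (metis str_code_dstr)
  then show "decidable D m (\<lambda>e. dstr (f e) = dstr (g e))" using * by (simp add: dec_eq)
qed

lemma dec_tree:
  assumes "computable_fun D m f"
  shows "decidable D m (\<lambda>e. tree (strs (f e)))"
  unfolding tree_def
  by (intro dec_conj dec_disj dec_imp dec_not dec_strs_ball dec_strs_bex dec_prefix dec_strs_eq cf_vr cf_tl assms)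
    (simp_all add: cf_vr)

lemma dec_dstr_mem:
  assumes "finite G" "computable_fun D m f"
  shows "decidable D m (\<lambda>e. dstr (f e) \<in> G)"
proof -
  have *: "dstr x \<in> G \<longleftrightarrow> (\<exists>s\<in>G. x = str_code s)" for x
    by (metis dstr_str_code str_code_dstr)
  show ?thesis unfolding * by (intro dec_bex assms dec_eq cf_const)
qed

lemma dec_above:
  assumes "finite P" "computable_fun D m f"
  shows "decidable D m (\<lambda>e. above P (dstr (f e)))"
  unfolding above_def
proof (rule dec_bex[OF assms(1)])
  show "decidable D m (\<lambda>e. prefix p (dstr (f e)))" for p
    using dec_prefix[OF cf_const[of D m "str_code p"] assms(2)] by simp
qed

lemma dec_subset_strs:
  assumes "finite G" "computable_fun D m f"
  shows "decidable D m (\<lambda>e. G \<subseteq> strs (f e))"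
  unfolding strs_def subset_iff mem_Collect_eq Ball_def[symmetric]
  by (intro dec_ball assms dec_mem cf_const)

text \<open>The open sets of states for which a valid tree with property \<open>\<Phi>\<close>
  exists. Validity asks finitely many bits of the state to have the one value
  \<open>shade \<alpha>\<close>, so it constrains only \<open>a\<close> or only
  \<open>b\<close>.\<close>

definition avoid_obst :: "cand \<Rightarrow> (nat \<Rightarrow> nat list \<Rightarrow> bool) \<Rightarrow> nat \<Rightarrow> nat \<Rightarrow> nat list \<Rightarrow> bool" where
  "avoid_obst \<alpha> \<Phi> a b e \<longleftrightarrow> (\<exists>f. \<Phi> f e \<and> tree (strs f) \<and> nodes \<alpha> \<subseteq> strs f \<and>
     (\<forall>x\<in>strs f. (x \<in> nodes \<alpha> \<or> above (tips \<alpha>) x) \<and>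
       (\<forall>j\<in>addrs \<alpha>. pos j (str_code x) \<in> set_decode (if shade \<alpha> then a else b))))"

lemma ce_avoid_obst:
  assumes fin: "finite (nodes \<alpha>)" "finite (tips \<alpha>)" "finite (addrs \<alpha>)"
    and \<Phi>: "semidecidable D (Suc m) (\<lambda>e. \<Phi> (arg 0 e) (tl e))"
  shows "semidecidable D (Suc (Suc m)) (\<lambda>e. avoid_obst \<alpha> \<Phi> (arg 0 e) (arg (Suc 0) e) (tl (tl e)))"
  unfolding avoid_obst_def
proof (rule ce_ex, rule ce_conj)
  have "semidecidable D (Suc (Suc (Suc m))) (\<lambda>e. (\<lambda>e. \<Phi> (arg 0 e) (tl e)) (arg 0 e # tl (tl (tl e))))"
    by (rule ce_env[OF \<Phi>]) (auto simp: less_Suc_eq_0_disj intro: cf_vr)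
  then show "semidecidable D (Suc (Suc (Suc m))) (\<lambda>e. \<Phi> (arg 0 e) (tl (tl (tl e))))" by simp
  have if1: "computable_fun D n (\<lambda>e. if shade \<alpha> then f e else g e)" if "computable_fun D n f" "computable_fun D n g" for n f g
    using that by (cases "shade \<alpha>") auto
  show "semidecidable D (Suc (Suc (Suc m))) (\<lambda>e. tree (strs (arg 0 e)) \<and> nodes \<alpha> \<subseteq> strs (arg 0 e) \<and>
       (\<forall>x\<in>strs (arg 0 e). (x \<in> nodes \<alpha> \<or> above (tips \<alpha>) x) \<and>
         (\<forall>j\<in>addrs \<alpha>. pos j (str_code x)
            \<in> set_decode (if shade \<alpha> then arg 0 (tl e) else arg (Suc 0) (tl e)))))"
    by (intro ce_dec dec_conj dec_tree dec_subset_strs dec_strs_ball dec_disj dec_dstr_mem dec_above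
        dec_ball dec_mem cf_pos if1 fin cf_vr) (simp_all add: cf_vr)
qed

lemma avoid_obst_iff:
  assumes "finite (addrs \<alpha>)"
  shows "obstructed (\<lambda>a b. avoid_obst \<alpha> \<Phi> a b e) c \<longleftrightarrow> (\<exists>F. valid \<alpha> c F \<and> \<Phi> (finset_code F) e)"
proof
  assume "obstructed (\<lambda>a b. avoid_obst \<alpha> \<Phi> a b e) c"
  then obtain a b f where f: "\<Phi> f e" "tree (strs f)" "nodes \<alpha> \<subseteq> strs f"
    "\<And>x. x \<in> strs f \<Longrightarrow> x \<in> nodes \<alpha> \<or> above (tips \<alpha>) x"
    "\<And>x j. x \<in> strs f \<Longrightarrow> j \<in> addrs \<alpha> \<Longrightarrow> pos j (str_code x) \<in> set_decode (if shade \<alpha> then a else b)"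
    and c: "set_decode a \<subseteq> c" "set_decode b \<inter> c = {}"
    unfolding obstructed_def avoid_obst_def by blast
  have "shaded c (addrs \<alpha>) (shade \<alpha>) x" if "x \<in> strs f" for x
    unfolding shaded_def using f(5)[OF that] c by (cases "shade \<alpha>") auto
  with f have "valid \<alpha> c (strs f)" unfolding valid_def by simp
  with f(1) show "\<exists>F. valid \<alpha> c F \<and> \<Phi> (finset_code F) e"
    by (intro exI[of _ "strs f"]) simp
next
  assume "\<exists>F. valid \<alpha> c F \<and> \<Phi> (finset_code F) e"
  then obtain F where F: "valid \<alpha> c F" "\<Phi> (finset_code F) e" by blast
  then have finF: "finite F" unfolding valid_def by blast
  define Z where "Z = (\<Union>x\<in>F. (\<lambda>j. pos j (str_code x)) ` addrs \<alpha>)"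
  have "finite Z" unfolding Z_def using finF assms by blast
  show "obstructed (\<lambda>a b. avoid_obst \<alpha> \<Phi> a b e) c"
  proof (rule obstI)
    show "avoid_obst \<alpha> \<Phi> (set_encode (if shade \<alpha> then Z else {})) (set_encode (if shade \<alpha> then {} else Z)) e"
      unfolding avoid_obst_def using F finF \<open>finite Z\<close>
      by (intro exI[of _ "finset_code F"]) (auto simp: valid_def Z_def)
    have "pos j (str_code x) \<in> c \<longleftrightarrow> shade \<alpha>" if "x \<in> F" "j \<in> addrs \<alpha>" for x j
      using F that unfolding valid_def shaded_def by blast
    then have "Z \<subseteq> (if shade \<alpha> then c else - c)" unfolding Z_def by auto
    then show "set_decode (set_encode (if shade \<alpha> then Z else {})) \<subseteq> c"
      "set_decode (set_encode (if shade \<alpha> then {} else Z)) \<inter> c = {}"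
      using \<open>finite Z\<close> by (auto split: if_splits)
  qed
qed

text \<open>A valid tree uses finitely many bits of the state, so having one with an enumerable
  property is an effectively open condition on states.\<close>

lemma eff_avoid:
  assumes fin: "finite (nodes \<alpha>)" "finite (tips \<alpha>)" "finite (addrs \<alpha>)"
    and \<Phi>: "semidecidable D (Suc 0) (\<lambda>e. \<Phi> (arg 0 e))"
  shows "eff_closed D {c. \<forall>F. valid \<alpha> c F \<longrightarrow> \<not> \<Phi> (finset_code F)}"
proof (rule effI)
  show "semidecidable D 2 (\<lambda>e. avoid_obst \<alpha> (\<lambda>f _. \<Phi> f) (arg 0 e) (arg (Suc 0) e) [])"
    using ce_avoid_obst[OF fin, where m = 0 and \<Phi> = "\<lambda>f _. \<Phi> f"] \<Phi>
    by (simp add: avoid_obst_def numeral_2_eq_2)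
  show "{c. \<forall>F. valid \<alpha> c F \<longrightarrow> \<not> \<Phi> (finset_code F)} =
    {c. \<not> obstructed (\<lambda>a b. avoid_obst \<alpha> (\<lambda>f _. \<Phi> f) a b []) c}"
    unfolding avoid_obst_iff[OF fin(3)] by blast
qed

text \<open>The relation expresses that the states in \<open>Q\<close> for which all candidates of
  \<open>A\<close> avoid \<open>\<Phi>\<close> form an empty class, so compactness makes it
  semidecidable.\<close>

lemma ce_avoid_empty:
  assumes Q: "eff_closed D Q" and A: "finite A"
    and fin: "\<And>\<alpha>. \<alpha> \<in> A \<Longrightarrow> finite (nodes \<alpha>) \<and> finite (tips \<alpha>) \<and> finite (addrs \<alpha>)"
    and \<Phi>: "semidecidable D (Suc m) (\<lambda>e. \<Phi> (arg 0 e) (tl e))"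
  shows "semidecidable D m (\<lambda>e. \<forall>c\<in>Q. \<exists>\<alpha>\<in>A. \<exists>F. valid \<alpha> c F \<and> \<Phi> (finset_code F) e)"
proof -
  from Q obtain W where W: "semidecidable D 2 (\<lambda>e. W (arg 0 e) (arg (Suc 0) e))" "Q = {c. \<not> obstructed W c}"
    unfolding eff_closed_def by blast
  have "semidecidable D m (\<lambda>e. \<forall>c. obstructed (\<lambda>a b. W a b \<or> (\<exists>\<alpha>\<in>A. avoid_obst \<alpha> \<Phi> a b e)) c)"
    by (intro ce_obst_all ce_disj ce_bex A ce_avoid_obst ce_subst2[OF W(1)] \<Phi> cf_vr) (use fin in auto)
  moreover have "obstructed (\<lambda>a b. W a b \<or> (\<exists>\<alpha>\<in>A. avoid_obst \<alpha> \<Phi> a b e)) c \<longleftrightarrow>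
    c \<notin> Q \<or> (\<exists>\<alpha>\<in>A. \<exists>F. valid \<alpha> c F \<and> \<Phi> (finset_code F) e)" for c e
  proof -
    have "obstructed (\<lambda>a b. W a b \<or> (\<exists>\<alpha>\<in>A. avoid_obst \<alpha> \<Phi> a b e)) c \<longleftrightarrow>
      obstructed W c \<or> (\<exists>\<alpha>\<in>A. obstructed (\<lambda>a b. avoid_obst \<alpha> \<Phi> a b e) c)"
      unfolding obstructed_def by blast
    also have "\<dots> \<longleftrightarrow> c \<notin> Q \<or> (\<exists>\<alpha>\<in>A. \<exists>F. valid \<alpha> c F \<and> \<Phi> (finset_code F) e)"
      using avoid_obst_iff[of _ \<Phi> e c] fin W(2) by auto
    finally show ?thesis .
  qed
  ultimately show ?thesis by (elim ce_cong) blast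
qed

subsection \<open>Deciding candidates\<close>

definition leaf :: "bool list set \<Rightarrow> bool list \<Rightarrow> bool" where
  "leaf F x \<longleftrightarrow> x \<in> F \<and> (\<forall>y\<in>F. prefix x y \<longrightarrow> x = y)"

text \<open>Each leaf keeps a tip above it, so the tree can grow at every leaf. Conversely each tip
  lies above a leaf, so new nodes leave the splitting at inner nodes as it is. For the empty tree
  the tips are free.\<close>

definition proper :: "cand \<Rightarrow> bool" where
  "proper \<alpha> \<longleftrightarrow> finite (nodes \<alpha>) \<and> finite (tips \<alpha>) \<and> finite (addrs \<alpha>) \<and> addrs \<alpha> \<noteq> {} \<and> tips \<alpha> \<noteq> {} \<and>
     tree (nodes \<alpha>) \<and> (\<forall>x. leaf (nodes \<alpha>) x \<longrightarrow> (\<exists>p\<in>tips \<alpha>. prefix x p)) \<and>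
     (\<forall>p\<in>tips \<alpha>. nodes \<alpha> = {} \<or> (\<exists>x. leaf (nodes \<alpha>) x \<and> prefix x p))"

definition hom :: "nat set \<Rightarrow> cand \<Rightarrow> bool" where
  "hom c \<alpha> \<longleftrightarrow> (\<forall>x\<in>nodes \<alpha>. shaded c (addrs \<alpha>) (shade \<alpha>) x)"

definition extends :: "cand \<Rightarrow> cand \<Rightarrow> bool" where
  "extends \<alpha> \<beta> \<longleftrightarrow> shade \<beta> = shade \<alpha> \<and> addrs \<beta> = addrs \<alpha> \<and> nodes \<alpha> \<subseteq> nodes \<beta> \<and>
     (\<forall>x\<in>nodes \<beta>. x \<in> nodes \<alpha> \<or> above (tips \<alpha>) x) \<and> (\<forall>p\<in>tips \<beta>. above (tips \<alpha>) p)"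

text \<open>A weaker matching property for the time when only some candidates have been refined:
  guesses are made at finitely many positions \<open>L\<close>, and a tip is matched if some
  position above it is. Thus \<open>L\<close> can be enlarged while the other candidates keep their
  tips.\<close>

definition cover :: "bool list set \<Rightarrow> cand set \<Rightarrow> bool" where
  "cover L A \<longleftrightarrow> (\<forall>y :: bool list \<Rightarrow> nat list \<Rightarrow> bool. \<exists>\<alpha>\<in>A. \<forall>p\<in>tips \<alpha>. \<exists>l\<in>L.
     prefix p l \<and> (\<forall>j\<in>addrs \<alpha>. y l j = shade \<alpha>))"

text \<open>Here \<open>y p j\<close> is a guess of the color at address \<open>j\<close> of the future nodes above the tip \<open>p\<close>.\<close>

definition dcover :: "cand set \<Rightarrow> bool" where
  "dcover A \<longleftrightarrow> (\<forall>y :: bool list \<Rightarrow> nat list \<Rightarrow> bool. \<exists>\<alpha>\<in>A. \<forall>p\<in>tips \<alpha>. \<forall>j\<in>addrs \<alpha>. y p j = shade \<alpha>)"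

text \<open>In the first alternative \<open>bnd\<close> stands for the use of the computation that
  makes the tree good: all later nodes are at least that long and cannot disturb it. The second
  alternative concerns the one state \<open>c\<close> only and is extended to a class later.\<close>

definition decided :: "nat set \<Rightarrow> (bool list set \<Rightarrow> bool list set \<Rightarrow> bool) \<Rightarrow> (bool list set \<Rightarrow> nat) \<Rightarrow>
    cand \<Rightarrow> cand \<Rightarrow> bool" where
  "decided c good bnd \<alpha> \<beta> \<longleftrightarrow> (good (nodes \<alpha>) (nodes \<beta>) \<and> (\<forall>p\<in>tips \<beta>. bnd (nodes \<beta>) \<le> length p)) \<or>
     (nodes \<beta> = nodes \<alpha> \<and> (\<forall>F. valid \<beta> c F \<longrightarrow> \<not> good (nodes \<alpha>) F))"

lemma above_trans: "above P x \<Longrightarrow> (\<forall>p\<in>P. above P' p) \<Longrightarrow> above P' x"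
  unfolding above_def by (meson prefix_order.trans)

lemma above_prefix: "above P x \<Longrightarrow> prefix x y \<Longrightarrow> above P y"
  unfolding above_def by (meson prefix_order.trans)

lemma extends_valid: "extends \<alpha> \<beta> \<Longrightarrow> valid \<beta> c F \<Longrightarrow> valid \<alpha> c F"
  unfolding extends_def valid_def using above_trans[of "tips \<beta>" _ "tips \<alpha>"] by auto

lemma extends_trans: "extends \<alpha> \<beta> \<Longrightarrow> extends \<beta> \<gamma> \<Longrightarrow> extends \<alpha> \<gamma>"
  unfolding extends_def using above_trans[of "tips \<beta>" _ "tips \<alpha>"] by auto

lemma ex_leaf_above:
  assumes "finite F" "x \<in> F"
  shows "\<exists>l. leaf F l \<and> prefix x l"
proof -
  define X where "X = {y \<in> F. prefix x y}"
  have X: "finite X" "X \<noteq> {}" unfolding X_def using assms by auto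
  then have "Max (length ` X) \<in> length ` X" by (intro Max_in) auto
  then obtain l where l: "l \<in> X" "length l = Max (length ` X)" by auto
  have "l = y" if "y \<in> F" "prefix l y" for y
  proof -
    have "y \<in> X" using that l(1) unfolding X_def by (auto intro: prefix_order.trans)
    then have "length y \<le> length l" using l(2) X(1) by simp
    with that(2) show ?thesis by (auto simp: prefix_def)
  qed
  then show ?thesis using l(1) unfolding leaf_def X_def by blast
qed

lemma decide_one:
  assumes \<alpha>: "proper \<alpha>" "hom c \<alpha>" and f: "\<And>p. p \<in> tips \<alpha> \<Longrightarrow> prefix p (f p)"
  shows "\<exists>\<beta>. proper \<beta> \<and> hom c \<beta> \<and> extends \<alpha> \<beta> \<and> decided c good bnd \<alpha> \<beta> \<and> (\<forall>q\<in>tips \<beta>. above (f ` tips \<alpha>) q)"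
proof -
  define \<alpha>' where "\<alpha>' = Cand (nodes \<alpha>) (f ` tips \<alpha>) (shade \<alpha>) (addrs \<alpha>)"
  have fa: "above (tips \<alpha>) (f p)" if "p \<in> tips \<alpha>" for p
    using f[OF that] that unfolding above_def by blast
  have ext: "extends \<alpha> \<alpha>'" unfolding extends_def \<alpha>'_def using fa by auto
  show ?thesis
  proof (cases "\<exists>F. valid \<alpha>' c F \<and> good (nodes \<alpha>) F")
    case False
    have "proper \<alpha>'" using \<alpha>(1) f unfolding proper_def \<alpha>'_def
      by (auto intro: prefix_order.trans) (meson prefix_order.trans)+
    moreover have "hom c \<alpha>'" using \<alpha>(2) unfolding hom_def \<alpha>'_def by simp
    moreover have "decided c good bnd \<alpha> \<alpha>'" using False unfolding decided_def \<alpha>'_def by simp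
    moreover have "\<forall>q\<in>tips \<alpha>'. above (f ` tips \<alpha>) q" unfolding \<alpha>'_def above_def by auto
    ultimately show ?thesis using ext by blast
  next
    case True
    then obtain F where F: "valid \<alpha>' c F" "good (nodes \<alpha>) F" by blast
    then have F': "finite F" "tree F" "nodes \<alpha> \<subseteq> F" "\<And>x. x \<in> F \<Longrightarrow> x \<in> nodes \<alpha> \<or> above (f ` tips \<alpha>) x"
      "\<And>x. x \<in> F \<Longrightarrow> shaded c (addrs \<alpha>) (shade \<alpha>) x" unfolding valid_def \<alpha>'_def by auto
    \<comment> \<open>A new leaf is its own tip, and a leaf taken over from
      \<open>nodes \<alpha>\<close> keeps a lifted tip above it. Lifted tips above no leaf of
      \<open>F\<close> are dropped, as \<open>proper\<close> demands, except when \<open>F\<close>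
      is empty.\<close>
    define Q where "Q = {l. leaf F l \<and> l \<notin> nodes \<alpha>} \<union> {q \<in> f ` tips \<alpha>. F = {} \<or> (\<exists>l. leaf F l \<and> prefix l q)}"
    \<comment> \<open>The padding makes every tip at least as long as \<open>bnd F\<close>; the bits
      themselves are arbitrary.\<close>
    define P where "P = (\<lambda>q. q @ replicate (bnd F) False) ` Q"
    define \<beta> where "\<beta> = Cand F P (shade \<alpha>) (addrs \<alpha>)"
    have Qf: "above (f ` tips \<alpha>) q" if "q \<in> Q" for q
      using that F'(4) unfolding Q_def by (auto simp: leaf_def above_def)
    have Pf: "above (f ` tips \<alpha>) q" if "q \<in> P" for q
      using that Qf unfolding P_def by (auto intro: above_prefix[OF Qf])
    have Qleaf: "\<exists>q\<in>Q. prefix l q" if l: "leaf F l" for l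
    proof (cases "l \<in> nodes \<alpha>")
      case True
      with l F'(3) have "leaf (nodes \<alpha>) l" unfolding leaf_def by blast
      then obtain p where "p \<in> tips \<alpha>" "prefix l p" using \<alpha>(1) unfolding proper_def by blast
      with f l show ?thesis unfolding Q_def by (auto intro!: bexI[of _ "f p"] intro: prefix_order.trans)
    next
      case False
      with l show ?thesis unfolding Q_def by blast
    qed
    have "finite Q" unfolding Q_def using F'(1) \<alpha>(1) by (auto simp: leaf_def proper_def)
    then have finP: "finite P" unfolding P_def by simp
    have "Q \<noteq> {}"
    proof (cases "F = {}")
      case True
      then show ?thesis unfolding Q_def using \<alpha>(1) by (auto simp: proper_def)
    next
      case False
      then show ?thesis using ex_leaf_above[OF F'(1)] Qleaf by blast
    qed
    then have "P \<noteq> {}" unfolding P_def by simp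
    moreover have "\<exists>p\<in>P. prefix l p" if "leaf F l" for l
      using Qleaf[OF that] unfolding P_def by (auto intro: prefix_prefix)
    moreover have "F = {} \<or> (\<exists>x. leaf F x \<and> prefix x p)" if "p \<in> P" for p
      using that unfolding P_def Q_def by (auto intro: prefix_order.trans)
    ultimately have "proper \<beta>" using \<alpha>(1) F'(1,2) finP unfolding proper_def \<beta>_def by simp
    moreover have "hom c \<beta>" using F'(5) unfolding hom_def \<beta>_def by simp
    moreover have "extends \<alpha> \<beta>"
    proof -
      have "above (tips \<alpha>) x" if "above (f ` tips \<alpha>) x" for x
        using above_trans[OF that, of "tips \<alpha>"] fa by simp
      with F'(3,4) Pf show ?thesis unfolding extends_def \<beta>_def by auto
    qed
    moreover have "decided c good bnd \<alpha> \<beta>"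
      unfolding decided_def \<beta>_def P_def using F(2) by auto
    moreover have "\<forall>q\<in>tips \<beta>. above (f ` tips \<alpha>) q" using Pf unfolding \<beta>_def by simp
    ultimately show ?thesis by blast
  qed
qed

text \<open>There is one new candidate for each choice \<open>f\<close> of a position of
  \<open>L\<close> above every tip of \<open>\<alpha>\<close>, and \<open>L'\<close> adds the tips
  of these candidates. Given a guess on \<open>L'\<close>, call a position forced if everything in
  \<open>L'\<close> above it has the right color. If every tip of \<open>\<alpha>\<close> has a
  forced position, the new candidate for these positions is matched, because its tips lie above
  them. Otherwise \<open>\<alpha>\<close> can be defeated at one tip, and the old matching property
  yields another candidate.\<close>

lemma decide_step:
  assumes \<alpha>: "proper \<alpha>" "hom c \<alpha>" and L: "finite L" and cov: "cover L (insert \<alpha> A)"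
  shows "\<exists>L' N. finite L' \<and> finite N \<and> cover L' (N \<union> A) \<and>
    (\<forall>\<beta>\<in>N. proper \<beta> \<and> hom c \<beta> \<and> extends \<alpha> \<beta> \<and> decided c good bnd \<alpha> \<beta>)"
proof -
  define I where "I = PiE (tips \<alpha>) (\<lambda>p. {l \<in> L. prefix p l})"
  have "finite I" unfolding I_def using \<alpha>(1) L by (intro finite_PiE) (auto simp: proper_def)
  have "\<forall>f\<in>I. \<exists>\<beta>. proper \<beta> \<and> hom c \<beta> \<and> extends \<alpha> \<beta> \<and> decided c good bnd \<alpha> \<beta> \<and>
      (\<forall>q\<in>tips \<beta>. above (f ` tips \<alpha>) q)"
    by (intro ballI decide_one \<alpha>) (auto simp: I_def)
  then obtain \<beta> where \<beta>: "\<And>f. f \<in> I \<Longrightarrow> proper (\<beta> f) \<and> hom c (\<beta> f) \<and> extends \<alpha> (\<beta> f) \<and>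
      decided c good bnd \<alpha> (\<beta> f) \<and> (\<forall>q\<in>tips (\<beta> f). above (f ` tips \<alpha>) q)"
    by metis
  define L' where "L' = L \<union> (\<Union>f\<in>I. tips (\<beta> f))"
  have "finite L'" unfolding L'_def using L \<open>finite I\<close> \<beta> by (auto simp: proper_def)
  moreover have "cover L' (\<beta> ` I \<union> A)"
    unfolding cover_def
  proof
    fix y :: "bool list \<Rightarrow> nat list \<Rightarrow> bool"
    define ok where "ok l \<longleftrightarrow> (\<forall>j\<in>addrs \<alpha>. y l j = shade \<alpha>)" for l
    define forced where "forced q \<longleftrightarrow> (\<forall>l\<in>L'. prefix q l \<longrightarrow> ok l)" for q
    show "\<exists>\<gamma>\<in>\<beta> ` I \<union> A. \<forall>p\<in>tips \<gamma>. \<exists>l\<in>L'. prefix p l \<and> (\<forall>j\<in>addrs \<gamma>. y l j = shade \<gamma>)"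
    proof (cases "\<forall>p\<in>tips \<alpha>. \<exists>q\<in>L. prefix p q \<and> forced q")
      case True
      then obtain g where g: "\<And>p. p \<in> tips \<alpha> \<Longrightarrow> g p \<in> L \<and> prefix p (g p) \<and> forced (g p)" by metis
      define f where "f = restrict g (tips \<alpha>)"
      have fI: "f \<in> I" unfolding I_def f_def using g by auto
      have "\<exists>l\<in>L'. prefix p l \<and> (\<forall>j\<in>addrs (\<beta> f). y l j = shade (\<beta> f))" if p: "p \<in> tips (\<beta> f)" for p
      proof (intro bexI[of _ p] conjI)
        show pL: "p \<in> L'" unfolding L'_def using fI p by blast
        from \<beta>[OF fI] p obtain t where "t \<in> tips \<alpha>" "prefix (f t) p" unfolding above_def by blast
        with g[of t] pL have "ok p" unfolding f_def forced_def by simp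
        then show "\<forall>j\<in>addrs (\<beta> f). y p j = shade (\<beta> f)"
          using \<beta>[OF fI] unfolding ok_def extends_def by simp
      qed simp
      then show ?thesis using fI by blast
    next
      case False
      then obtain p where p: "p \<in> tips \<alpha>" "\<And>q. q \<in> L \<Longrightarrow> prefix p q \<Longrightarrow> \<not> forced q" by blast
      have "\<forall>q\<in>L. \<exists>l\<in>L'. prefix q l \<and> (\<not> forced q \<longrightarrow> \<not> ok l)"
        unfolding forced_def L'_def by blast
      then obtain h where h: "\<And>q. q \<in> L \<Longrightarrow> h q \<in> L' \<and> prefix q (h q) \<and> (\<not> forced q \<longrightarrow> \<not> ok (h q))"
        by metis
      \<comment> \<open>Each position \<open>q\<close> borrows its guess from \<open>h q\<close>
        above it, which has a wrong color for \<open>\<alpha>\<close> whenever possible. A match at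
        \<open>l\<close> for this guess is a match at \<open>h l\<close> for the guess
        \<open>y\<close>.\<close>
      from cov[unfolded cover_def, rule_format, of "\<lambda>q. y (h q)"]
      obtain \<gamma> where \<gamma>: "\<gamma> \<in> insert \<alpha> A"
        "\<And>p. p \<in> tips \<gamma> \<Longrightarrow> \<exists>l\<in>L. prefix p l \<and> (\<forall>j\<in>addrs \<gamma>. y (h l) j = shade \<gamma>)"
        by blast
      have "\<gamma> \<noteq> \<alpha>"
      proof
        assume "\<gamma> = \<alpha>"
        with \<gamma>(2)[of p] p(1) obtain l where "l \<in> L" "prefix p l" "ok (h l)" unfolding ok_def by blast
        with p(2) h show False by blast
      qed
      with \<gamma>(1) have "\<gamma> \<in> A" by blast
      moreover have "\<exists>l\<in>L'. prefix p l \<and> (\<forall>j\<in>addrs \<gamma>. y l j = shade \<gamma>)" if "p \<in> tips \<gamma>" for p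
        using \<gamma>(2)[OF that] h by (meson prefix_order.trans)
      ultimately show ?thesis by blast
    qed
  qed
  ultimately show ?thesis using \<open>finite I\<close> \<beta> by (intro exI[of _ L'] exI[of _ "\<beta> ` I"]) blast
qed

text \<open>\<open>M\<close> collects the candidates already refined; the later rounds only carry
  them along while the positions \<open>L\<close> are enlarged.\<close>

lemma decide_finite:
  assumes "finite A" "finite L" "cover L (M \<union> A)" "\<forall>\<alpha>\<in>A. proper \<alpha> \<and> hom c \<alpha>"
  shows "\<exists>L' N. finite L' \<and> finite N \<and> cover L' (M \<union> N) \<and>
    (\<forall>\<beta>\<in>N. proper \<beta> \<and> hom c \<beta> \<and> (\<exists>\<alpha>\<in>A. extends \<alpha> \<beta> \<and> decided c good bnd \<alpha> \<beta>))"
  using assms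
proof (induction A arbitrary: L M rule: finite_induct)
  case empty
  then show ?case by (intro exI[of _ L] exI[of _ "{}"]) auto
next
  case (insert \<alpha> A)
  have "cover L (insert \<alpha> (M \<union> A))" using insert.prems(2) by simp
  from insert.prems(3) have \<alpha>: "proper \<alpha>" "hom c \<alpha>" and A: "\<forall>\<alpha>\<in>A. proper \<alpha> \<and> hom c \<alpha>" by simp_all
  from decide_step[OF \<alpha> insert.prems(1) \<open>cover L (insert \<alpha> (M \<union> A))\<close>, of good bnd]
  obtain L' N where "finite L' \<and> finite N \<and> cover L' (N \<union> (M \<union> A)) \<and>
    (\<forall>\<beta>\<in>N. proper \<beta> \<and> hom c \<beta> \<and> extends \<alpha> \<beta> \<and> decided c good bnd \<alpha> \<beta>)"
    by (elim exE)
  then have 1: "finite L'" "finite N" "cover L' (N \<union> (M \<union> A))"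
    "\<forall>\<beta>\<in>N. proper \<beta> \<and> hom c \<beta> \<and> extends \<alpha> \<beta> \<and> decided c good bnd \<alpha> \<beta>" by simp_all
  have "cover L' ((N \<union> M) \<union> A)" using 1(3) by (simp add: Un_assoc)
  from insert.IH[OF 1(1) this A]
  obtain L'' N' where "finite L'' \<and> finite N' \<and> cover L'' ((N \<union> M) \<union> N') \<and>
    (\<forall>\<beta>\<in>N'. proper \<beta> \<and> hom c \<beta> \<and> (\<exists>\<alpha>\<in>A. extends \<alpha> \<beta> \<and> decided c good bnd \<alpha> \<beta>))"
    by (elim exE)
  then have 2: "finite L''" "finite N'" "cover L'' ((N \<union> M) \<union> N')"
    "\<forall>\<beta>\<in>N'. proper \<beta> \<and> hom c \<beta> \<and> (\<exists>\<alpha>\<in>A. extends \<alpha> \<beta> \<and> decided c good bnd \<alpha> \<beta>)" by simp_all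
  have "cover L'' (M \<union> (N \<union> N'))" using 2(3) by (simp add: Un_ac)
  then show ?case using 1(2,4) 2 by (intro exI[of _ L''] exI[of _ "N \<union> N'"]) blast
qed

text \<open>Every candidate is split into one copy for each choice of positions above its tips, and
  the chosen positions become the tips. A position that witnesses a match is then itself a tip of
  one of the copies.\<close>

lemma cover_dcover:
  assumes "finite L" "finite A" "cover L A" "\<And>\<alpha>. \<alpha> \<in> A \<Longrightarrow> proper \<alpha>"
  shows "\<exists>A'. finite A' \<and> dcover A' \<and> (\<forall>\<beta>\<in>A'. proper \<beta> \<and> (\<exists>\<alpha>\<in>A. extends \<alpha> \<beta> \<and> nodes \<beta> = nodes \<alpha>))"
proof -
  define mk where "mk \<alpha> f = Cand (nodes \<alpha>) (f ` tips \<alpha>) (shade \<alpha>) (addrs \<alpha>)" for \<alpha> f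
  define I where "I \<alpha> = PiE (tips \<alpha>) (\<lambda>p. {l \<in> L. prefix p l})" for \<alpha>
  have "finite (I \<alpha>)" if "\<alpha> \<in> A" for \<alpha>
    unfolding I_def using assms(1) assms(4)[OF that] by (intro finite_PiE) (auto simp: proper_def)
  then have "finite (\<Union>\<alpha>\<in>A. mk \<alpha> ` I \<alpha>)" using assms(2) by blast
  moreover have "dcover (\<Union>\<alpha>\<in>A. mk \<alpha> ` I \<alpha>)"
    unfolding dcover_def
  proof
    fix y :: "bool list \<Rightarrow> nat list \<Rightarrow> bool"
    from assms(3)[unfolded cover_def, rule_format, of y]
    obtain \<alpha> where \<alpha>: "\<alpha> \<in> A" "\<forall>p\<in>tips \<alpha>. \<exists>l\<in>L. prefix p l \<and> (\<forall>j\<in>addrs \<alpha>. y l j = shade \<alpha>)" by blast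
    then obtain g where g: "\<And>p. p \<in> tips \<alpha> \<Longrightarrow> g p \<in> L \<and> prefix p (g p) \<and> (\<forall>j\<in>addrs \<alpha>. y (g p) j = shade \<alpha>)"
      by metis
    have "restrict g (tips \<alpha>) \<in> I \<alpha>" unfolding I_def using g by auto
    moreover have "\<forall>p\<in>tips (mk \<alpha> (restrict g (tips \<alpha>))). \<forall>j\<in>addrs (mk \<alpha> (restrict g (tips \<alpha>))).
        y p j = shade (mk \<alpha> (restrict g (tips \<alpha>)))"
      unfolding mk_def using g by auto
    ultimately show "\<exists>\<beta>\<in>\<Union>\<alpha>\<in>A. mk \<alpha> ` I \<alpha>. \<forall>p\<in>tips \<beta>. \<forall>j\<in>addrs \<beta>. y p j = shade \<beta>" using \<alpha>(1) by blast
  qed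
  moreover have "proper (mk \<alpha> f) \<and> extends \<alpha> (mk \<alpha> f) \<and> nodes (mk \<alpha> f) = nodes \<alpha>" if "\<alpha> \<in> A" "f \<in> I \<alpha>" for \<alpha> f
  proof -
    have f: "prefix p (f p)" if "p \<in> tips \<alpha>" for p using \<open>f \<in> I \<alpha>\<close> that unfolding I_def by auto
    have "proper (mk \<alpha> f)" using assms(4)[OF \<open>\<alpha> \<in> A\<close>] f unfolding proper_def mk_def
      by (auto intro: prefix_order.trans) (meson prefix_order.trans)+
    moreover have "extends \<alpha> (mk \<alpha> f)" unfolding extends_def mk_def above_def using f by auto
    ultimately show ?thesis unfolding mk_def by simp
  qed
  ultimately show ?thesis by (intro exI[of _ "\<Union>\<alpha>\<in>A. mk \<alpha> ` I \<alpha>"]) blast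
qed

lemma decide:
  assumes "finite A" "dcover A" "\<forall>\<alpha>\<in>A. proper \<alpha> \<and> hom c \<alpha>"
  shows "\<exists>A'. finite A' \<and> dcover A' \<and> (\<forall>\<beta>\<in>A'. proper \<beta> \<and> hom c \<beta> \<and>
    (\<exists>\<alpha>\<in>A. extends \<alpha> \<beta> \<and> decided c good bnd \<alpha> \<beta>))"
proof -
  have cov: "cover (\<Union>\<alpha>\<in>A. tips \<alpha>) ({} \<union> A)"
    using assms(2) unfolding cover_def dcover_def by (metis UN_I Un_empty_left prefix_order.refl)
  have fin: "finite (\<Union>\<alpha>\<in>A. tips \<alpha>)" using assms(1,3) by (auto simp: proper_def)
  from decide_finite[OF assms(1) fin cov assms(3), of good bnd]
  obtain L N where "finite L \<and> finite N \<and> cover L ({} \<union> N) \<and>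
    (\<forall>\<beta>\<in>N. proper \<beta> \<and> hom c \<beta> \<and> (\<exists>\<alpha>\<in>A. extends \<alpha> \<beta> \<and> decided c good bnd \<alpha> \<beta>))"
    by (elim exE)
  then have N: "finite L" "finite N" "cover L N"
    "\<And>\<beta>. \<beta> \<in> N \<Longrightarrow> proper \<beta> \<and> hom c \<beta> \<and> (\<exists>\<alpha>\<in>A. extends \<alpha> \<beta> \<and> decided c good bnd \<alpha> \<beta>)"
    by simp_all
  from cover_dcover[OF N(1-3)] N(4) obtain A' where A': "finite A'" "dcover A'"
    "\<And>\<gamma>. \<gamma> \<in> A' \<Longrightarrow> proper \<gamma> \<and> (\<exists>\<beta>\<in>N. extends \<beta> \<gamma> \<and> nodes \<gamma> = nodes \<beta>)" by blast
  have "proper \<gamma> \<and> hom c \<gamma> \<and> (\<exists>\<alpha>\<in>A. extends \<alpha> \<gamma> \<and> decided c good bnd \<alpha> \<gamma>)" if \<gamma>: "\<gamma> \<in> A'" for \<gamma>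
  proof -
    from A'(3)[OF \<gamma>] obtain \<beta> where \<beta>: "\<beta> \<in> N" "extends \<beta> \<gamma>" "nodes \<gamma> = nodes \<beta>" "proper \<gamma>" by blast
    from N(4)[OF \<beta>(1)] obtain \<alpha> where \<alpha>: "\<alpha> \<in> A" "extends \<alpha> \<beta>" "decided c good bnd \<alpha> \<beta>" "hom c \<beta>" by blast
    have "hom c \<gamma>" using \<alpha>(4) \<beta>(2,3) unfolding hom_def extends_def by simp
    moreover have "bnd (nodes \<beta>) \<le> length p" if "\<forall>p\<in>tips \<beta>. bnd (nodes \<beta>) \<le> length p" "p \<in> tips \<gamma>" for p
    proof -
      from \<beta>(2) that(2) obtain q where "q \<in> tips \<beta>" "prefix q p" unfolding extends_def above_def by blast
      with that(1) show ?thesis by (meson order.trans prefix_length_le)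
    qed
    then have "decided c good bnd \<alpha> \<gamma>"
      using \<alpha>(3) \<beta>(3) extends_valid[OF \<beta>(2)] unfolding decided_def by auto
    ultimately show ?thesis using \<beta>(4) \<alpha>(1) extends_trans[OF \<alpha>(2) \<beta>(2)] by blast
  qed
  with A'(1,2) show ?thesis by blast
qed

subsection \<open>Conditions and their extensions\<close>

definition condition :: "nat set \<Rightarrow> nat set set \<Rightarrow> cand set \<Rightarrow> bool" where
  "condition D Q A \<longleftrightarrow> eff_closed D Q \<and> Q \<noteq> {} \<and> finite A \<and> dcover A \<and> (\<forall>\<alpha>\<in>A. proper \<alpha> \<and> (\<forall>c\<in>Q. hom c \<alpha>))"

definition pot :: "nat set set \<Rightarrow> cand \<Rightarrow> bool list set set" where
  "pot Q \<alpha> = {F. \<exists>c\<in>Q. valid \<alpha> c F}"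

lemma eff_hom:
  assumes "proper \<alpha>"
  shows "eff_closed D {c. hom c \<alpha>}"
proof -
  have "{c. hom c \<alpha>} = (\<Inter>x\<in>nodes \<alpha>. \<Inter>j\<in>addrs \<alpha>. {c. (pos j (str_code x) \<in> c) = shade \<alpha>})"
    unfolding hom_def shaded_def by blast
  then show ?thesis using assms unfolding proper_def by (auto intro!: eff_INT eff_mem_eq)
qed

lemma cond_decide:
  assumes condition: "condition D Q A" and c: "c \<in> Q"
  shows "\<exists>A'. finite A' \<and> dcover A' \<and> (\<forall>\<beta>\<in>A'. proper \<beta> \<and> hom c \<beta> \<and>
    (\<exists>\<alpha>\<in>A. extends \<alpha> \<beta> \<and> decided c good bnd \<alpha> \<beta>)) \<and> eff_closed D (Q \<inter> (\<Inter>\<beta>\<in>A'. {c. hom c \<beta>}))"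
proof -
  from decide[of A c good bnd] assms obtain A' where A': "finite A'" "dcover A'"
    "\<forall>\<beta>\<in>A'. proper \<beta> \<and> hom c \<beta> \<and> (\<exists>\<alpha>\<in>A. extends \<alpha> \<beta> \<and> decided c good bnd \<alpha> \<beta>)"
    unfolding condition_def by blast
  have "eff_closed D (Q \<inter> (\<Inter>\<beta>\<in>A'. {c. hom c \<beta>}))"
    using condition A' unfolding condition_def by (intro eff_Int eff_INT eff_hom) auto
  with A' show ?thesis by blast
qed

text \<open>If \<open>G \<subseteq> F\<close>, a leaf of \<open>F\<close> inside \<open>G\<close> is
  a leaf of \<open>G\<close>, so the condition says that no leaf of \<open>G\<close> has remained a
  leaf. Nonemptiness of \<open>F\<close> makes this meaningful for empty \<open>G\<close>.\<close>

definition grows :: "bool list set \<Rightarrow> bool list set \<Rightarrow> bool" where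
  "grows G F \<longleftrightarrow> F \<noteq> {} \<and> (\<forall>x. leaf F x \<longrightarrow> x \<notin> G)"

lemma ce_grows:
  assumes "finite G"
  shows "semidecidable D (Suc 0) (\<lambda>e. grows G (strs (arg 0 e)))"
proof -
  have *: "grows G F \<longleftrightarrow> (\<exists>x\<in>F. True) \<and> (\<forall>x\<in>F. (\<forall>y\<in>F. prefix x y \<longrightarrow> x = y) \<longrightarrow> x \<notin> G)" for F
    unfolding grows_def leaf_def by blast
  show ?thesis unfolding *
    by (intro ce_dec dec_conj dec_strs_bex dec_strs_ball dec_imp dec_not dec_const dec_prefix dec_strs_eq
        dec_dstr_mem cf_vr assms) (simp_all add: cf_vr)
qed

lemma grows_mono:
  assumes "grows G H" "G \<subseteq> H" "H \<subseteq> F"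
  shows "grows G F"
  using assms unfolding grows_def leaf_def by blast

text \<open>Candidates are decided at one state \<open>c\<close>. Having grown persists in all
  larger trees. Being unable to grow is a closed condition on states which holds at
  \<open>c\<close>, so it can be imposed on the whole class without emptying it.\<close>

lemma grow_step:
  assumes condition: "condition D Q A"
  shows "\<exists>Q' A'. condition D Q' A' \<and> (\<forall>\<beta>\<in>A'. \<exists>\<alpha>\<in>A. pot Q' \<beta> \<subseteq> pot Q \<alpha> \<and>
    ((\<forall>F\<in>pot Q' \<beta>. grows (nodes \<alpha>) F) \<or> (\<forall>F\<in>pot Q' \<beta>. \<not> grows (nodes \<alpha>) F)))"
proof -
  from condition obtain c where c: "c \<in> Q" unfolding condition_def by blast
  from cond_decide[OF condition c, of grows "\<lambda>_. 0"] obtain A' where A': "finite A'" "dcover A'"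
    "\<And>\<beta>. \<beta> \<in> A' \<Longrightarrow> proper \<beta> \<and> hom c \<beta> \<and> (\<exists>\<alpha>\<in>A. extends \<alpha> \<beta> \<and> decided c grows (\<lambda>_. 0) \<alpha> \<beta>)"
    "eff_closed D (Q \<inter> (\<Inter>\<beta>\<in>A'. {c. hom c \<beta>}))" by blast
  define dead where "dead = {\<beta> \<in> A'. \<forall>F. valid \<beta> c F \<longrightarrow> \<not> grows (nodes \<beta>) F}"
  define N where "N \<beta> = {c. \<forall>F. valid \<beta> c F \<longrightarrow> \<not> grows (nodes \<beta>) F}" for \<beta>
  define Q' where "Q' = Q \<inter> (\<Inter>\<beta>\<in>A'. {c. hom c \<beta>}) \<inter> (\<Inter>\<beta>\<in>dead. N \<beta>)"
  have "eff_closed D (N \<beta>)" if "\<beta> \<in> A'" for \<beta>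
  proof -
    have fin: "finite (nodes \<beta>)" "finite (tips \<beta>)" "finite (addrs \<beta>)"
      using A'(3)[OF that] unfolding proper_def by auto
    have "N \<beta> = {c. \<forall>F. valid \<beta> c F \<longrightarrow> \<not> grows (nodes \<beta>) (strs (finset_code F))}"
      unfolding N_def by (auto simp: valid_def)
    then show ?thesis using eff_avoid[OF fin ce_grows[OF fin(1)]] by simp
  qed
  then have "eff_closed D Q'" unfolding Q'_def using A'(1) by (intro eff_Int[OF A'(4)] eff_INT) (auto simp: dead_def)
  moreover have "c \<in> Q'" unfolding Q'_def N_def dead_def using c A'(3) by blast
  ultimately have "condition D Q' A'" using A' unfolding condition_def Q'_def by blast
  moreover have "\<exists>\<alpha>\<in>A. pot Q' \<beta> \<subseteq> pot Q \<alpha> \<and>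
    ((\<forall>F\<in>pot Q' \<beta>. grows (nodes \<alpha>) F) \<or> (\<forall>F\<in>pot Q' \<beta>. \<not> grows (nodes \<alpha>) F))" if \<beta>: "\<beta> \<in> A'" for \<beta>
  proof -
    from A'(3)[OF \<beta>] obtain \<alpha> where \<alpha>: "\<alpha> \<in> A" "extends \<alpha> \<beta>" "decided c grows (\<lambda>_. 0) \<alpha> \<beta>" by blast
    have "pot Q' \<beta> \<subseteq> pot Q \<alpha>" unfolding pot_def Q'_def using extends_valid[OF \<alpha>(2)] by blast
    moreover have "(\<forall>F\<in>pot Q' \<beta>. grows (nodes \<alpha>) F) \<or> (\<forall>F\<in>pot Q' \<beta>. \<not> grows (nodes \<alpha>) F)"
    proof (cases "grows (nodes \<alpha>) (nodes \<beta>)")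
      case True
      have "grows (nodes \<alpha>) F" if "F \<in> pot Q' \<beta>" for F
        using grows_mono[OF True] \<alpha>(2) that unfolding extends_def pot_def valid_def by blast
      then show ?thesis by blast
    next
      case False
      with \<alpha>(3) have d: "nodes \<beta> = nodes \<alpha>" "\<beta> \<in> dead" unfolding decided_def dead_def using \<beta> by auto
      then have "\<not> grows (nodes \<alpha>) F" if "F \<in> pot Q' \<beta>" for F
      proof -
        from that obtain c' where c': "c' \<in> Q'" "valid \<beta> c' F" unfolding pot_def by blast
        with d(2) have "c' \<in> N \<beta>" unfolding Q'_def by blast
        with c'(2) d(1) show ?thesis unfolding N_def by simp
      qed
      then show ?thesis by blast
    qed
    ultimately show ?thesis using \<alpha>(1) by blast
  qed
  ultimately show ?thesis by blast
qed

section \<open>Failure of a program and the use of its oracle\<close>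

definition level_codes :: "nat \<Rightarrow> nat set" where
  "level_codes n = {x. length (dstr x) = n}"

lemma finite_level_codes: "finite (level_codes n)"
  unfolding level_codes_def length_dstr_iff by (rule finite_subset[of _ "{..2 ^ Suc n}"]) auto

text \<open>Trees in \<open>P\<close> do not produce the value at some \<open>n\<close> of an enumeration with bound \<open>k\<close>. This covers
  both wrong outputs and divergence, and it only depends on the set of possible future trees.\<close>

definition missed :: "nat set \<Rightarrow> bool list set \<Rightarrow> orec \<Rightarrow> nat \<Rightarrow> bool list set set \<Rightarrow> bool" where
  "missed D S p k P \<longleftrightarrow> (\<exists>n. \<forall>F\<in>P. \<forall>y. orec_eval (turing_join D (str_code ` F)) p [n] y \<longrightarrow>
     \<not> (card (set_decode y) \<le> k \<and> set_decode y \<inter> str_code ` S \<inter> level_codes n \<noteq> {}))"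

text \<open>A halting computation asks finitely many oracle questions; finitely many subcomputations
  have a common bound on them.\<close>

lemma orec_eval_use:
  assumes "orec_eval A p xs y"
  shows "\<exists>m. \<forall>A'. (\<forall>x<m. x \<in> A \<longleftrightarrow> x \<in> A') \<longrightarrow> orec_eval A' p xs y"
  using assms
proof (induction rule: orec_eval.induct)
  case (eval_Oracle x)
  have "orec_eval A' Oracle [x] (of_bool (x \<in> A))" if "\<forall>y<Suc x. y \<in> A \<longleftrightarrow> y \<in> A'" for A'
    using orec_eval.eval_Oracle[of A' x] that by simp
  then show ?case by blast
next
  case (eval_Comp xs gs ys f z)
  then have len: "length gs = length ys"
    and "\<forall>i<length gs. \<exists>m. \<forall>A'. (\<forall>x<m. x \<in> A \<longleftrightarrow> x \<in> A') \<longrightarrow> orec_eval A' (gs ! i) xs (ys ! i)"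
    by (auto simp: list_all2_conv_all_nth)
  then obtain m where m: "\<And>i A'. i < length gs \<Longrightarrow> (\<forall>x<m i. x \<in> A \<longleftrightarrow> x \<in> A') \<Longrightarrow> orec_eval A' (gs ! i) xs (ys ! i)"
    by metis
  from eval_Comp.IH(2) obtain l where l: "\<And>A'. (\<forall>x<l. x \<in> A \<longleftrightarrow> x \<in> A') \<Longrightarrow> orec_eval A' f ys z" by blast
  have "orec_eval A' (Comp f gs) xs z" if A': "\<forall>x<max l (\<Sum>i<length gs. m i). x \<in> A \<longleftrightarrow> x \<in> A'" for A'
  proof (rule orec_eval.eval_Comp)
    have "orec_eval A' (gs ! i) xs (ys ! i)" if "i < length gs" for i
    proof (rule m[OF that])
      have "m i \<le> (\<Sum>i<length gs. m i)" using that by (intro member_le_sum) auto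
      with A' show "\<forall>x<m i. x \<in> A \<longleftrightarrow> x \<in> A'" by auto
    qed
    then show "list_all2 (\<lambda>g y. orec_eval A' g xs y) gs ys" using len by (auto simp: list_all2_conv_all_nth)
    show "orec_eval A' f ys z" using A' by (intro l) auto
  qed
  then show ?case by blast
next
  case (eval_Prec_Suc f g n xs r y)
  from eval_Prec_Suc.IH obtain m m' where m:
    "\<forall>A'. (\<forall>x<m. x \<in> A \<longleftrightarrow> x \<in> A') \<longrightarrow> orec_eval A' (Prec f g) (n # xs) r"
    "\<forall>A'. (\<forall>x<m'. x \<in> A \<longleftrightarrow> x \<in> A') \<longrightarrow> orec_eval A' g (n # r # xs) y" by blast
  have "orec_eval A' (Prec f g) (Suc n # xs) y" if "\<forall>x<max m m'. x \<in> A \<longleftrightarrow> x \<in> A'" for A'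
  proof (rule orec_eval.eval_Prec_Suc)
    show "orec_eval A' (Prec f g) (n # xs) r" by (rule m(1)[rule_format]) (use that in auto)
    show "orec_eval A' g (n # r # xs) y" by (rule m(2)[rule_format]) (use that in auto)
  qed
  then show ?case by blast
next
  case (eval_Mu f n xs)
  from eval_Mu.IH obtain l where l: "\<And>A'. (\<forall>x<l. x \<in> A \<longleftrightarrow> x \<in> A') \<Longrightarrow> orec_eval A' f (n # xs) 0" by blast
  from eval_Mu.IH have "\<forall>i<n. \<exists>y m. \<forall>A'. (\<forall>x<m. x \<in> A \<longleftrightarrow> x \<in> A') \<longrightarrow> orec_eval A' f (i # xs) (Suc y)"
  proof (intro allI impI)
    fix i assume "i < n"
    with eval_Mu.IH(2) obtain y m where "\<forall>A'. (\<forall>x<m. x \<in> A \<longleftrightarrow> x \<in> A') \<longrightarrow> orec_eval A' f (i # xs) (Suc y)"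
      by meson
    then show "\<exists>y m. \<forall>A'. (\<forall>x<m. x \<in> A \<longleftrightarrow> x \<in> A') \<longrightarrow> orec_eval A' f (i # xs) (Suc y)" by (intro exI)
  qed
  then obtain y m where m: "\<And>i A'. i < n \<Longrightarrow> (\<forall>x<m i. x \<in> A \<longleftrightarrow> x \<in> A') \<Longrightarrow> orec_eval A' f (i # xs) (Suc (y i))"
    by metis
  have "orec_eval A' (Mu f) xs n" if A': "\<forall>x<max l (\<Sum>i<n. m i). x \<in> A \<longleftrightarrow> x \<in> A'" for A'
  proof (rule orec_eval.eval_Mu)
    show "orec_eval A' f (n # xs) 0" using A' by (intro l) auto
    have "orec_eval A' f (i # xs) (Suc (y i))" if "i < n" for i
    proof (rule m[OF that])
      have "m i \<le> (\<Sum>i<n. m i)" using that by (intro member_le_sum) auto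
      with A' show "\<forall>x<m i. x \<in> A \<longleftrightarrow> x \<in> A'" by auto
    qed
    then show "\<forall>i<n. \<exists>y. orec_eval A' f (i # xs) (Suc y)" by blast
  qed
  then show ?case by blast
qed (auto intro: orec_eval.intros)

lemma orec_eval_join_use:
  assumes "orec_eval (turing_join D (str_code ` F)) p xs y"
  shows "\<exists>m. \<forall>F'. (\<forall>s. str_code s < m \<longrightarrow> (s \<in> F \<longleftrightarrow> s \<in> F')) \<longrightarrow> orec_eval (turing_join D (str_code ` F')) p xs y"
proof -
  from orec_eval_use[OF assms] obtain m where m: "\<And>A'. (\<forall>x<m. x \<in> turing_join D (str_code ` F) \<longleftrightarrow> x \<in> A') \<Longrightarrow> orec_eval A' p xs y"
    by blast
  have "orec_eval (turing_join D (str_code ` F')) p xs y"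
    if F': "\<forall>s. str_code s < m \<longrightarrow> (s \<in> F \<longleftrightarrow> s \<in> F')" for F'
  proof (rule m, intro allI impI)
    fix x assume x: "x < m"
    have "n \<in> str_code ` F \<longleftrightarrow> n \<in> str_code ` F'" if "x = 2 * n + 1" for n
    proof -
      have "n \<in> str_code ` H \<longleftrightarrow> dstr n \<in> H" for H by (metis dstr_str_code image_iff str_code_dstr)
      then show ?thesis using F'[rule_format, of "dstr n"] x that by simp
    qed
    then show "x \<in> turing_join D (str_code ` F) \<longleftrightarrow> x \<in> turing_join D (str_code ` F')"
      unfolding turing_join_def by blast
  qed
  then show ?thesis by blast
qed

definition hits :: "nat set \<Rightarrow> bool list set \<Rightarrow> orec \<Rightarrow> bool list set \<Rightarrow> bool" where
  "hits D S p F \<longleftrightarrow> (\<exists>n y. orec_eval (turing_join D (str_code ` F)) p [n] y \<and>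
     set_decode y \<inter> str_code ` S \<inter> level_codes n = {})"

text \<open>The wrong output depends on the tree only up to the use, and a string has a code at
  least as large as its length. So every tree agreeing with \<open>F\<close> on short strings gives
  the same wrong output.\<close>

lemma hits_missed:
  assumes "hits D S p F"
  shows "\<exists>m. \<forall>P. (\<forall>F'\<in>P. \<forall>s. length s < m \<longrightarrow> (s \<in> F \<longleftrightarrow> s \<in> F')) \<longrightarrow> missed D S p k P"
proof -
  from assms obtain n y where y: "orec_eval (turing_join D (str_code ` F)) p [n] y"
    "set_decode y \<inter> str_code ` S \<inter> level_codes n = {}" unfolding hits_def by blast
  from orec_eval_join_use[OF y(1)] obtain m where
    m: "\<And>F'. (\<forall>s. str_code s < m \<longrightarrow> (s \<in> F \<longleftrightarrow> s \<in> F')) \<Longrightarrow> orec_eval (turing_join D (str_code ` F')) p [n] y"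
    by blast
  have "missed D S p k P" if P: "\<forall>F'\<in>P. \<forall>s. length s < m \<longrightarrow> (s \<in> F \<longleftrightarrow> s \<in> F')" for P
    unfolding missed_def
  proof (intro exI[of _ n] ballI allI impI)
    fix F' y' assume "F' \<in> P" and y': "orec_eval (turing_join D (str_code ` F')) p [n] y'"
    have "orec_eval (turing_join D (str_code ` F')) p [n] y"
      using P \<open>F' \<in> P\<close> length_le_str_code by (intro m) (meson order_le_less_trans)
    then have "y' = y" using y' orec_eval_functional by blast
    then show "\<not> (card (set_decode y') \<le> k \<and> set_decode y' \<inter> str_code ` S \<inter> level_codes n \<noteq> {})"
      using y(2) by blast
  qed
  then show ?thesis by blast
qed


lemma computes_bounded_enumerationI:
  assumes "computable_in D g" "\<And>n. card (set_decode (g n)) \<le> d"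
    "\<And>n. set_decode (g n) \<inter> str_code ` S \<inter> level_codes n \<noteq> {}"
  shows "computes_bounded_enumeration D S"
proof -
  have "l_enumeration d S (\<lambda>n. strs (g n))"
    unfolding l_enumeration_def
  proof (intro allI conjI)
    fix n
    have "card (strs (g n)) = card (set_decode (g n))"
      unfolding str_code_strs[symmetric] by (rule card_image[symmetric]) (simp add: inj_on_def)
    then show "card (strs (g n)) \<le> d" using assms(2) by simp
    show "strs (g n) \<inter> S \<inter> {s. length s = n} \<noteq> {}"
      using assms(3)[of n] unfolding strs_def level_codes_def by auto
  qed simp
  then show ?thesis
    unfolding computes_bounded_enumeration_def bounded_enumeration_def using assms(1)
    by (intro exI[of _ "\<lambda>n. strs (g n)"]) auto
qed

section \<open>Candidates over several rows of a state\<close>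

definition lift_addrs :: "nat set \<Rightarrow> cand \<Rightarrow> cand" where
  "lift_addrs E \<alpha> = Cand (nodes \<alpha>) (tips \<alpha>) (shade \<alpha>) {e # j | e j. e \<in> E \<and> j \<in> addrs \<alpha>}"

lemma shaded_lift: "shaded c {e # j | e j. e \<in> E \<and> j \<in> B} k x \<longleftrightarrow> (\<forall>e\<in>E. shaded (row e c) B k x)"
proof -
  have "(\<forall>j'\<in>{e # j | e j. e \<in> E \<and> j \<in> B}. (pos j' (str_code x) \<in> c) = k) \<longleftrightarrow>
    (\<forall>e\<in>E. \<forall>j\<in>B. (pos (e # j) (str_code x) \<in> c) = k)" by blast
  then show ?thesis unfolding shaded_def pos_Cons_mem .
qed

lemma valid_lift: "e \<in> E \<Longrightarrow> valid (lift_addrs E \<alpha>) c F \<Longrightarrow> valid \<alpha> (row e c) F"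
  unfolding valid_def lift_addrs_def by (auto simp: shaded_lift)

lemma hom_lift: "hom c (lift_addrs E \<alpha>) \<longleftrightarrow> (\<forall>e\<in>E. hom (row e c) \<alpha>)"
  unfolding hom_def lift_addrs_def by (auto simp: shaded_lift)

lemma proper_lift: "proper \<alpha> \<Longrightarrow> finite E \<Longrightarrow> E \<noteq> {} \<Longrightarrow> proper (lift_addrs E \<alpha>)"
proof -
  assume *: "proper \<alpha>" "finite E" "E \<noteq> {}"
  have "{e # j | e j. e \<in> E \<and> j \<in> addrs \<alpha>} = (\<lambda>(e, j). e # j) ` (E \<times> addrs \<alpha>)" by auto
  with * show "proper (lift_addrs E \<alpha>)" unfolding proper_def lift_addrs_def by simp
qed

text \<open>Halting is part of the relation, which makes it semidecidable. Its negation covers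
  divergence as well as outputs that leave \<open>e\<close> on level \<open>n\<close>.\<close>

definition inside :: "nat set \<Rightarrow> orec \<Rightarrow> nat \<Rightarrow> nat \<Rightarrow> nat \<Rightarrow> bool" where
  "inside D p n e f \<longleftrightarrow> (\<exists>y. orec_eval (turing_join D (set_decode f)) p [n] y \<and>
     set_decode y \<inter> level_codes n \<subseteq> set_decode e)"

lemma ce_inside:
  assumes "computable_fun D m n" "computable_fun D m e" "computable_fun D m f"
  shows "semidecidable D m (\<lambda>x. inside D p (n x) (e x) (f x))"
proof -
  have *: "set_decode y \<inter> level_codes n \<subseteq> set_decode e \<longleftrightarrow>
     (\<forall>x<y. x \<in> set_decode y \<longrightarrow> length (dstr x) = n \<longrightarrow> x \<in> set_decode e)" for y n e
    unfolding level_codes_def using mem_set_decode_less by auto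
  show ?thesis
    unfolding inside_def *
    by (intro ce_ex ce_conj ce_orec_eval ce_dec dec_all dec_imp dec_mem dec_length cf_vr cf_tl assms) simp_all
qed

text \<open>On level \<open>n\<close>, an output of size at most \<open>k\<close> would be contained
  in some \<open>e \<in> E\<close>. But the tree is valid for \<open>\<beta>\<close> in row
  \<open>e\<close>, and there outputs inside \<open>e\<close> are excluded.\<close>

lemma missed_lift:
  assumes cov: "\<And>Y. Y \<subseteq> level_codes n \<Longrightarrow> card Y \<le> k \<Longrightarrow> \<exists>e\<in>E. Y \<subseteq> set_decode e"
    and Q: "\<And>c e F. c \<in> Q \<Longrightarrow> e \<in> E \<Longrightarrow> valid \<beta> (row e c) F \<Longrightarrow> \<not> inside D p n e (finset_code F)"
  shows "missed D S p k (pot Q (lift_addrs E \<beta>))"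
  unfolding missed_def
proof (intro exI[of _ n] ballI allI impI notI, elim conjE)
  fix F y assume "F \<in> pot Q (lift_addrs E \<beta>)"
    and y: "orec_eval (turing_join D (str_code ` F)) p [n] y" "card (set_decode y) \<le> k"
  then obtain c where c: "c \<in> Q" "valid (lift_addrs E \<beta>) c F" unfolding pot_def by blast
  have "card (set_decode y \<inter> level_codes n) \<le> k"
    using y(2) by (meson card_mono finite_set_decode inf_le1 order.trans)
  with cov obtain e where e: "e \<in> E" "set_decode y \<inter> level_codes n \<subseteq> set_decode e"
    by (meson inf_le2)
  have "finite F" using c(2) unfolding valid_def by blast
  then have "inside D p n e (finset_code F)"
    unfolding inside_def using y(1) e(2) by (auto simp: set_decode_finset_code)
  then show False using Q[OF c(1) e(1)] valid_lift[OF e(1) c(2)] by blast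
qed

text \<open>Pigeonhole: if every \<open>\<beta>\<close> left some set \<open>Y \<beta>\<close> of size at most \<open>k\<close> uncovered, then the choice
  made at the union of all \<open>Y \<beta>\<close> would be contradictory.\<close>

lemma covering_choice:
  fixes A :: "'a set" and w :: "nat \<Rightarrow> 'a" and X :: "nat set"
  assumes "finite A" "finite X"
    and w: "\<And>e. set_decode e \<subseteq> X \<Longrightarrow> card (set_decode e) \<le> k * card A \<Longrightarrow> w e \<in> A"
  shows "\<exists>\<beta>\<in>A. \<forall>Y\<subseteq>X. card Y \<le> k \<longrightarrow>
    (\<exists>e. set_decode e \<subseteq> X \<and> card (set_decode e) \<le> k * card A \<and> w e = \<beta> \<and> Y \<subseteq> set_decode e)"
proof (rule ccontr)
  assume "\<not> ?thesis"
  then have "\<forall>\<beta>\<in>A. \<exists>Y. Y \<subseteq> X \<and> card Y \<le> k \<and>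
    (\<forall>e. set_decode e \<subseteq> X \<longrightarrow> card (set_decode e) \<le> k * card A \<longrightarrow> w e = \<beta> \<longrightarrow> \<not> Y \<subseteq> set_decode e)"
    by meson
  then obtain Y where Y: "\<And>\<beta>. \<beta> \<in> A \<Longrightarrow> Y \<beta> \<subseteq> X \<and> card (Y \<beta>) \<le> k \<and>
    (\<forall>e. set_decode e \<subseteq> X \<longrightarrow> card (set_decode e) \<le> k * card A \<longrightarrow> w e = \<beta> \<longrightarrow> \<not> Y \<beta> \<subseteq> set_decode e)"
    by metis
  define e where "e = set_encode (\<Union>\<beta>\<in>A. Y \<beta>)"
  have "finite (\<Union>\<beta>\<in>A. Y \<beta>)" using assms(2) Y by (intro finite_subset[OF _ assms(2)]) blast
  then have e: "set_decode e = (\<Union>\<beta>\<in>A. Y \<beta>)" unfolding e_def by simp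
  have "card (\<Union>\<beta>\<in>A. Y \<beta>) \<le> (\<Sum>\<beta>\<in>A. card (Y \<beta>))" by (rule card_UN_le[OF assms(1)])
  also have "\<dots> \<le> (\<Sum>\<beta>\<in>A. k)" using Y by (intro sum_mono) blast
  finally have "card (set_decode e) \<le> k * card A" unfolding e by (simp add: mult.commute)
  moreover have "set_decode e \<subseteq> X" unfolding e using Y by blast
  ultimately show False using w[of e] Y[of "w e"] e by blast
qed

text \<open>A candidate that can be extended to produce a wrong output at \<open>c\<close> has been
  so extended, and the use protects that output. For the candidates in \<open>dead\<close>, every
  output at \<open>c\<close> meets \<open>S\<close> on its level. This correctness at the single
  state \<open>c\<close> is what would turn the search for sets \<open>e\<close> into an enumeration
  of \<open>S\<close>, and for this \<open>c\<close> has to remain in \<open>Q1\<close>.\<close>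

lemma miss_step:
  assumes condition: "condition D Q A" and S: "\<not> computes_bounded_enumeration D S"
  shows "\<exists>Q' A'. condition D Q' A' \<and> (\<forall>\<beta>\<in>A'. \<exists>\<alpha>\<in>A. pot Q' \<beta> \<subseteq> pot Q \<alpha> \<and> missed D S p k (pot Q' \<beta>))"
proof -
  from condition obtain c where c: "c \<in> Q" unfolding condition_def by blast
  have "\<forall>F. \<exists>m. hits D S p F \<longrightarrow> (\<forall>P. (\<forall>F'\<in>P. \<forall>s. length s < m \<longrightarrow> (s \<in> F \<longleftrightarrow> s \<in> F')) \<longrightarrow> missed D S p k P)"
  proof
    fix F
    show "\<exists>m. hits D S p F \<longrightarrow> (\<forall>P. (\<forall>F'\<in>P. \<forall>s. length s < m \<longrightarrow> (s \<in> F \<longleftrightarrow> s \<in> F')) \<longrightarrow> missed D S p k P)"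
    proof (cases "hits D S p F")
      case True
      from hits_missed[OF this, of k] show ?thesis by (elim exE) (rule exI, rule impI)
    qed simp
  qed
  from choice[OF this] obtain bnd where bnd': "\<forall>F. hits D S p F \<longrightarrow>
      (\<forall>P. (\<forall>F'\<in>P. \<forall>s. length s < bnd F \<longrightarrow> (s \<in> F \<longleftrightarrow> s \<in> F')) \<longrightarrow> missed D S p k P)"
    by (elim exE)
  have bnd: "missed D S p k P" if "hits D S p F"
    "\<And>F' s. F' \<in> P \<Longrightarrow> length s < bnd F \<Longrightarrow> s \<in> F \<longleftrightarrow> s \<in> F'" for F P
    using bnd'[THEN spec, THEN mp, OF that(1), THEN spec, of P] that(2) by simp
  from cond_decide[OF condition c, of "\<lambda>_. hits D S p" bnd] obtain A' where A': "finite A'" "dcover A'"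
    "\<And>\<beta>. \<beta> \<in> A' \<Longrightarrow> proper \<beta> \<and> hom c \<beta> \<and> (\<exists>\<alpha>\<in>A. extends \<alpha> \<beta> \<and> decided c (\<lambda>_. hits D S p) bnd \<alpha> \<beta>)"
    "eff_closed D (Q \<inter> (\<Inter>\<beta>\<in>A'. {c. hom c \<beta>}))" by blast
  define Q1 where "Q1 = Q \<inter> (\<Inter>\<beta>\<in>A'. {c. hom c \<beta>})"
  have c1: "c \<in> Q1" unfolding Q1_def using c A'(3) by blast
  define dead where "dead = {\<beta> \<in> A'. \<forall>F. valid \<beta> c F \<longrightarrow> \<not> hits D S p F}"
  have dead: "finite dead" "\<And>\<beta>. \<beta> \<in> dead \<Longrightarrow> finite (nodes \<beta>) \<and> finite (tips \<beta>) \<and> finite (addrs \<beta>)"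
    unfolding dead_def using A'(1,3) by (auto simp: proper_def)
  \<comment> \<open>The bound comes from \<open>covering_choice\<close>: one uncovered set of size
    at most \<open>k\<close> for each candidate.\<close>
  define d where "d = k * card A'"
  have "\<exists>n. \<forall>e. card (set_decode e) \<le> d \<longrightarrow>
    (\<exists>c\<in>Q1. \<forall>\<beta>\<in>dead. \<forall>F. valid \<beta> c F \<longrightarrow> \<not> inside D p n e (finset_code F))"
  proof (rule ccontr)
    assume n: "\<not> ?thesis"
    \<comment> \<open>\<open>H n e\<close> says that no state of \<open>Q1\<close> keeps all
      candidates of \<open>dead\<close> from giving an output inside \<open>e\<close>, an emptiness
      statement and hence enumerable. Applied to \<open>c\<close>, it provides an output inside
      \<open>e\<close>, which meets \<open>S\<close>, so \<open>e\<close> does too.\<close>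
    define H where "H n e \<longleftrightarrow> card (set_decode e) \<le> d \<and>
      (\<forall>c\<in>Q1. \<exists>\<beta>\<in>dead. \<exists>F. valid \<beta> c F \<and> inside D p n e (finset_code F))" for n e
    have "semidecidable D 2 (\<lambda>x. \<forall>c\<in>Q1. \<exists>\<beta>\<in>dead. \<exists>F. valid \<beta> c F \<and>
        (\<lambda>f x. inside D p (arg 0 x) (arg (Suc 0) x) f) (finset_code F) x)"
      by (rule ce_avoid_empty[OF A'(4)[folded Q1_def] dead])
        (auto intro!: ce_inside cf_vr)
    then have "semidecidable D 2 (\<lambda>x. H (arg 0 x) (arg (Suc 0) x))"
      unfolding H_def by (intro ce_conj ce_dec[OF dec_le] cf_card_decode cf_const cf_vr) simp_all
    moreover have "\<exists>e. H n e" for n using n unfolding H_def by blast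
    ultimately obtain g where g: "computable_in D g" "\<And>n. H n (g n)"
      using ce_uniformize[of D H] by blast
    have "set_decode (g n) \<inter> str_code ` S \<inter> level_codes n \<noteq> {}" for n
    proof
      assume e: "set_decode (g n) \<inter> str_code ` S \<inter> level_codes n = {}"
      from g(2)[of n] c1 obtain \<beta> F where \<beta>: "\<beta> \<in> dead" "valid \<beta> c F" "inside D p n (g n) (finset_code F)"
        unfolding H_def by blast
      then have "finite F" unfolding valid_def by blast
      with \<beta>(3) e have "hits D S p F"
        unfolding inside_def hits_def by (fastforce simp: set_decode_finset_code)
      with \<beta> show False unfolding dead_def by blast
    qed
    with g have "computes_bounded_enumeration D S"
      unfolding H_def by (intro computes_bounded_enumerationI[of D g d]) auto
    with S show False by contradiction
  qed
  then obtain n where "\<forall>e. \<exists>c. card (set_decode e) \<le> d \<longrightarrow>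
    c \<in> Q1 \<and> (\<forall>\<beta>\<in>dead. \<forall>F. valid \<beta> c F \<longrightarrow> \<not> inside D p n e (finset_code F))" by blast
  from choice[OF this] obtain C where C: "\<And>e. card (set_decode e) \<le> d \<Longrightarrow> C e \<in> Q1"
    "\<And>e \<beta> F. card (set_decode e) \<le> d \<Longrightarrow> \<beta> \<in> dead \<Longrightarrow> valid \<beta> (C e) F \<Longrightarrow> \<not> inside D p n e (finset_code F)"
    by blast
  \<comment> \<open>Restriction to subsets of level \<open>n\<close> leaves finitely many rows to be
    constrained.\<close>
  define \<E> where "\<E> = {e. card (set_decode e) \<le> d \<and> set_decode e \<subseteq> level_codes n}"
  have "\<E> \<subseteq> set_encode ` Pow (level_codes n)"
    unfolding \<E>_def by (auto intro!: image_eqI[of _ _ "set_decode _"])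
  then have fin\<E>: "finite \<E>" by (rule finite_subset) (simp add: finite_level_codes)
  define N where "N e \<beta> = {c. \<forall>F. valid \<beta> c F \<longrightarrow> \<not> inside D p n e (finset_code F)}" for e \<beta>
  define Q2 where "Q2 = (\<Inter>e\<in>\<E>. {c. row e c \<in> Q1 \<inter> (\<Inter>\<beta>\<in>dead. N e \<beta>)})"
  have "eff_closed D (N e \<beta>)" if "\<beta> \<in> dead" for e \<beta>
    unfolding N_def using dead(2)[OF that]
    by (intro eff_avoid ce_inside cf_const cf_vr) auto
  then have "eff_closed D Q2"
    unfolding Q2_def using fin\<E> dead(1) A'(4)
    by (intro eff_INT eff_row eff_Int) (auto simp: Q1_def)
  moreover have "Q2 \<noteq> {}"
  proof -
    define c2 where "c2 = {z. snd (prod_decode z) \<in> C (fst (prod_decode z))}"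
    have "row e c2 = C e" for e unfolding row_def c2_def by simp
    then have "c2 \<in> Q2" unfolding Q2_def N_def \<E>_def using C by auto
    then show ?thesis by blast
  qed
  \<comment> \<open>Which rows match a given candidate depends on the guess, so every set
    \<open>E\<close> of rows that covers all possible outputs is provided for in advance.\<close>
  moreover define A2 where "A2 = {lift_addrs E \<beta> | E \<beta>. \<beta> \<in> A' \<and> E \<subseteq> \<E> \<and>
      (\<forall>Y\<subseteq>level_codes n. card Y \<le> k \<longrightarrow> (\<exists>e\<in>E. Y \<subseteq> set_decode e))}"
  have "A2 \<subseteq> (\<lambda>(E, \<beta>). lift_addrs E \<beta>) ` (Pow \<E> \<times> A')" unfolding A2_def by auto
  then have "finite A2" by (rule finite_subset) (simp add: fin\<E> A'(1))
  moreover have "dcover A2"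
    unfolding dcover_def
  proof
    fix y :: "bool list \<Rightarrow> nat list \<Rightarrow> bool"
    \<comment> \<open>Reading the guess in row \<open>e\<close> alone gives a guess for
      \<open>A'\<close>, matched by some candidate \<open>w e\<close>. The rows with the same
      candidate \<open>\<beta>\<close> are then combined into one lifted candidate.\<close>
    have "\<forall>e. \<exists>\<beta>\<in>A'. \<forall>p\<in>tips \<beta>. \<forall>j\<in>addrs \<beta>. y p (e # j) = shade \<beta>"
    proof
      fix e
      show "\<exists>\<beta>\<in>A'. \<forall>p\<in>tips \<beta>. \<forall>j\<in>addrs \<beta>. y p (e # j) = shade \<beta>"
        using A'(2)[unfolded dcover_def, rule_format, of "\<lambda>p j. y p (e # j)"] .
    qed
    then obtain w where w: "\<And>e. w e \<in> A'" "\<And>e p j. p \<in> tips (w e) \<Longrightarrow> j \<in> addrs (w e) \<Longrightarrow> y p (e # j) = shade (w e)"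
      by metis
    from covering_choice[where w = w, OF A'(1) finite_level_codes w(1), of n k, folded d_def]
    obtain \<beta> where \<beta>: "\<beta> \<in> A'" "\<forall>Y\<subseteq>level_codes n. card Y \<le> k \<longrightarrow>
      (\<exists>e. set_decode e \<subseteq> level_codes n \<and> card (set_decode e) \<le> d \<and> w e = \<beta> \<and> Y \<subseteq> set_decode e)"
      by (elim bexE)
    define E where "E = {e \<in> \<E>. w e = \<beta>}"
    have "\<forall>Y\<subseteq>level_codes n. card Y \<le> k \<longrightarrow> (\<exists>e\<in>E. Y \<subseteq> set_decode e)"
      using \<beta>(2) unfolding E_def \<E>_def by blast
    then have "lift_addrs E \<beta> \<in> A2" unfolding A2_def E_def using \<beta>(1) by blast
    moreover have "\<forall>p\<in>tips (lift_addrs E \<beta>). \<forall>j\<in>addrs (lift_addrs E \<beta>). y p j = shade (lift_addrs E \<beta>)"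
      unfolding lift_addrs_def E_def using w(2) by auto
    ultimately show "\<exists>\<alpha>\<in>A2. \<forall>p\<in>tips \<alpha>. \<forall>j\<in>addrs \<alpha>. y p j = shade \<alpha>" by blast
  qed
  moreover have "\<exists>\<alpha>\<in>A. proper \<gamma> \<and> (\<forall>c\<in>Q2. hom c \<gamma>) \<and> pot Q2 \<gamma> \<subseteq> pot Q \<alpha> \<and> missed D S p k (pot Q2 \<gamma>)"
    if \<gamma>: "\<gamma> \<in> A2" for \<gamma>
  proof -
    from \<gamma> obtain E \<beta> where E: "\<gamma> = lift_addrs E \<beta>" "\<beta> \<in> A'" "E \<subseteq> \<E>"
      "\<And>Y. Y \<subseteq> level_codes n \<Longrightarrow> card Y \<le> k \<Longrightarrow> \<exists>e\<in>E. Y \<subseteq> set_decode e"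
      unfolding A2_def by blast
    \<comment> \<open>Covering the empty output already forces \<open>E\<close> to be nonempty; one
      row is enough to compare the possible trees with those of \<open>\<beta>\<close>.\<close>
    from E(4)[of "{}"] obtain e0 where e0: "e0 \<in> E" by auto
    from A'(3)[OF E(2)] obtain \<alpha> where \<alpha>: "\<alpha> \<in> A" "proper \<beta>" "extends \<alpha> \<beta>" "decided c (\<lambda>_. hits D S p) bnd \<alpha> \<beta>" by blast
    have Q2Q1: "row e c' \<in> Q1" "\<beta>' \<in> dead \<Longrightarrow> row e c' \<in> N e \<beta>'" if "c' \<in> Q2" "e \<in> E" for c' e \<beta>'
      using that E(3) unfolding Q2_def by auto
    have "proper \<gamma>" unfolding E(1) using \<alpha>(2) e0 E(3) fin\<E> by (intro proper_lift) (auto intro: finite_subset)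
    moreover have "hom c' \<gamma>" if "c' \<in> Q2" for c'
      unfolding E(1) hom_lift using Q2Q1(1)[OF that] E(2) unfolding Q1_def by blast
    moreover have "pot Q2 \<gamma> \<subseteq> pot Q1 \<beta>"
      unfolding pot_def E(1) using valid_lift[OF e0] Q2Q1(1) e0 by blast
    moreover have "pot Q1 \<beta> \<subseteq> pot Q \<alpha>" unfolding pot_def Q1_def using extends_valid[OF \<alpha>(3)] by blast
    moreover have "missed D S p k (pot Q2 \<gamma>)"
    proof (cases "\<beta> \<in> dead")
      case True
      show ?thesis unfolding E(1)
        using Q2Q1(2)[OF _ _ True] by (intro missed_lift[OF E(4)]) (auto simp: N_def)
    next
      case False
      with \<alpha>(4) E(2) have h: "hits D S p (nodes \<beta>)" "\<forall>p\<in>tips \<beta>. bnd (nodes \<beta>) \<le> length p"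
        unfolding decided_def dead_def by auto
      show ?thesis
      proof (rule bnd[OF h(1)])
        fix F and s :: "bool list" assume "F \<in> pot Q2 \<gamma>" and s: "length s < bnd (nodes \<beta>)"
        then obtain c' where "valid \<beta> c' F" using \<open>pot Q2 \<gamma> \<subseteq> pot Q1 \<beta>\<close> unfolding pot_def by blast
        moreover have "\<not> above (tips \<beta>) s"
          unfolding above_def using h(2) s by (meson leD order.trans prefix_length_le)
        ultimately show "s \<in> nodes \<beta> \<longleftrightarrow> s \<in> F" unfolding valid_def by blast
      qed
    qed
    ultimately show ?thesis using \<alpha>(1) by blast
  qed
  ultimately have "condition D Q2 A2" "\<forall>\<gamma>\<in>A2. \<exists>\<alpha>\<in>A. pot Q2 \<gamma> \<subseteq> pot Q \<alpha> \<and> missed D S p k (pot Q2 \<gamma>)"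
    unfolding condition_def by blast+
  then show ?thesis by blast
qed

subsection \<open>Perfect trees and growth\<close>

instance orec :: countable
  by countable_datatype

text \<open>A shortest element is a root by the common lower bounds. Iterating the choice of two
  immediate successors from it embeds the full binary tree. Every \<open>x\<close> is reached:
  otherwise a longest \<open>s\<close> with \<open>f s\<close> below \<open>x\<close> could be
  prolonged, as \<open>x\<close> lies above one of the successors of \<open>f s\<close>.\<close>

lemma perfectI:
  assumes "T \<noteq> {}"
    and dir: "\<And>x y. x \<in> T \<Longrightarrow> y \<in> T \<Longrightarrow> \<exists>r\<in>T. prefix r x \<and> prefix r y"
    and br: "\<And>x. x \<in> T \<Longrightarrow> \<exists>u\<in>T. \<exists>v\<in>T. \<not> prefix u v \<and> \<not> prefix v u \<and> prefix x u \<and> prefix x v \<and>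
       (\<forall>y\<in>T. prefix x y \<longrightarrow> x = y \<or> prefix u y \<or> prefix v y)"
  shows "infinite_perfect_tree T"
proof -
  obtain r where r: "r \<in> T" "\<And>x. x \<in> T \<Longrightarrow> length r \<le> length x"
    using assms(1) ex_has_least_nat[of "\<lambda>x. x \<in> T" _ length] by (metis ex_in_conv)
  have root: "prefix r x" if "x \<in> T" for x
  proof -
    from dir[OF r(1) that] obtain r' where r': "r' \<in> T" "prefix r' r" "prefix r' x" by blast
    with r(2)[OF r'(1)] have "r' = r" by (auto simp: prefix_def)
    with r'(3) show ?thesis by simp
  qed
  from br obtain u v where uv: "\<And>x. x \<in> T \<Longrightarrow> u x \<in> T \<and> v x \<in> T \<and> \<not> prefix (u x) (v x) \<and> \<not> prefix (v x) (u x) \<and>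
    prefix x (u x) \<and> prefix x (v x) \<and> (\<forall>y\<in>T. prefix x y \<longrightarrow> x = y \<or> prefix (u x) y \<or> prefix (v x) y)"
    by metis
  define ch where "ch x b = (if b then u x else v x)" for x and b :: bool
  define f where "f = foldl ch r"
  have f_snoc: "f (s @ [b]) = ch (f s) b" for s b unfolding f_def by simp
  have fT: "f s \<in> T" for s
    by (induction s rule: rev_induct) (use r(1) uv in \<open>auto simp: f_def ch_def\<close>)
  have ch: "prefix x (ch x b)" "x \<noteq> ch x b" "ch x b \<in> T" "\<not> prefix (ch x b) (ch x (\<not> b))" if "x \<in> T" for x b
    using uv[OF that] unfolding ch_def by (cases b; auto)+
  have mono: "prefix (f s) (f (s @ w))" for s w
  proof (induction w rule: rev_induct)
    case (snoc b w)
    have "prefix (f (s @ w)) (f ((s @ w) @ [b]))" unfolding f_snoc by (rule ch(1)[OF fT])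
    with snoc show ?case by (auto intro: prefix_order.trans)
  qed simp
  have len: "length s \<le> length (f s)" for s
  proof (induction s rule: rev_induct)
    case (snoc b s)
    have "strict_prefix (f s) (f (s @ [b]))" unfolding f_snoc using ch[OF fT] by (simp add: strict_prefix_def)
    with snoc show ?case by (fastforce dest: prefix_length_less)
  qed simp
  have "prefix s t" if "prefix (f s) (f t)" for s t
  proof (rule ccontr)
    assume n: "\<not> prefix s t"
    show False
    proof (cases "prefix t s")
      case True
      with n obtain b w where "s = t @ b # w" by (metis prefix_def append.right_neutral neq_Nil_conv prefix_order.refl)
      then have "prefix (f (t @ [b])) (f s)" using mono[of "t @ [b]" w] by simp
      with that have "prefix (ch (f t) b) (f t)" unfolding f_snoc by (auto intro: prefix_order.trans)
      with ch[OF fT] show False by (metis prefix_order.antisym)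
    next
      case False
      with n have "s \<parallel> t" by (simp add: parallel_def)
      from parallel_decomp[OF this] obtain a b c s' t' where d: "b \<noteq> c" "s = a @ b # s'" "t = a @ c # t'"
        by (elim exE conjE)
      then have c: "c = (\<not> b)" by auto
      have 1: "prefix (ch (f a) b) (f t)"
        using mono[of "a @ [b]" s'] that d(2) unfolding f_snoc by (auto intro: prefix_order.trans)
      have 2: "prefix (ch (f a) (\<not> b)) (f t)"
        using mono[of "a @ [c]" t'] d(3) unfolding f_snoc c by simp
      from prefix_same_cases[OF 1 2] ch(4)[OF fT, of a b] ch(4)[OF fT, of a "\<not> b"] show False by simp
    qed
  qed
  then have iff: "prefix (f s) (f t) \<longleftrightarrow> prefix s t" for s t
    using mono by (auto simp: prefix_def)
  moreover have "bij_betw f UNIV T"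
  proof (rule bij_betwI')
    show "f s = f t \<longleftrightarrow> s = t" for s t
      using iff by (metis prefix_order.antisym prefix_order.refl)
    show "f s \<in> T" for s by (rule fT)
    fix x assume x: "x \<in> T"
    define L where "L = length ` {s. prefix (f s) x}"
    have L: "l \<le> length x" if "l \<in> L" for l
      using that len prefix_length_le unfolding L_def by (fastforce intro: order.trans)
    have "0 \<in> L" unfolding L_def f_def using root[OF x] by (auto intro!: image_eqI[of _ _ "[]"])
    moreover have finL: "finite L" using L by (meson finite_nat_set_iff_bounded_le)
    ultimately have "Max L \<in> L" by (auto intro: Max_in)
    then obtain s where s: "prefix (f s) x" "length s = Max L" unfolding L_def by auto
    have "x = f s"
    proof (rule ccontr)
      assume "x \<noteq> f s"
      with uv[OF fT, of s] x s(1) have "\<exists>b. prefix (f (s @ [b])) x" unfolding f_snoc ch_def by (metis (full_types))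
      then obtain b where "prefix (f (s @ [b])) x" by blast
      then have "length (s @ [b]) \<in> L" unfolding L_def by blast
      with Max_ge[OF finL] s(2) show False by fastforce
    qed
    then show "\<exists>s\<in>UNIV. x = f s" by blast
  qed
  ultimately show ?thesis unfolding infinite_perfect_tree_def by blast
qed

text \<open>Putting a fork on every leaf works because distinct leaves are incomparable, so the
  forks do not interact, and because new nodes lie above leaves, so inner nodes keep their two
  successors.\<close>

lemma grow_tree:
  assumes G: "tree G"
    and u: "\<And>l. leaf G l \<Longrightarrow> prefix l (u l) \<and> prefix l (v l) \<and> \<not> prefix (u l) (v l) \<and> \<not> prefix (v l) (u l)"
    and F: "F = G \<union> {u l | l. leaf G l} \<union> {v l | l. leaf G l}"
  shows "tree F" "\<And>x. leaf F x \<Longrightarrow> x \<notin> G"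
proof -
  have leafD: "x = l" if "leaf G l" "x \<in> G" "prefix l x" for l x
    using that unfolding leaf_def by blast
  have leafG: "l \<in> G" if "leaf G l" for l using that unfolding leaf_def by blast
  have same: "l = l'" if "leaf G l" "leaf G l'" "prefix l y" "prefix l' y" for l l' y
    using prefix_same_cases[OF that(3,4)] leafD[OF that(1)] leafD[OF that(2)] leafG[OF that(1)] leafG[OF that(2)] by blast
  have new: "u l \<notin> G" "v l \<notin> G" "u l \<in> F" "v l \<in> F" if "leaf G l" for l
    using u[OF that] leafD[OF that] unfolding F by (metis, metis) (use that in blast)+
  have cases: "(\<And>x. x \<in> G \<Longrightarrow> P x) \<Longrightarrow> (\<And>l. leaf G l \<Longrightarrow> P (u l)) \<Longrightarrow> (\<And>l. leaf G l \<Longrightarrow> P (v l)) \<Longrightarrow> x \<in> F \<Longrightarrow> P x" for P x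
    unfolding F by blast
  have below: "x \<in> G \<or> (\<exists>l. leaf G l \<and> prefix l x \<and> (x = u l \<or> x = v l))" if "x \<in> F" for x
    using that u unfolding F by blast
  have below': "\<exists>g\<in>G. prefix g x" if "x \<in> F" for x
    using below[OF that] leafG by blast
  have "\<exists>r\<in>F. prefix r x \<and> prefix r y" if "x \<in> F" "y \<in> F" for x y
  proof -
    from below'[OF that(1)] below'[OF that(2)] obtain g h where "g \<in> G" "prefix g x" "h \<in> G" "prefix h y" by blast
    moreover from this G obtain r where "r \<in> G" "prefix r g" "prefix r h" unfolding tree_def by blast
    ultimately show ?thesis unfolding F by (intro bexI[of _ r]) (auto intro: prefix_order.trans)
  qed
  moreover have "(\<forall>y\<in>F. prefix x y \<longrightarrow> x = y) \<or>
       (\<exists>u\<in>F. \<exists>v\<in>F. \<not> prefix u v \<and> \<not> prefix v u \<and> prefix x u \<and> prefix x v \<and>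
          (\<forall>y\<in>F. prefix x y \<longrightarrow> x = y \<or> prefix u y \<or> prefix v y))" if x: "x \<in> F" for x
  proof (cases "x \<in> G")
    case True
    show ?thesis
    proof (cases "leaf G x")
      case l: True
      have "x = y \<or> prefix (u x) y \<or> prefix (v x) y" if "y \<in> F" "prefix x y" for y
      proof (cases "y \<in> G")
        case True
        then show ?thesis using leafD[OF l] that(2) by blast
      next
        case False
        with below[OF that(1)] obtain l' where "leaf G l'" "prefix l' y" "y = u l' \<or> y = v l'" by blast
        moreover from this have "l' = x" using same[OF _ l _ that(2)] by blast
        ultimately show ?thesis by auto
      qed
      then show ?thesis using u[OF l] new[OF l] by (intro disjI2 bexI[of _ "u x"] bexI[of _ "v x"]) auto
    next
      case nl: False
      then have "\<not> (\<forall>y\<in>G. prefix x y \<longrightarrow> x = y)" using True unfolding leaf_def by blast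
      with G True obtain a b where ab: "a \<in> G" "b \<in> G" "\<not> prefix a b" "\<not> prefix b a" "prefix x a" "prefix x b"
          "\<And>y. y \<in> G \<Longrightarrow> prefix x y \<Longrightarrow> x = y \<or> prefix a y \<or> prefix b y"
        unfolding tree_def by blast
      have "x = y \<or> prefix a y \<or> prefix b y" if "y \<in> F" "prefix x y" for y
      proof (cases "y \<in> G")
        case False
        with below[OF that(1)] obtain l where l: "leaf G l" "prefix l y" by blast
        have "x \<noteq> l" using nl l(1) by blast
        moreover from prefix_same_cases[OF that(2) l(2)] have "prefix x l"
          using leafD[OF l(1) True] by auto
        ultimately have "prefix a l \<or> prefix b l" using ab(7)[OF leafG[OF l(1)]] by blast
        with l(2) show ?thesis by (auto intro: prefix_order.trans)
      qed (use ab(7) that in blast)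
      with ab show ?thesis unfolding F by (intro disjI2 bexI[of _ a] bexI[of _ b]) auto
    qed
  next
    case False
    with below[OF x] obtain l where l: "leaf G l" "prefix l x" "x = u l \<or> x = v l" by blast
    have "x = y" if y: "y \<in> F" "prefix x y" for y
    proof -
      have ly: "prefix l y" using l(2) y(2) by (rule prefix_order.trans)
      have "y \<notin> G"
      proof
        assume "y \<in> G"
        then have "y = l" using leafD[OF l(1)] ly by blast
        then have "x = l" using l(2) y(2) by (simp add: prefix_order.antisym)
        then show False using leafG[OF l(1)] False by blast
      qed
      with below[OF y(1)] obtain l' where l': "leaf G l'" "prefix l' y" "y = u l' \<or> y = v l'" by blast
      with same[OF l(1) l'(1) ly] have "y = u l \<or> y = v l" by blast
      then show ?thesis using l(3) u[OF l(1)] y(2) by auto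
    qed
    then show ?thesis by blast
  qed
  ultimately show "tree F" unfolding tree_def by blast
  show "x \<notin> G" if "leaf F x" for x
  proof
    assume "x \<in> G"
    with that have "leaf G x" unfolding leaf_def F by blast
    with u[of x] new[of x] that show False unfolding leaf_def by (metis)
  qed
qed

text \<open>Coordinates are added one by one. Either the pattern found so far together with
  \<open>True\<close> at \<open>i\<close> stays dense above \<open>\<sigma>\<close>, or some
  \<open>\<rho>\<close> above \<open>\<sigma>\<close> excludes it; above \<open>\<rho>\<close>
  density of the old pattern then forces \<open>False\<close> at \<open>i\<close>.\<close>

lemma dense_shades:
  fixes \<kappa> :: "bool list \<Rightarrow> 'j \<Rightarrow> bool"
  assumes "finite J"
  shows "\<exists>\<sigma> v. prefix l \<sigma> \<and> (\<forall>\<tau>. prefix \<sigma> \<tau> \<longrightarrow> (\<exists>x. prefix \<tau> x \<and> (\<forall>j\<in>J. \<kappa> x j = v j)))"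
  using assms
proof (induction J rule: finite_induct)
  case empty
  show ?case by auto
next
  case (insert i J)
  then obtain \<sigma> v where \<sigma>: "prefix l \<sigma>" "\<And>\<tau>. prefix \<sigma> \<tau> \<Longrightarrow> \<exists>x. prefix \<tau> x \<and> (\<forall>j\<in>J. \<kappa> x j = v j)" by blast
  show ?case
  proof (cases "\<forall>\<tau>. prefix \<sigma> \<tau> \<longrightarrow> (\<exists>x. prefix \<tau> x \<and> (\<forall>j\<in>J. \<kappa> x j = v j) \<and> \<kappa> x i)")
    case True
    then have "\<forall>\<tau>. prefix \<sigma> \<tau> \<longrightarrow> (\<exists>x. prefix \<tau> x \<and> (\<forall>j\<in>insert i J. \<kappa> x j = (v(i := True)) j))"
      using insert(2) by (auto simp: Ball_def) (metis)
    with \<sigma>(1) show ?thesis by blast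
  next
    case False
    then obtain \<rho> where \<rho>: "prefix \<sigma> \<rho>" "\<And>x. prefix \<rho> x \<Longrightarrow> (\<forall>j\<in>J. \<kappa> x j = v j) \<Longrightarrow> \<not> \<kappa> x i" by blast
    have "\<exists>x. prefix \<tau> x \<and> (\<forall>j\<in>insert i J. \<kappa> x j = (v(i := False)) j)" if "prefix \<rho> \<tau>" for \<tau>
    proof -
      from \<sigma>(2)[of \<tau>] \<rho>(1) that obtain x where x: "prefix \<tau> x" "\<forall>j\<in>J. \<kappa> x j = v j"
        by (meson prefix_order.trans)
      with \<rho>(2)[of x] that have "\<not> \<kappa> x i" by (meson prefix_order.trans)
      with x insert(2) show ?thesis by (intro exI[of _ x]) auto
    qed
    moreover have "prefix l \<rho>" using \<sigma>(1) \<rho>(1) by (rule prefix_order.trans)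
    ultimately show ?thesis by blast
  qed
qed

text \<open>The patterns dense above each string, read as a guess, are matched by some candidate.
  Its color is then dense above suitable extensions of all its tips, simultaneously in all its
  addresses, so a fork of the right color fits on every leaf.\<close>

lemma ex_live_candidate:
  assumes condition: "condition D Q A" and c: "c \<in> Q"
  shows "\<exists>\<alpha>\<in>A. \<exists>F. valid \<alpha> c F \<and> grows (nodes \<alpha>) F"
proof -
  have "finite (\<Union>\<alpha>\<in>A. addrs \<alpha>)" using condition unfolding condition_def proper_def by blast
  from dense_shades[OF this, of _ "\<lambda>x j. pos j (str_code x) \<in> c"]
  have "\<forall>l. \<exists>\<sigma> v. prefix l \<sigma> \<and> (\<forall>\<tau>. prefix \<sigma> \<tau> \<longrightarrow>
    (\<exists>x. prefix \<tau> x \<and> (\<forall>j\<in>\<Union>\<alpha>\<in>A. addrs \<alpha>. (pos j (str_code x) \<in> c) = v j)))" by blast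
  then obtain \<sigma> v where \<sigma>: "\<And>l. prefix l (\<sigma> l)" "\<And>l \<tau>. prefix (\<sigma> l) \<tau> \<Longrightarrow>
    (\<exists>x. prefix \<tau> x \<and> (\<forall>j\<in>\<Union>\<alpha>\<in>A. addrs \<alpha>. (pos j (str_code x) \<in> c) = v l j))" by metis
  from condition obtain \<alpha> where \<alpha>: "\<alpha> \<in> A" "\<forall>p\<in>tips \<alpha>. \<forall>j\<in>addrs \<alpha>. v p j = shade \<alpha>"
    unfolding condition_def dcover_def by blast
  have dense: "\<exists>x. prefix \<tau> x \<and> shaded c (addrs \<alpha>) (shade \<alpha>) x" if "p \<in> tips \<alpha>" "prefix (\<sigma> p) \<tau>" for p \<tau>
    using \<sigma>(2)[OF that(2)] \<alpha> that(1) unfolding shaded_def by blast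
  have pr: "proper \<alpha>" "hom c \<alpha>" using condition c \<alpha>(1) unfolding condition_def by auto
  show ?thesis
  proof (cases "nodes \<alpha> = {}")
    case True
    from pr obtain p where p: "p \<in> tips \<alpha>" unfolding proper_def by blast
    from dense[OF this, of "\<sigma> p"] obtain x where x: "prefix (\<sigma> p) x" "shaded c (addrs \<alpha>) (shade \<alpha>) x" by auto
    then have "prefix p x" using \<sigma>(1) by (meson prefix_order.trans)
    with x p True have "valid \<alpha> c {x}" unfolding valid_def tree_def above_def by auto
    moreover have "grows (nodes \<alpha>) {x}" unfolding grows_def True by simp
    ultimately show ?thesis using \<alpha>(1) by blast
  next
    case False
    have "\<forall>l. \<exists>u v. leaf (nodes \<alpha>) l \<longrightarrow> prefix l u \<and> prefix l v \<and> \<not> prefix u v \<and> \<not> prefix v u \<and>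
       above (tips \<alpha>) u \<and> above (tips \<alpha>) v \<and> shaded c (addrs \<alpha>) (shade \<alpha>) u \<and> shaded c (addrs \<alpha>) (shade \<alpha>) v"
    proof
      fix l
      show "\<exists>u v. leaf (nodes \<alpha>) l \<longrightarrow> prefix l u \<and> prefix l v \<and> \<not> prefix u v \<and> \<not> prefix v u \<and>
       above (tips \<alpha>) u \<and> above (tips \<alpha>) v \<and> shaded c (addrs \<alpha>) (shade \<alpha>) u \<and> shaded c (addrs \<alpha>) (shade \<alpha>) v"
      proof (cases "leaf (nodes \<alpha>) l")
        case True
        with pr obtain p where p: "p \<in> tips \<alpha>" "prefix l p" unfolding proper_def by blast
        \<comment> \<open>Starting the two searches from extensions by different bits makes the
          strings found incomparable.\<close>
        from dense[OF p(1), of "\<sigma> p @ [True]"] dense[OF p(1), of "\<sigma> p @ [False]"] obtain u v where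
          uv: "prefix (\<sigma> p @ [True]) u" "prefix (\<sigma> p @ [False]) v"
          "shaded c (addrs \<alpha>) (shade \<alpha>) u" "shaded c (addrs \<alpha>) (shade \<alpha>) v" by auto
        have n: "\<not> prefix u v" "\<not> prefix v u" using uv(1,2) by (auto simp: prefix_def)
        have "prefix p u" "prefix p v" using uv(1,2) \<sigma>(1)[of p] by (auto simp: prefix_def)
        with p uv n show ?thesis unfolding above_def by (meson prefix_order.trans)
      qed simp
    qed
    then obtain u v where uv: "\<And>l. leaf (nodes \<alpha>) l \<Longrightarrow> prefix l (u l) \<and> prefix l (v l) \<and>
       \<not> prefix (u l) (v l) \<and> \<not> prefix (v l) (u l) \<and> above (tips \<alpha>) (u l) \<and> above (tips \<alpha>) (v l) \<and>
       shaded c (addrs \<alpha>) (shade \<alpha>) (u l) \<and> shaded c (addrs \<alpha>) (shade \<alpha>) (v l)"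
      by metis
    define F where "F = nodes \<alpha> \<union> {u l | l. leaf (nodes \<alpha>) l} \<union> {v l | l. leaf (nodes \<alpha>) l}"
    have t: "tree F" "\<And>x. leaf F x \<Longrightarrow> x \<notin> nodes \<alpha>"
      using grow_tree[OF _ _ F_def] pr uv unfolding proper_def by blast+
    have "finite {l. leaf (nodes \<alpha>) l}" using pr unfolding proper_def leaf_def by simp
    then have "finite F" unfolding F_def using pr unfolding proper_def by simp
    with t have "valid \<alpha> c F"
      unfolding valid_def using uv pr(2) unfolding F_def hom_def by blast
    moreover have "grows (nodes \<alpha>) F" unfolding grows_def using t(2) False F_def by blast
    ultimately show ?thesis using \<alpha>(1) by blast
  qed
qed

lemma valid_nodes:
  assumes "condition D Q A" "\<alpha> \<in> A"
  shows "nodes \<alpha> \<in> pot Q \<alpha>"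
  using assms unfolding condition_def pot_def valid_def proper_def hom_def by blast

lemma grow_miss_step:
  assumes condition: "condition D Q A" and S: "\<not> computes_bounded_enumeration D S"
  shows "\<exists>Q' A'. condition D Q' A' \<and> (\<forall>\<beta>\<in>A'. \<exists>\<alpha>\<in>A. pot Q' \<beta> \<subseteq> pot Q \<alpha> \<and> missed D S p k (pot Q' \<beta>) \<and>
    ((\<forall>F\<in>pot Q' \<beta>. grows (nodes \<alpha>) F) \<or> (\<forall>F\<in>pot Q' \<beta>. \<not> grows (nodes \<alpha>) F)))"
proof -
  from grow_step[OF condition] obtain Q1 A1 where 1: "condition D Q1 A1" "\<forall>\<beta>\<in>A1. \<exists>\<alpha>\<in>A. pot Q1 \<beta> \<subseteq> pot Q \<alpha> \<and>
    ((\<forall>F\<in>pot Q1 \<beta>. grows (nodes \<alpha>) F) \<or> (\<forall>F\<in>pot Q1 \<beta>. \<not> grows (nodes \<alpha>) F))" by blast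
  from miss_step[OF 1(1) S, of p k] obtain Q2 A2 where 2: "condition D Q2 A2"
    "\<forall>\<beta>\<in>A2. \<exists>\<alpha>\<in>A1. pot Q2 \<beta> \<subseteq> pot Q1 \<alpha> \<and> missed D S p k (pot Q2 \<beta>)" by blast
  have "\<exists>\<alpha>\<in>A. pot Q2 \<gamma> \<subseteq> pot Q \<alpha> \<and> missed D S p k (pot Q2 \<gamma>) \<and>
    ((\<forall>F\<in>pot Q2 \<gamma>. grows (nodes \<alpha>) F) \<or> (\<forall>F\<in>pot Q2 \<gamma>. \<not> grows (nodes \<alpha>) F))" if \<gamma>: "\<gamma> \<in> A2" for \<gamma>
  proof -
    from 2(2) \<gamma> obtain \<beta> where \<beta>: "\<beta> \<in> A1" "pot Q2 \<gamma> \<subseteq> pot Q1 \<beta>" "missed D S p k (pot Q2 \<gamma>)" by blast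
    from 1(2) \<beta>(1) obtain \<alpha> where "\<alpha> \<in> A" "pot Q1 \<beta> \<subseteq> pot Q \<alpha>"
      "(\<forall>F\<in>pot Q1 \<beta>. grows (nodes \<alpha>) F) \<or> (\<forall>F\<in>pot Q1 \<beta>. \<not> grows (nodes \<alpha>) F)" by blast
    with \<beta> show ?thesis by (intro bexI[of _ \<alpha>]) auto
  qed
  with 2(1) show ?thesis by blast
qed

text \<open>One empty candidate per color suffices: a guess colors the only tip at the only address
  \<open>[]\<close>, which denotes the state itself read as a single coloring.\<close>

lemma initial_cond:
  assumes "Pi01_class D Q" "Q \<noteq> {}"
  shows "condition D {c. (\<lambda>s. str_code s \<in> c) \<in> Q} (range (\<lambda>k. Cand {} {[]} k {[]}))"
proof -
  from assms(2) obtain C where "C \<in> Q" by blast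
  then have "(\<lambda>s. str_code s \<in> str_code ` {s. C s}) \<in> Q" by (simp add: image_iff)
  then have "{c. (\<lambda>s. str_code s \<in> c) \<in> Q} \<noteq> {}" by blast
  moreover have "dcover (range (\<lambda>k. Cand {} {[]} k {[]}))" unfolding dcover_def by auto
  ultimately show ?thesis
    unfolding condition_def using eff_Pi01[OF assms(1)]
    by (auto simp: proper_def hom_def tree_def leaf_def)
qed

section \<open>Colorings for an increasing union of finite trees\<close>

lemma chain_absorbs:
  assumes mono: "\<And>t. G t \<subseteq> (G (Suc t) :: bool list set)"
  shows "\<exists>t. \<forall>x\<in>\<Union>t. G t. str_code x < m \<longrightarrow> x \<in> G t"
proof (induction m)
  case (Suc m)
  then obtain t where t: "\<forall>x\<in>\<Union>t. G t. str_code x < m \<longrightarrow> x \<in> G t" by blast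
  have le: "G t \<subseteq> G t'" if "t \<le> t'" for t t' using lift_Suc_mono_le[of G, OF mono that] .
  show ?case
  proof (cases "dstr m \<in> (\<Union>t. G t)")
    case True
    then obtain t' where "dstr m \<in> G t'" by blast
    then have "\<forall>x\<in>\<Union>t. G t. str_code x < Suc m \<longrightarrow> x \<in> G (max t t')"
      using t le[of t "max t t'"] le[of t' "max t t'"] by (metis dstr_str_code less_Suc_eq max.cobounded1 max.cobounded2 subset_iff)
    then show ?thesis by blast
  next
    case False
    with t show ?thesis by (metis dstr_str_code less_Suc_eq)
  qed
qed simp

text \<open>\<open>W'\<close> adds to \<open>W\<close> the open sets of states that miscolor some
  node of the union. If they covered everything, finitely many of them would, and the nodes
  concerned would already lie in one \<open>G t\<close>, against \<open>ex\<close>.\<close>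

lemma eff_hom_limit:
  assumes "eff_closed D Q" and mono: "\<And>t. G t \<subseteq> G (Suc t)"
    and ex: "\<And>t. \<exists>c\<in>Q. \<forall>x\<in>G t. (str_code x \<in> c) = k"
  shows "\<exists>c\<in>Q. \<forall>x\<in>(\<Union>t. G t). (str_code x \<in> c) = k"
proof (rule ccontr)
  assume n: "\<not> ?thesis"
  from assms(1) obtain W where W: "Q = {c. \<not> obstructed W c}" unfolding eff_closed_def by blast
  define W' where "W' a b \<longleftrightarrow> W a b \<or> (\<exists>x\<in>\<Union>t. G t. str_code x \<in> set_decode (if k then b else a))" for a b
  have z: "set_decode (2 ^ z) = {z}" for z
    using set_encode_inverse[of "{z}"] by (simp add: set_encode_def)
  have "obstructed W' c" for c
  proof (cases "obstructed W c")
    case True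
    then show ?thesis unfolding obstructed_def W'_def by blast
  next
    case False
    with n W obtain x where x: "x \<in> (\<Union>t. G t)" "(str_code x \<in> c) \<noteq> k" by blast
    show ?thesis
      by (rule obstI[where a = "if k then 0 else 2 ^ str_code x" and b = "if k then 2 ^ str_code x else 0"])
        (use x z in \<open>auto simp: W'_def split: if_splits\<close>)
  qed
  then have "\<forall>c. obstructed W' c" by blast
  from this[unfolded obst_compact] obtain m where m: "\<And>w. w < 2 ^ m \<Longrightarrow> \<exists>a b. W' a b \<and> a < 2 ^ m \<and> b < 2 ^ m \<and>
     set_decode a \<subseteq> set_decode w \<and> set_decode b \<inter> set_decode w = {}" by blast
  from chain_absorbs[of G, OF mono] obtain t where
    t: "\<And>x. x \<in> (\<Union>t. G t) \<Longrightarrow> str_code x < m \<Longrightarrow> x \<in> G t" by blast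
  from ex[of t] obtain c where c: "c \<in> Q" "\<forall>x\<in>G t. (str_code x \<in> c) = k" by blast
  define w where "w = set_encode (c \<inter> {..<m})"
  have w: "set_decode w = c \<inter> {..<m}" unfolding w_def by simp
  then have "w < 2 ^ m" by (metis set_decode_subset_lessThan Int_lower2)
  from m[OF this] obtain a b where ab: "W' a b" "a < 2 ^ m" "b < 2 ^ m"
     "set_decode a \<subseteq> c \<inter> {..<m}" "set_decode b \<inter> (c \<inter> {..<m}) = {}" unfolding w by blast
  have bm: "set_decode b \<subseteq> {..<m}" using ab(3) by (simp add: set_decode_subset_lessThan)
  have "\<not> W a b"
  proof
    assume "W a b"
    then have "obstructed W c" by (rule obstI) (use ab bm in auto)
    with c(1) W show False by blast
  qed
  with ab(1) obtain x where x: "x \<in> (\<Union>t. G t)" "str_code x \<in> set_decode (if k then b else a)" unfolding W'_def by blast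
  then have "str_code x < m" using ab(4) bm by (auto split: if_splits)
  with t[OF x(1)] c(2) have "(str_code x \<in> c) = k" by blast
  with x(2) ab(4,5) bm \<open>str_code x < m\<close> show False by (cases k) auto
qed

subsection \<open>The limit\<close>

lemma condition_sequence:
  assumes condition: "condition D Q A" and S: "\<not> computes_bounded_enumeration D S"
  shows "\<exists>\<Q> \<A>. \<Q> 0 = Q \<and> \<A> 0 = A \<and> (\<forall>t. condition D (\<Q> t) (\<A> t) \<and> (\<forall>\<beta>\<in>\<A> (Suc t). \<exists>\<alpha>\<in>\<A> t.
    pot (\<Q> (Suc t)) \<beta> \<subseteq> pot (\<Q> t) \<alpha> \<and> missed D S (p t) (k t) (pot (\<Q> (Suc t)) \<beta>) \<and>
    ((\<forall>F\<in>pot (\<Q> (Suc t)) \<beta>. grows (nodes \<alpha>) F) \<or> (\<forall>F\<in>pot (\<Q> (Suc t)) \<beta>. \<not> grows (nodes \<alpha>) F))))"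
proof -
  define P where "P t x \<longleftrightarrow> condition D (fst x) (snd x) \<and> (t = 0 \<longrightarrow> x = (Q, A))" for t :: nat and x
  define R where "R t x y \<longleftrightarrow> (\<forall>\<beta>\<in>snd y. \<exists>\<alpha>\<in>snd x.
    pot (fst y) \<beta> \<subseteq> pot (fst x) \<alpha> \<and> missed D S (p t) (k t) (pot (fst y) \<beta>) \<and>
    ((\<forall>F\<in>pot (fst y) \<beta>. grows (nodes \<alpha>) F) \<or> (\<forall>F\<in>pot (fst y) \<beta>. \<not> grows (nodes \<alpha>) F)))" for t x y
  have "\<exists>f. \<forall>t. P t (f t) \<and> R t (f t) (f (Suc t))"
  proof (rule dependent_nat_choice)
    show "\<exists>x. P 0 x" unfolding P_def using condition by auto
    fix x t assume "P t x"
    then have "condition D (fst x) (snd x)" unfolding P_def by blast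
    from grow_miss_step[OF this S, of "p t" "k t"] show "\<exists>y. P (Suc t) y \<and> R t x y" unfolding P_def R_def by simp
  qed
  then obtain f where f: "\<And>t. P t (f t)" "\<And>t. R t (f t) (f (Suc t))" by blast
  have "fst (f 0) = Q" "snd (f 0) = A" using f(1)[of 0] unfolding P_def by auto
  moreover have "condition D (fst (f t)) (snd (f t))" for t using f(1) unfolding P_def by blast
  ultimately show ?thesis using f(2) unfolding R_def
    by (intro exI[of _ "\<lambda>t. fst (f t)"], intro exI[of _ "\<lambda>t. snd (f t)"]) blast
qed

text \<open>A candidate of stage \<open>T\<close> that can grow exists at any state of that stage. A
  tree that grows its nodes also grows the smaller trees of its ancestors, so in the alternative
  between all and none each ancestor was of the first kind. This gives finite paths of every length
  for Koenig's lemma.\<close>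

lemma infinite_branch:
  assumes condition: "condition D Q A" and S: "\<not> computes_bounded_enumeration D S"
  shows "\<exists>\<Q> \<pi>. \<Q> 0 = Q \<and> \<pi> 0 \<in> A \<and> (\<forall>t. proper (\<pi> t) \<and> nodes (\<pi> t) \<in> pot (\<Q> t) (\<pi> t) \<and>
    pot (\<Q> (Suc t)) (\<pi> (Suc t)) \<subseteq> pot (\<Q> t) (\<pi> t) \<and>
    missed D S (p t) (k t) (pot (\<Q> (Suc t)) (\<pi> (Suc t))) \<and> grows (nodes (\<pi> t)) (nodes (\<pi> (Suc t))))"
proof -
  from condition_sequence[OF assms, of p k] obtain \<Q> \<A> where st: "\<Q> 0 = Q" "\<A> 0 = A" "\<And>t. condition D (\<Q> t) (\<A> t)"
    "\<And>t \<beta>. \<beta> \<in> \<A> (Suc t) \<Longrightarrow> \<exists>\<alpha>\<in>\<A> t.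
    pot (\<Q> (Suc t)) \<beta> \<subseteq> pot (\<Q> t) \<alpha> \<and> missed D S (p t) (k t) (pot (\<Q> (Suc t)) \<beta>) \<and>
    ((\<forall>F\<in>pot (\<Q> (Suc t)) \<beta>. grows (nodes \<alpha>) F) \<or> (\<forall>F\<in>pot (\<Q> (Suc t)) \<beta>. \<not> grows (nodes \<alpha>) F))"
    by blast
  define R where "R t \<alpha> \<beta> \<longleftrightarrow> pot (\<Q> (Suc t)) \<beta> \<subseteq> pot (\<Q> t) \<alpha> \<and> missed D S (p t) (k t) (pot (\<Q> (Suc t)) \<beta>) \<and>
    (\<forall>F\<in>pot (\<Q> (Suc t)) \<beta>. grows (nodes \<alpha>) F)" for t \<alpha> \<beta>
  have ancestry: "\<exists>\<pi>. \<pi> t = \<alpha> \<and> (\<forall>i\<le>t. \<pi> i \<in> \<A> i) \<and> (\<forall>i<t. R i (\<pi> i) (\<pi> (Suc i)))"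
    if "\<alpha> \<in> \<A> t" "F \<in> pot (\<Q> t) \<alpha>" "grows (nodes \<alpha>) F" for t \<alpha> F
    using that
  proof (induction t arbitrary: \<alpha>)
    case 0
    then show ?case by auto
  next
    case (Suc t \<beta>)
    from st(4)[OF Suc.prems(1)] obtain \<alpha> where \<alpha>: "\<alpha> \<in> \<A> t" "pot (\<Q> (Suc t)) \<beta> \<subseteq> pot (\<Q> t) \<alpha>"
      "missed D S (p t) (k t) (pot (\<Q> (Suc t)) \<beta>)"
      "(\<forall>F\<in>pot (\<Q> (Suc t)) \<beta>. grows (nodes \<alpha>) F) \<or> (\<forall>F\<in>pot (\<Q> (Suc t)) \<beta>. \<not> grows (nodes \<alpha>) F)" by blast
    have "nodes \<beta> \<in> pot (\<Q> t) \<alpha>" using valid_nodes[OF st(3) Suc.prems(1)] \<alpha>(2) by blast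
    then have "nodes \<alpha> \<subseteq> nodes \<beta>" unfolding pot_def valid_def by blast
    with Suc.prems(3) have g: "grows (nodes \<alpha>) F" unfolding grows_def by blast
    with \<alpha> Suc.prems(2) have "R t \<alpha> \<beta>" unfolding R_def by blast
    moreover from Suc.IH[OF \<alpha>(1) _ g] Suc.prems(2) \<alpha>(2) obtain \<pi> where
      "\<pi> t = \<alpha>" "\<forall>i\<le>t. \<pi> i \<in> \<A> i" "\<forall>i<t. R i (\<pi> i) (\<pi> (Suc i))" by blast
    ultimately show ?case using Suc.prems(1)
      by (intro exI[of _ "\<pi>(Suc t := \<beta>)"]) (auto simp: less_Suc_eq le_Suc_eq)
  qed
  have "\<exists>\<pi>. \<forall>t. \<pi> t \<in> \<A> t \<and> R t (\<pi> t) (\<pi> (Suc t))"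
  proof (rule koenig)
    show "finite (\<A> t)" for t using st(3) unfolding condition_def by blast
    fix T
    from st(3)[of T] obtain c where "c \<in> \<Q> T" unfolding condition_def by blast
    with ex_live_candidate[OF st(3)] obtain \<alpha> F where "\<alpha> \<in> \<A> T" "F \<in> pot (\<Q> T) \<alpha>" "grows (nodes \<alpha>) F"
      unfolding pot_def by blast
    from ancestry[OF this] show "\<exists>\<pi>. (\<forall>t\<le>T. \<pi> t \<in> \<A> t) \<and> (\<forall>t<T. R t (\<pi> t) (\<pi> (Suc t)))" by blast
  qed
  then obtain \<pi> where \<pi>: "\<And>t. \<pi> t \<in> \<A> t" "\<And>t. R t (\<pi> t) (\<pi> (Suc t))" by blast
  have "proper (\<pi> t)" "nodes (\<pi> t) \<in> pot (\<Q> t) (\<pi> t)" for t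
    using st(3)[of t] \<pi>(1)[of t] valid_nodes unfolding condition_def by blast+
  then show ?thesis using st(1,2) \<pi> unfolding R_def
    by (intro exI[of _ \<Q>], intro exI[of _ \<pi>]) blast
qed

text \<open>At stage \<open>Suc t\<close> a node of \<open>G t\<close> has ceased to be a leaf and
  has two immediate successors. They are final, since all later nodes lie above leaves of that
  stage.\<close>

lemma perfect_limit:
  assumes tree: "\<And>t. tree (G t)" and mono: "\<And>t t'. t \<le> t' \<Longrightarrow> G t \<subseteq> G t'" and ne: "G 0 \<noteq> {}"
    and grows: "\<And>t. grows (G t) (G (Suc t))"
    and new: "\<And>t t' y. t \<le> t' \<Longrightarrow> y \<in> G t' \<Longrightarrow> y \<in> G t \<or> (\<exists>l. leaf (G t) l \<and> prefix l y)"
  shows "infinite_perfect_tree (\<Union>t. G t)"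
proof (rule perfectI)
  show "(\<Union>t. G t) \<noteq> {}" using ne by blast
next
  fix x y assume "x \<in> (\<Union>t. G t)" "y \<in> (\<Union>t. G t)"
  then obtain t t' where "x \<in> G t" "y \<in> G t'" by blast
  then have "x \<in> G (max t t')" "y \<in> G (max t t')" using mono[of t "max t t'"] mono[of t' "max t t'"] by auto
  with tree[of "max t t'"] show "\<exists>r\<in>\<Union>t. G t. prefix r x \<and> prefix r y" unfolding tree_def by blast
next
  fix x assume "x \<in> (\<Union>t. G t)"
  then obtain t where t: "x \<in> G t" by blast
  define H where "H = G (Suc t)"
  have xH: "x \<in> H" and nl: "\<not> leaf H x"
    using t mono[of t "Suc t"] grows[of t] unfolding H_def grows_def by auto
  with tree[of "Suc t"] obtain u v where uv: "u \<in> H" "v \<in> H" "\<not> prefix u v" "\<not> prefix v u" "prefix x u" "prefix x v"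
    "\<And>y. y \<in> H \<Longrightarrow> prefix x y \<Longrightarrow> x = y \<or> prefix u y \<or> prefix v y"
    unfolding tree_def H_def[symmetric] leaf_def by blast
  have "x = y \<or> prefix u y \<or> prefix v y" if y: "y \<in> (\<Union>t. G t)" "prefix x y" for y
  proof -
    from y(1) obtain t' where "y \<in> G t'" by blast
    then have "y \<in> G (max t' (Suc t))" using mono[of t' "max t' (Suc t)"] by auto
    with new[of "Suc t" "max t' (Suc t)" y] have "y \<in> H \<or> (\<exists>l. leaf H l \<and> prefix l y)" unfolding H_def by simp
    then show ?thesis
    proof
      assume "\<exists>l. leaf H l \<and> prefix l y"
      then obtain l where l: "leaf H l" "prefix l y" by blast
      from prefix_same_cases[OF y(2) l(2)] have "prefix x l"
        using l(1) xH unfolding leaf_def by auto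
      moreover have "x \<noteq> l" using l(1) nl by blast
      ultimately have "prefix u l \<or> prefix v l" using uv(7)[of l] l(1) unfolding leaf_def by blast
      with l(2) show ?thesis by (auto intro: prefix_order.trans)
    qed (use uv(7) y(2) in blast)
  qed
  with uv show "\<exists>u\<in>\<Union>t. G t. \<exists>v\<in>\<Union>t. G t. \<not> prefix u v \<and> \<not> prefix v u \<and> prefix x u \<and> prefix x v \<and>
       (\<forall>y\<in>\<Union>t. G t. prefix x y \<longrightarrow> x = y \<or> prefix u y \<or> prefix v y)"
    unfolding H_def by (intro bexI[of _ u] bexI[of _ v]) auto
qed

lemma missed_limit:
  assumes mono: "\<And>t. G t \<subseteq> G (Suc t)" and P: "\<And>t'. t \<le> t' \<Longrightarrow> G t' \<in> P" and missed: "missed D S p k P"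
    and p: "\<And>n. orec_eval (turing_join D (str_code ` (\<Union>t. G t))) p [n] (finset_code (g n))"
  shows "\<not> l_enumeration k S g"
proof
  assume enum: "l_enumeration k S g"
  from missed obtain n where n: "\<And>F y. F \<in> P \<Longrightarrow> orec_eval (turing_join D (str_code ` F)) p [n] y \<Longrightarrow>
     \<not> (card (set_decode y) \<le> k \<and> set_decode y \<inter> str_code ` S \<inter> level_codes n \<noteq> {})"
    unfolding missed_def by blast
  from orec_eval_join_use[OF p[of n]] obtain m where
    m: "\<And>F'. (\<forall>s. str_code s < m \<longrightarrow> (s \<in> (\<Union>t. G t) \<longleftrightarrow> s \<in> F')) \<Longrightarrow>
      orec_eval (turing_join D (str_code ` F')) p [n] (finset_code (g n))" by blast
  from chain_absorbs[of G m, OF mono] obtain t1 where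
    t1: "\<And>x. x \<in> (\<Union>t. G t) \<Longrightarrow> str_code x < m \<Longrightarrow> x \<in> G t1" by blast
  \<comment> \<open>Stage \<open>t1\<close> agrees with the limit up to the use of the computation,
    and stages from \<open>t\<close> on belong to \<open>P\<close>; the maximum has both
    properties.\<close>
  have sub: "G t1 \<subseteq> G (max t t1)" by (rule lift_Suc_mono_le[of G, OF mono]) simp
  have "orec_eval (turing_join D (str_code ` G (max t t1))) p [n] (finset_code (g n))"
    using t1 sub by (intro m) blast
  from n[OF P this] have 1: "\<not> (card (set_decode (finset_code (g n))) \<le> k \<and>
     set_decode (finset_code (g n)) \<inter> str_code ` S \<inter> level_codes n \<noteq> {})" by simp
  from enum have g: "finite (g n)" "card (g n) \<le> k" "g n \<inter> S \<inter> {s. length s = n} \<noteq> {}"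
    unfolding l_enumeration_def by auto
  from g(1) have sd: "set_decode (finset_code (g n)) = str_code ` g n" by (rule set_decode_finset_code)
  have "card (str_code ` g n) = card (g n)" by (rule card_image) (simp add: inj_on_def)
  moreover from g(3) obtain s where "s \<in> g n" "s \<in> S" "length s = n" by blast
  then have "str_code s \<in> str_code ` g n \<inter> str_code ` S \<inter> level_codes n" unfolding level_codes_def by simp
  ultimately show False using 1 g(2) unfolding sd by auto
qed

theorem theorem4p11:
  fixes D :: "nat set"
    and S :: "bool list set"
    and Q :: "(bool list \<Rightarrow> bool) set"
  assumes "\<not> computes_bounded_enumeration D S"
    and "Pi01_class D Q"
    and "Q \<noteq> {}"
  shows "\<exists>C\<in>Q. \<exists>T. infinite_perfect_tree T \<and> (\<exists>c. \<forall>s\<in>T. C s = c) \<and>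
           \<not> computes_bounded_enumeration (turing_join D (str_code ` T)) S"
proof -
  define Q0 where "Q0 = {c. (\<lambda>s. str_code s \<in> c) \<in> Q}"
  \<comment> \<open>Programs are countable, so every pair of a program and a bound is the
    requirement of some stage.\<close>
  define req :: "nat \<Rightarrow> orec \<times> nat" where "req = from_nat"
  have condition: "condition D Q0 (range (\<lambda>k. Cand {} {[]} k {[]}))"
    unfolding Q0_def using initial_cond assms(2,3) by blast
  from infinite_branch[OF this assms(1), of "\<lambda>t. fst (req t)" "\<lambda>t. snd (req t)"]
  obtain \<Q> \<pi> where \<pi>: "\<Q> 0 = Q0" "\<pi> 0 \<in> range (\<lambda>k. Cand {} {[]} k {[]})" "\<And>t. proper (\<pi> t)"
    "\<And>t. nodes (\<pi> t) \<in> pot (\<Q> t) (\<pi> t)" "\<And>t. pot (\<Q> (Suc t)) (\<pi> (Suc t)) \<subseteq> pot (\<Q> t) (\<pi> t)"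
    "\<And>t. missed D S (fst (req t)) (snd (req t)) (pot (\<Q> (Suc t)) (\<pi> (Suc t)))"
    "\<And>t. grows (nodes (\<pi> t)) (nodes (\<pi> (Suc t)))" by blast
  \<comment> \<open>The shift by one skips the empty tree of stage \<open>0\<close>; growth makes
    all later trees nonempty.\<close>
  define G where "G t = nodes (\<pi> (Suc t))" for t
  define T where "T = (\<Union>t. G t)"
  have pot_le: "pot (\<Q> t') (\<pi> t') \<subseteq> pot (\<Q> t) (\<pi> t)" if "t \<le> t'" for t t'
    using lift_Suc_antimono_le[of "\<lambda>t. pot (\<Q> t) (\<pi> t)", OF \<pi>(5) that] .
  have Gpot: "nodes (\<pi> t') \<in> pot (\<Q> t) (\<pi> t)" if "t \<le> t'" for t t'
    using pot_le[OF that] \<pi>(4) by blast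
  have mono: "G t \<subseteq> G t'" if "t \<le> t'" for t t'
    using Gpot[of "Suc t" "Suc t'"] that unfolding G_def pot_def valid_def by auto
  have ne: "G t \<noteq> {}" for t using \<pi>(7)[of t] unfolding G_def grows_def by blast
  have "infinite_perfect_tree T"
    unfolding T_def
  proof (rule perfect_limit[OF _ mono ne])
    show "tree (G t)" for t using \<pi>(3) unfolding G_def proper_def by blast
    show "grows (G t) (G (Suc t))" for t using \<pi>(7) unfolding G_def .
    fix t t' y assume "t \<le> t'" "y \<in> G t'"
    with Gpot[of "Suc t" "Suc t'"] have "y \<in> G t \<or> above (tips (\<pi> (Suc t))) y"
      unfolding G_def pot_def valid_def by auto
    moreover have "\<exists>l. leaf (G t) l \<and> prefix l y" if "above (tips (\<pi> (Suc t))) y"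
    proof -
      from that obtain q where "q \<in> tips (\<pi> (Suc t))" "prefix q y" unfolding above_def by blast
      with \<pi>(3)[of "Suc t"] ne[of t] obtain l where "leaf (G t) l" "prefix l q"
        unfolding proper_def G_def by blast
      with \<open>prefix q y\<close> show ?thesis by (auto intro: prefix_order.trans)
    qed
    ultimately show "y \<in> G t \<or> (\<exists>l. leaf (G t) l \<and> prefix l y)" by blast
  qed
  moreover have "\<not> computes_bounded_enumeration (turing_join D (str_code ` T)) S"
  proof
    assume "computes_bounded_enumeration (turing_join D (str_code ` T)) S"
    then obtain g k p where g: "l_enumeration k S g"
      "\<And>n. orec_eval (turing_join D (str_code ` T)) p [n] (finset_code (g n))"
      unfolding computes_bounded_enumeration_def bounded_enumeration_def computable_in_def by blast
    obtain t where t: "req t = (p, k)" unfolding req_def by (metis from_nat_to_nat)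
    have "\<not> l_enumeration k S g"
    proof (rule missed_limit)
      show "G t \<subseteq> G (Suc t)" for t by (rule mono) simp
      show "G t' \<in> pot (\<Q> (Suc t)) (\<pi> (Suc t))" if "t \<le> t'" for t'
        unfolding G_def using that by (intro Gpot) simp
      show "missed D S p k (pot (\<Q> (Suc t)) (\<pi> (Suc t)))" using \<pi>(6)[of t] t by simp
      show "orec_eval (turing_join D (str_code ` (\<Union>t. G t))) p [n] (finset_code (g n))" for n
        using g(2) unfolding T_def .
    qed
    with g(1) show False by contradiction
  qed
  moreover have "\<exists>c\<in>Q0. \<forall>x\<in>T. (str_code x \<in> c) = shade (\<pi> 0)"
    unfolding T_def
  proof (rule eff_hom_limit[of D])
    show "eff_closed D Q0" using condition unfolding condition_def by blast
    show "G t \<subseteq> G (Suc t)" for t by (rule mono) simp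
    \<comment> \<open>Every tree on the branch is still among the possible trees of stage
      \<open>0\<close>, where the only address \<open>[]\<close> refers to the coloring
      itself.\<close>
    show "\<exists>c\<in>Q0. \<forall>x\<in>G t. (str_code x \<in> c) = shade (\<pi> 0)" for t
    proof -
      from Gpot[of 0 "Suc t"] obtain c where "c \<in> Q0" "valid (\<pi> 0) c (G t)"
        unfolding pot_def \<pi>(1) G_def by auto
      moreover have "addrs (\<pi> 0) = {[]}" using \<pi>(2) by auto
      ultimately show ?thesis unfolding valid_def shaded_def by auto
    qed
  qed
  then obtain c where "c \<in> Q0" "\<forall>x\<in>T. (str_code x \<in> c) = shade (\<pi> 0)" by blast
  ultimately show ?thesis unfolding Q0_def
    by (intro bexI[of _ "\<lambda>s. str_code s \<in> c"] exI[of _ T] conjI exI[of _ "shade (\<pi> 0)"]) auto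
qed

end
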